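(* For every complete theory $T$ extending $\mathrm{PA}$, the class of countable linear orderings is reducible via $\Delta^{\mathrm{in}}_1$ bi-interpretability to the class of canonical structural $\omega$-jumps of countable models of $T$.
   Context: A class $\mathfrak C$ is reducible via $\Delta^{\mathrm{in}}_1$ bi-interpretability to a class $\mathfrak D$ if there are fixed $L_{\omega_1\omega}$ formulas, each equivalent (in the relevant structures) both to a $\Sigma^{\mathrm{in}}_1$ and to a $\Pi^{\mathrm{in}}_1$ formula, defining the domains, equivalence relations, relations and composition isomorphisms of a bi-interpretation, such that every structure in $\mathfrak C$ is bi-interpretable with some structure in $\mathfrak D$ via these formulas. (Here $\mathcal C$ is interpreted in $\mathcal D$ via relations $Dom\subseteq D^{<\omega}$, an equivalence relation $\sim$ and $\sim$-closed relations with $(Dom,R_0,\dots)/{\sim}\cong\mathcal C$ via a map $f^{\mathcal D}_{\mathcal C}$; a bi-interpretation additionally requires the two compositions $f^{\mathcal C}_{\mathcal D}\circ\tilde f^{\mathcal D}_{\mathcal C}$ and $f^{\mathcal D}_{\mathcal C}\circ\tilde f^{\mathcal C}_{\mathcal D}$ to be definable by such formulas.) The canonical structural $\omega$-jump $\mathcal N_{(\omega)}$ of a structure $\mathcal N$: fix an injective enumeration $(\bar a_i)_{i\in\omega}$ of representatives of the $\omega$-back-and-forth equivalence classes of finite tuples (where $\bar a\leq_0\bar b$ iff they satisfy the same quantifier-free formulas among the first $|\bar a|$, and for $\beta>0$, $\bar a\leq_\beta\bar b$ iff for all $\gamma<\beta$ and finite $\bar d$ there is $\bar c$ with $\bar b\bar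 d\leq_\gamma\bar a\bar c$); $\mathcal N_{(\omega)}$ expands $\mathcal N$ by relations $R_i$ with $\bar b\in R_i\iff\bar a_i\leq_\omega\bar b$.
   Formalization: Linear orderings are nonempty. With canonical ω-jumps indexed by all of ω, the claim is proved for infinite countable orderings (it fails with finite ones included); for all countable orderings it is proved with jumps in which some relations R_i may be empty (class not realized). *)

theory Defs
  imports Main "HOL-Library.Countable_Set" "HOL-Library.Countable" "HOL-Library.Extended_Nat"
begin

section \<open>First-order arithmetic\<close>

text \<open>
  Finitary first-order logic over the language \<open>0, 1, +, \<cdot>, \<le>\<close>, with de Bruijn indices.  Valuations
  are lists: the free variable \<open>i\<close> of a formula evaluated at a tuple \<open>e\<close> denotes \<open>e ! i\<close>.
\<close>

datatype aterm = V nat | Zero | One | Plus aterm aterm | Times aterm aterm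

datatype afm = AEq aterm aterm | ALe aterm aterm | ANeg afm | AAnd afm afm | AEx afm

instance aterm :: countable by countable_datatype
instance afm :: countable by countable_datatype

abbreviation "AImp p q \<equiv> ANeg (AAnd p (ANeg q))"
abbreviation "AIff p q \<equiv> AAnd (AImp p q) (AImp q p)"
abbreviation "AAll p \<equiv> ANeg (AEx (ANeg p))"

text \<open>\<open>aterm_in n\<close>, \<open>afm_in n\<close>: all free variables are among the first \<open>n\<close>.\<close>

primrec aterm_in :: "nat \<Rightarrow> aterm \<Rightarrow> bool" where
  "aterm_in n (V i) \<longleftrightarrow> i < n"
| "aterm_in n Zero \<longleftrightarrow> True"
| "aterm_in n One \<longleftrightarrow> True"
| "aterm_in n (Plus s t) \<longleftrightarrow> aterm_in n s \<and> aterm_in n t"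
| "aterm_in n (Times s t) \<longleftrightarrow> aterm_in n s \<and> aterm_in n t"

primrec afm_in :: "nat \<Rightarrow> afm \<Rightarrow> bool" where
  "afm_in n (AEq s t) \<longleftrightarrow> aterm_in n s \<and> aterm_in n t"
| "afm_in n (ALe s t) \<longleftrightarrow> aterm_in n s \<and> aterm_in n t"
| "afm_in n (ANeg p) \<longleftrightarrow> afm_in n p"
| "afm_in n (AAnd p q) \<longleftrightarrow> afm_in n p \<and> afm_in n q"
| "afm_in n (AEx p) \<longleftrightarrow> afm_in (Suc n) p"

definition asentences :: "afm set" where
  "asentences = {p. afm_in 0 p}"

primrec aqfree :: "afm \<Rightarrow> bool" where
  "aqfree (AEq s t) \<longleftrightarrow> True"
| "aqfree (ALe s t) \<longleftrightarrow> True"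
| "aqfree (ANeg p) \<longleftrightarrow> aqfree p"
| "aqfree (AAnd p q) \<longleftrightarrow> aqfree p \<and> aqfree q"
| "aqfree (AEx p) \<longleftrightarrow> False"

record 'a arith =
  adom :: "'a set"
  azero :: 'a
  aone :: 'a
  aplus :: "'a \<Rightarrow> 'a \<Rightarrow> 'a"
  atimes :: "'a \<Rightarrow> 'a \<Rightarrow> 'a"
  ale :: "'a \<Rightarrow> 'a \<Rightarrow> bool"

definition arith_struct :: "'a arith \<Rightarrow> bool" where
  "arith_struct N \<longleftrightarrow> azero N \<in> adom N \<and> aone N \<in> adom N \<and>
     (\<forall>x\<in>adom N. \<forall>y\<in>adom N. aplus N x y \<in> adom N \<and> atimes N x y \<in> adom N)"

primrec aval :: "'a arith \<Rightarrow> 'a list \<Rightarrow> aterm \<Rightarrow> 'a" where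
  "aval N e (V i) = e ! i"
| "aval N e Zero = azero N"
| "aval N e One = aone N"
| "aval N e (Plus s t) = aplus N (aval N e s) (aval N e t)"
| "aval N e (Times s t) = atimes N (aval N e s) (aval N e t)"

primrec asat :: "'a arith \<Rightarrow> 'a list \<Rightarrow> afm \<Rightarrow> bool" where
  "asat N e (AEq s t) \<longleftrightarrow> aval N e s = aval N e t"
| "asat N e (ALe s t) \<longleftrightarrow> ale N (aval N e s) (aval N e t)"
| "asat N e (ANeg p) \<longleftrightarrow> \<not> asat N e p"
| "asat N e (AAnd p q) \<longleftrightarrow> asat N e p \<and> asat N e q"
| "asat N e (AEx p) \<longleftrightarrow> (\<exists>x\<in>adom N. asat N (x # e) p)"

primrec asubst_tm :: "(nat \<Rightarrow> aterm) \<Rightarrow> aterm \<Rightarrow> aterm" where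
  "asubst_tm \<sigma> (V i) = \<sigma> i"
| "asubst_tm \<sigma> Zero = Zero"
| "asubst_tm \<sigma> One = One"
| "asubst_tm \<sigma> (Plus s t) = Plus (asubst_tm \<sigma> s) (asubst_tm \<sigma> t)"
| "asubst_tm \<sigma> (Times s t) = Times (asubst_tm \<sigma> s) (asubst_tm \<sigma> t)"

definition alift :: "(nat \<Rightarrow> aterm) \<Rightarrow> nat \<Rightarrow> aterm" where
  "alift \<sigma> = case_nat (V 0) (\<lambda>i. asubst_tm (\<lambda>j. V (Suc j)) (\<sigma> i))"

primrec asubst :: "(nat \<Rightarrow> aterm) \<Rightarrow> afm \<Rightarrow> afm" where
  "asubst \<sigma> (AEq s t) = AEq (asubst_tm \<sigma> s) (asubst_tm \<sigma> t)"
| "asubst \<sigma> (ALe s t) = ALe (asubst_tm \<sigma> s) (asubst_tm \<sigma> t)"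
| "asubst \<sigma> (ANeg p) = ANeg (asubst \<sigma> p)"
| "asubst \<sigma> (AAnd p q) = AAnd (asubst \<sigma> p) (asubst \<sigma> q)"
| "asubst \<sigma> (AEx p) = AEx (asubst (alift \<sigma>) p)"

text \<open>
  Induction on the variable \<open>0\<close> of \<open>p\<close>; the other free variables of \<open>p\<close> are parameters.  Note that
  \<open>p(0)\<close> no longer depends on the variable \<open>0\<close>, whereas \<open>p(x + 1)\<close> stays below the quantifier for \<open>x\<close>.
\<close>

definition induction_fm :: "afm \<Rightarrow> afm" where
  "induction_fm p =
     AImp (AAnd (asubst (case_nat Zero V) p)
                (AAll (AImp p (asubst (case_nat (Plus (V 0) One) (\<lambda>i. V (Suc i))) p))))
          (AAll p)"

definition PA :: "afm set" where
  "PA =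
    {AAll (ANeg (AEq (Plus (V 0) One) Zero)),
     AAll (AAll (AImp (AEq (Plus (V 1) One) (Plus (V 0) One)) (AEq (V 1) (V 0)))),
     AAll (AEq (Plus (V 0) Zero) (V 0)),
     AAll (AAll (AEq (Plus (V 1) (Plus (V 0) One)) (Plus (Plus (V 1) (V 0)) One))),
     AAll (AEq (Times (V 0) Zero) Zero),
     AAll (AAll (AEq (Times (V 1) (Plus (V 0) One)) (Plus (Times (V 1) (V 0)) (V 1)))),
     AAll (AAll (AIff (ALe (V 1) (V 0)) (AEx (AEq (Plus (V 2) (V 0)) (V 1)))))}
    \<union> {((\<lambda>q. AAll q) ^^ n) (induction_fm p) | n p. afm_in (Suc n) p}"

definition amodel :: "afm set \<Rightarrow> 'a arith \<Rightarrow> bool" where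
  "amodel T N \<longleftrightarrow> arith_struct N \<and> (\<forall>p\<in>T. asat N [] p)"

text \<open>
  Structures with domain a subset of \<open>nat\<close> represent all countable structures.  By the
  Loewenheim-Skolem theorem, satisfiability and consequence for this countable language are not
  affected by the restriction to countable structures.
\<close>

definition aconsequence :: "afm set \<Rightarrow> afm \<Rightarrow> bool" where
  "aconsequence T p \<longleftrightarrow> (\<forall>N :: nat arith. amodel T N \<longrightarrow> asat N [] p)"

definition complete_theory :: "afm set \<Rightarrow> bool" where
  "complete_theory T \<longleftrightarrow> T \<subseteq> asentences \<and> (\<exists>N :: nat arith. amodel T N) \<and>
     (\<forall>p\<in>asentences. aconsequence T p \<or> aconsequence T (ANeg p))"

definition extends_PA :: "afm set \<Rightarrow> bool" where
  "extends_PA T \<longleftrightarrow> (\<forall>p\<in>PA. aconsequence T p)"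


section \<open>Infinitary logic over relational vocabularies\<close>

text \<open>
  A vocabulary is an arity function on a type of relation symbols.  The formulas of
  \<open>L\<^sub>\<omega>\<^sub>1\<^sub>\<omega>\<close> again use de Bruijn indices, and only finitely many variables occur free
  (see \<open>form_in\<close>).
\<close>

record ('a, 'r) struct =
  dom :: "'a set"
  rel :: "'r \<Rightarrow> 'a list \<Rightarrow> bool"

hide_const (open) Map.dom

definition is_struct :: "('r \<Rightarrow> nat) \<Rightarrow> ('a, 'r) struct \<Rightarrow> bool" where
  "is_struct ar A \<longleftrightarrow> dom A \<noteq> {} \<and>
     (\<forall>r xs. rel A r xs \<longrightarrow> xs \<in> lists (dom A) \<and> length xs = ar r)"

datatype 'r form =
    Bot
  | Eq nat nat
  | Rel 'r "nat list"
  | Neg "'r form"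
  | And "'r form" "'r form"
  | Conj "nat \<Rightarrow> 'r form"
  | Disj "nat \<Rightarrow> 'r form"
  | Ex "'r form"
  | All "'r form"

text \<open>\<open>form_in ar n\<close>: formulas of the vocabulary \<open>ar\<close> with free variables among the first \<open>n\<close>.\<close>

primrec form_in :: "('r \<Rightarrow> nat) \<Rightarrow> nat \<Rightarrow> 'r form \<Rightarrow> bool" where
  "form_in ar n Bot \<longleftrightarrow> True"
| "form_in ar n (Eq i j) \<longleftrightarrow> i < n \<and> j < n"
| "form_in ar n (Rel r is) \<longleftrightarrow> length is = ar r \<and> (\<forall>i\<in>set is. i < n)"
| "form_in ar n (Neg \<phi>) \<longleftrightarrow> form_in ar n \<phi>"
| "form_in ar n (And \<phi> \<psi>) \<longleftrightarrow> form_in ar n \<phi> \<and> form_in ar n \<psi>"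
| "form_in ar n (Conj \<Phi>) \<longleftrightarrow> (\<forall>k. form_in ar n (\<Phi> k))"
| "form_in ar n (Disj \<Phi>) \<longleftrightarrow> (\<forall>k. form_in ar n (\<Phi> k))"
| "form_in ar n (Ex \<phi>) \<longleftrightarrow> form_in ar (Suc n) \<phi>"
| "form_in ar n (All \<phi>) \<longleftrightarrow> form_in ar (Suc n) \<phi>"

primrec sat :: "('a, 'r) struct \<Rightarrow> 'a list \<Rightarrow> 'r form \<Rightarrow> bool" where
  "sat A e Bot \<longleftrightarrow> False"
| "sat A e (Eq i j) \<longleftrightarrow> e ! i = e ! j"
| "sat A e (Rel r is) \<longleftrightarrow> rel A r (map (\<lambda>i. e ! i) is)"
| "sat A e (Neg \<phi>) \<longleftrightarrow> \<not> sat A e \<phi>"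
| "sat A e (And \<phi> \<psi>) \<longleftrightarrow> sat A e \<phi> \<and> sat A e \<psi>"
| "sat A e (Conj \<Phi>) \<longleftrightarrow> (\<forall>k. sat A e (\<Phi> k))"
| "sat A e (Disj \<Phi>) \<longleftrightarrow> (\<exists>k. sat A e (\<Phi> k))"
| "sat A e (Ex \<phi>) \<longleftrightarrow> (\<exists>x\<in>dom A. sat A (x # e) \<phi>)"
| "sat A e (All \<phi>) \<longleftrightarrow> (\<forall>x\<in>dom A. sat A (x # e) \<phi>)"

text \<open>Finitary quantifier-free formulas, that is, the level \<open>\<Sigma>\<^sub>0 = \<Pi>\<^sub>0\<close> of the infinitary hierarchy.\<close>

primrec qfree :: "'r form \<Rightarrow> bool" where
  "qfree Bot \<longleftrightarrow> True"
| "qfree (Eq i j) \<longleftrightarrow> True"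
| "qfree (Rel r is) \<longleftrightarrow> True"
| "qfree (Neg \<phi>) \<longleftrightarrow> qfree \<phi>"
| "qfree (And \<phi> \<psi>) \<longleftrightarrow> qfree \<phi> \<and> qfree \<psi>"
| "qfree (Conj \<Phi>) \<longleftrightarrow> False"
| "qfree (Disj \<Phi>) \<longleftrightarrow> False"
| "qfree (Ex \<phi>) \<longleftrightarrow> False"
| "qfree (All \<phi>) \<longleftrightarrow> False"

definition Sigma1 :: "'r form \<Rightarrow> bool" where
  "Sigma1 \<phi> \<longleftrightarrow> (\<exists>k \<psi>. \<phi> = Disj (\<lambda>i. (Ex ^^ k i) (\<psi> i)) \<and> (\<forall>i. qfree (\<psi> i)))"

definition Pi1 :: "'r form \<Rightarrow> bool" where
  "Pi1 \<phi> \<longleftrightarrow> (\<exists>k \<psi>. \<phi> = Conj (\<lambda>i. (All ^^ k i) (\<psi> i)) \<and> (\<forall>i. qfree (\<psi> i)))"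

text \<open>
  A definition of a relation between finite tuples (of arbitrary lengths) from a structure consists
  of one formula for each list of lengths: the tuples \<open>b\<^sub>1, \<dots>, b\<^sub>k\<close> are related iff their concatenation
  satisfies the formula for \<open>[|b\<^sub>1|, \<dots>, |b\<^sub>k|]\<close>.
\<close>

type_synonym 'r family = "nat list \<Rightarrow> 'r form"

definition holds :: "('a, 'r) struct \<Rightarrow> 'r family \<Rightarrow> 'a list list \<Rightarrow> bool" where
  "holds A \<Phi> bs \<longleftrightarrow> sat A (concat bs) (\<Phi> (map length bs))"

definition equiv_on :: "('a, 'r) struct set \<Rightarrow> nat \<Rightarrow> 'r form \<Rightarrow> 'r form \<Rightarrow> bool" where
  "equiv_on K n \<phi> \<psi> \<longleftrightarrow>
     (\<forall>A\<in>K. \<forall>e\<in>lists (dom A). length e = n \<longrightarrow> (sat A e \<phi> \<longleftrightarrow> sat A e \<psi>))"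

definition Delta1 :: "('r \<Rightarrow> nat) \<Rightarrow> ('a, 'r) struct set \<Rightarrow> 'r family \<Rightarrow> bool" where
  "Delta1 ar K \<Phi> \<longleftrightarrow> (\<forall>ls. let n = sum_list ls in
     form_in ar n (\<Phi> ls) \<and>
     (\<exists>\<sigma>. Sigma1 \<sigma> \<and> form_in ar n \<sigma> \<and> equiv_on K n (\<Phi> ls) \<sigma>) \<and>
     (\<exists>\<pi>. Pi1 \<pi> \<and> form_in ar n \<pi> \<and> equiv_on K n (\<Phi> ls) \<pi>))"


section \<open>Bi-interpretations\<close>

text \<open>
  Formulas over a vocabulary \<open>'r\<close> for the domain, the equivalence relation and the relations of an
  interpretation of a structure with vocabulary \<open>'s\<close>.
\<close>

record ('r, 's) interp =
  dom_fm :: "'r family"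
  eq_fm :: "'r family"
  rel_fm :: "'s \<Rightarrow> 'r family"

definition Delta1_interp ::
  "('r \<Rightarrow> nat) \<Rightarrow> ('a, 'r) struct set \<Rightarrow> ('r, 's) interp \<Rightarrow> bool" where
  "Delta1_interp ar K I \<longleftrightarrow>
     Delta1 ar K (dom_fm I) \<and> Delta1 ar K (eq_fm I) \<and> (\<forall>s. Delta1 ar K (rel_fm I s))"

definition Dom :: "('d, 'r) struct \<Rightarrow> ('r, 's) interp \<Rightarrow> 'd list set" where
  "Dom D I = {b \<in> lists (dom D). holds D (dom_fm I) [b]}"

definition Sim :: "('d, 'r) struct \<Rightarrow> ('r, 's) interp \<Rightarrow> ('d list \<times> 'd list) set" where
  "Sim D I = {(a, b). a \<in> lists (dom D) \<and> b \<in> lists (dom D) \<and> holds D (eq_fm I) [a, b]}"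

definition IRel ::
  "('s \<Rightarrow> nat) \<Rightarrow> ('d, 'r) struct \<Rightarrow> ('r, 's) interp \<Rightarrow> 's \<Rightarrow> 'd list list set" where
  "IRel arC D I s = {bs \<in> lists (lists (dom D)). length bs = arC s \<and> holds D (rel_fm I s) bs}"

text \<open>
  \<open>interprets arC C D I f\<close>: the formulas \<open>I\<close> interpret \<open>C\<close> in \<open>D\<close>, and \<open>f\<close> induces an isomorphism from
  the quotient of \<open>(Dom, R\<^sub>0, R\<^sub>1, \<dots>)\<close> by the equivalence relation onto \<open>C\<close>.
\<close>

definition interprets :: "('s \<Rightarrow> nat) \<Rightarrow> ('c, 's) struct \<Rightarrow> ('d, 'r) struct \<Rightarrow>
    ('r, 's) interp \<Rightarrow> ('d list \<Rightarrow> 'c) \<Rightarrow> bool" where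
  "interprets arC C D I f \<longleftrightarrow>
     equiv (Dom D I) (Sim D I) \<and>
     (\<forall>s. IRel arC D I s \<subseteq> lists (Dom D I)) \<and>
     (\<forall>s. \<forall>as\<in>IRel arC D I s. \<forall>bs. list_all2 (\<lambda>a b. (a, b) \<in> Sim D I) as bs \<longrightarrow> bs \<in> IRel arC D I s) \<and>
     f ` Dom D I = dom C \<and>
     (\<forall>a\<in>Dom D I. \<forall>b\<in>Dom D I. f a = f b \<longleftrightarrow> (a, b) \<in> Sim D I) \<and>
     (\<forall>s. \<forall>bs\<in>lists (Dom D I). length bs = arC s \<longrightarrow> (bs \<in> IRel arC D I s \<longleftrightarrow> rel C s (map f bs)))"

text \<open>
  Given interpretations of \<open>C\<close> in \<open>D\<close> (via \<open>I\<close>, \<open>f\<close>) and of \<open>D\<close> in \<open>C\<close> (via \<open>J\<close>, \<open>g\<close>), the composition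
  of \<open>g\<close> with the extension \<open>map f\<close> of \<open>f\<close> to tuples sends certain tuples of tuples from \<open>D\<close> to elements
  of \<open>D\<close>.  The family \<open>\<Phi>\<close> defines the graph of this partial function in \<open>D\<close>.
\<close>

definition defines_composition :: "('c, 's) struct \<Rightarrow> ('d, 'r) struct \<Rightarrow>
    ('r, 's) interp \<Rightarrow> ('d list \<Rightarrow> 'c) \<Rightarrow> ('s, 'r) interp \<Rightarrow> ('c list \<Rightarrow> 'd) \<Rightarrow> 'r family \<Rightarrow> bool" where
  "defines_composition C D I f J g \<Phi> \<longleftrightarrow>
     (\<forall>bs\<in>lists (lists (dom D)). \<forall>x\<in>dom D.
        holds D \<Phi> (bs @ [[x]]) \<longleftrightarrow>
          bs \<in> lists (Dom D I) \<and> map f bs \<in> Dom C J \<and> g (map f bs) = x)"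

definition bi_interpretation :: "('s \<Rightarrow> nat) \<Rightarrow> ('c, 's) struct \<Rightarrow> ('r \<Rightarrow> nat) \<Rightarrow> ('d, 'r) struct \<Rightarrow>
    ('r, 's) interp \<Rightarrow> ('s, 'r) interp \<Rightarrow> 'r family \<Rightarrow> 's family \<Rightarrow> bool" where
  "bi_interpretation arC C arD D I J \<Phi> \<Psi> \<longleftrightarrow>
     (\<exists>f g. interprets arC C D I f \<and> interprets arD D C J g \<and>
        defines_composition C D I f J g \<Phi> \<and> defines_composition D C J g I f \<Psi>)"

text \<open>
  Reducibility of a class \<open>K\<close> of structures to a class \<open>L\<close>.  The set \<open>L'\<close> contains the members of \<open>L\<close>
  to which the formulas are applied.  The \<open>\<Sigma>\<^sub>1\<close> and \<open>\<Pi>\<^sub>1\<close> equivalents of the formulas are uniform over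
  \<open>L'\<close> and over \<open>K\<close>, respectively.
\<close>

definition reducible_Delta1_biint :: "('s \<Rightarrow> nat) \<Rightarrow> ('c, 's) struct set \<Rightarrow>
    ('r \<Rightarrow> nat) \<Rightarrow> ('d, 'r) struct set \<Rightarrow> bool" where
  "reducible_Delta1_biint arK K arL L \<longleftrightarrow>
     (\<exists>L' I J \<Phi> \<Psi>. L' \<subseteq> L \<and>
        Delta1_interp arL L' I \<and> Delta1 arL L' \<Phi> \<and>
        Delta1_interp arK K J \<and> Delta1 arK K \<Psi> \<and>
        (\<forall>C\<in>K. \<exists>D\<in>L'. bi_interpretation arK C arL D I J \<Phi> \<Psi>))"


section \<open>Canonical structural jumps of models of arithmetic\<close>

text \<open>
  The \<open>i\<close>-th quantifier-free formula; \<open>from_nat_into\<close> enumerates a countably infinite set without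
  repetitions.
\<close>

definition aqf_enum :: "nat \<Rightarrow> afm" where
  "aqf_enum = from_nat_into {p. aqfree p}"

text \<open>
  The asymmetric back-and-forth relations on finite tuples of equal length, for \<open>\<beta> \<le> \<omega>\<close>; the ordinal
  \<open>\<omega>\<close> is \<open>\<infinity> :: enat\<close>.  At level 0, only those of the first \<open>|a|\<close> quantifier-free formulas are
  relevant whose variables are interpreted by the tuples.
\<close>

function bf_le :: "'a arith \<Rightarrow> enat \<Rightarrow> 'a list \<Rightarrow> 'a list \<Rightarrow> bool" where
  "bf_le N \<beta> a b \<longleftrightarrow> length a = length b \<and>
     (if \<beta> = 0
      then \<forall>i<length a. afm_in (length a) (aqf_enum i) \<longrightarrow>
             (asat N a (aqf_enum i) \<longleftrightarrow> asat N b (aqf_enum i))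
      else \<forall>\<gamma>. \<gamma> < \<beta> \<longrightarrow> (\<forall>d\<in>lists (adom N). \<exists>c\<in>lists (adom N). bf_le N \<gamma> (b @ d) (a @ c)))"
  by pat_completeness auto
termination
  by (relation "inv_image {(x, y). x < y} (\<lambda>(_, \<beta>, _). \<beta>)") (auto intro: wf_inv_image wf)

declare bf_le.simps [simp del]

definition bf_equiv_omega :: "'a arith \<Rightarrow> 'a list \<Rightarrow> 'a list \<Rightarrow> bool" where
  "bf_equiv_omega N a b \<longleftrightarrow> bf_le N \<infinity> a b \<and> bf_le N \<infinity> b a"

text \<open>
  Injective enumerations \<open>(a\<^sub>i)\<close>, \<open>i \<in> S\<close>, of representatives of the classes.  The canonical jump has
  \<open>S = UNIV\<close>.
\<close>

definition bf_enumeration :: "'a arith \<Rightarrow> nat set \<Rightarrow> (nat \<Rightarrow> 'a list) \<Rightarrow> bool" where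
  "bf_enumeration N S a \<longleftrightarrow> (\<forall>i\<in>S. a i \<in> lists (adom N)) \<and>
     (\<forall>b\<in>lists (adom N). \<exists>!i. i \<in> S \<and> bf_equiv_omega N (a i) b)"

text \<open>
  Jumps are relational structures, as interpretations require: the operations of arithmetic are
  represented by their graphs.  This does not change which formulas are equivalent to \<open>\<Sigma>\<^sub>1\<close> or
  \<open>\<Pi>\<^sub>1\<close> formulas.
\<close>

datatype jsym = GZero | GOne | GPlus | GTimes | GLe | R nat

primrec jump_ar :: "(nat \<Rightarrow> nat) \<Rightarrow> jsym \<Rightarrow> nat" where
  "jump_ar ar GZero = 1"
| "jump_ar ar GOne = 1"
| "jump_ar ar GPlus = 3"
| "jump_ar ar GTimes = 3"
| "jump_ar ar GLe = 2"
| "jump_ar ar (R i) = ar i"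

primrec jump_rel :: "'a arith \<Rightarrow> nat set \<Rightarrow> (nat \<Rightarrow> 'a list) \<Rightarrow> jsym \<Rightarrow> 'a list set" where
  "jump_rel N S a GZero = {[azero N]}"
| "jump_rel N S a GOne = {[aone N]}"
| "jump_rel N S a GPlus = {[x, y, aplus N x y] | x y. x \<in> adom N \<and> y \<in> adom N}"
| "jump_rel N S a GTimes = {[x, y, atimes N x y] | x y. x \<in> adom N \<and> y \<in> adom N}"
| "jump_rel N S a GLe = {[x, y] | x y. x \<in> adom N \<and> y \<in> adom N \<and> ale N x y}"
| "jump_rel N S a (R i) = (if i \<in> S then {b \<in> lists (adom N). bf_le N \<infinity> (a i) b} else {})"

definition omega_jump :: "'a arith \<Rightarrow> nat set \<Rightarrow> (nat \<Rightarrow> 'a list) \<Rightarrow> ('a, jsym) struct" where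
  "omega_jump N S a = \<lparr>dom = adom N, rel = (\<lambda>s b. b \<in> jump_rel N S a s)\<rparr>"

text \<open>
  The canonical structural \<open>\<omega>\<close>-jumps, in the vocabulary where \<open>R\<^sub>i\<close> has arity \<open>ar i\<close>, of the countable
  models of \<open>T\<close>.
\<close>

definition omega_jumps :: "afm set \<Rightarrow> (nat \<Rightarrow> nat) \<Rightarrow> (nat, jsym) struct set" where
  "omega_jumps T ar = {omega_jump N UNIV a | N a.
     amodel T N \<and> bf_enumeration N UNIV a \<and> (\<forall>i. length (a i) = ar i)}"

text \<open>
  The variant in which the vocabulary may contain symbols \<open>R\<^sub>i\<close>, interpreted by the empty relation, for
  classes that have no member in the given model.  Models realizing different sets of classes can then
  share the names of the classes they have in common, which is impossible when every index has to be
  used in every model.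
\<close>

definition omega_jumps_partial :: "afm set \<Rightarrow> (nat \<Rightarrow> nat) \<Rightarrow> (nat, jsym) struct set" where
  "omega_jumps_partial T ar = {omega_jump N S a | N S a.
     amodel T N \<and> bf_enumeration N S a \<and> (\<forall>i\<in>S. length (a i) = ar i)}"


section \<open>Countable linear orderings\<close>

datatype lsym = Leq

primrec lo_ar :: "lsym \<Rightarrow> nat" where
  "lo_ar Leq = 2"

text \<open>Structures are nonempty, hence so are the linear orderings considered here.\<close>

definition countable_LO :: "(nat, lsym) struct set" where
  "countable_LO = {L. is_struct lo_ar L \<and> linear_order_on (dom L) {(x, y). rel L Leq [x, y]}}"

definition infinite_countable_LO :: "(nat, lsym) struct set" where
  "infinite_countable_LO = {L \<in> countable_LO. infinite (dom L)}"

end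

theory Submission
  imports Defs
begin

text \<open>
  Fix a model \<open>M\<close> of \<open>T\<close> and an ultrafilter \<open>U\<close> on it that contains a definable set thinned out with
  respect to each parameter-free definable function.  Iterating the definable ultrapower by \<open>U\<close> along
  a linear order \<open>L\<close>, as in Gaifman's canonical extensions, gives a model \<open>N(L)\<close> of \<open>T\<close> generated by
  order indiscernibles indexed by \<open>L\<close>; because of the thinning, no other element realizes the type of
  the generators.  In a nonstandard model of PA, \<open>a \<le>\<^sub>\<omega> b\<close> holds iff \<open>a\<close> and \<open>b\<close> realize the same
  complete type: a back-and-forth game whose moves are coded sequences can be won for sequences of
  each standard length, hence, by overspill, for sequences of some nonstandard length.  So the
  relations \<open>R\<^sub>i\<close> of the jump of \<open>N(L)\<close> name complete types.  One of them defines the generators, and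
  by indiscernibility the type of a tuple of elements depends only on the order pattern of the
  generators it is built from.  All formulas of the bi-interpretation are therefore quantifier-free.
\<close>

section \<open>Definability in a model of arithmetic\<close>

text \<open>Recovering the order without quantifiers requires that the generators be all the
  elements of their type, and the threat is an element F(x_1, ..., x_n) built from several
  generators. It is handled one generator at a time: with the smaller arguments fixed, F is, on the
  thin set, either eventually constant in the largest argument, which can then be dropped, or it
  returns to the thin set only as the identity. Only parameter-free definable functions are used in
  N(L). So there are countably many functions to thin for, and an element is named by a function and
  finitely many generators, with no constants from \<open>M\<close> that an order pattern could not
  see. The ultrafilter decides all subsets of \<open>M\<close>, not only the definable ones, so it
  can be iterated without being a definable type. An interpretation may use tuples of all lengths;
  the length of a tuple of generators serves as the name of the function. The composition formula
  stays finite because, for a given function, only finitely many order patterns of its arguments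
  exist.\<close>

primrec tval :: "'a arith \<Rightarrow> (nat \<Rightarrow> 'a) \<Rightarrow> aterm \<Rightarrow> 'a" where
  "tval N \<rho> (V i) = \<rho> i"
| "tval N \<rho> Zero = azero N"
| "tval N \<rho> One = aone N"
| "tval N \<rho> (Plus s t) = aplus N (tval N \<rho> s) (tval N \<rho> t)"
| "tval N \<rho> (Times s t) = atimes N (tval N \<rho> s) (tval N \<rho> t)"

primrec esat :: "'a arith \<Rightarrow> (nat \<Rightarrow> 'a) \<Rightarrow> afm \<Rightarrow> bool" where
  "esat N \<rho> (AEq s t) \<longleftrightarrow> tval N \<rho> s = tval N \<rho> t"
| "esat N \<rho> (ALe s t) \<longleftrightarrow> ale N (tval N \<rho> s) (tval N \<rho> t)"
| "esat N \<rho> (ANeg p) \<longleftrightarrow> \<not> esat N \<rho> p"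
| "esat N \<rho> (AAnd p q) \<longleftrightarrow> esat N \<rho> p \<and> esat N \<rho> q"
| "esat N \<rho> (AEx p) \<longleftrightarrow> (\<exists>x\<in>adom N. esat N (case_nat x \<rho>) p)"

lemma nth_Cons_case_nat: "(!) (x # e) = case_nat x ((!) e)"
  by (rule ext) (simp add: nth_Cons)

lemma aval_tval: "aval N e t = tval N ((!) e) t"
  by (induction t) auto

lemma asat_esat: "asat N e p \<longleftrightarrow> esat N ((!) e) p"
  by (induction p arbitrary: e) (auto simp: aval_tval nth_Cons_case_nat)

lemma tval_cong: "aterm_in n t \<Longrightarrow> (\<And>i. i < n \<Longrightarrow> \<rho> i = \<rho>' i) \<Longrightarrow> tval N \<rho> t = tval N \<rho>' t"
  by (induction t) auto

lemma esat_cong: "afm_in n p \<Longrightarrow> (\<And>i. i < n \<Longrightarrow> \<rho> i = \<rho>' i) \<Longrightarrow> esat N \<rho> p \<longleftrightarrow> esat N \<rho>' p"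
proof (induction p arbitrary: n \<rho> \<rho>')
  case (AEx p)
  have "esat N (case_nat x \<rho>) p = esat N (case_nat x \<rho>') p" for x
    by (rule AEx.IH[of "Suc n"]) (use AEx.prems in \<open>auto split: nat.split\<close>)
  then show ?case by simp
next
  case (AEq s t)
  have "tval N \<rho> s = tval N \<rho>' s" "tval N \<rho> t = tval N \<rho>' t"
    using AEq by (auto intro!: tval_cong)
  then show ?case by simp
next
  case (ALe s t)
  have "tval N \<rho> s = tval N \<rho>' s" "tval N \<rho> t = tval N \<rho>' t"
    using ALe by (auto intro!: tval_cong)
  then show ?case by simp
next
  case (ANeg p)
  have "esat N \<rho> p = esat N \<rho>' p"
    by (rule ANeg.IH[of n]) (use ANeg.prems in auto)
  then show ?case by simp
next
  case (AAnd p q)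
  have "esat N \<rho> p = esat N \<rho>' p" by (rule AAnd.IH(1)[of n]) (use AAnd.prems in auto)
  moreover have "esat N \<rho> q = esat N \<rho>' q" by (rule AAnd.IH(2)[of n]) (use AAnd.prems in auto)
  ultimately show ?case by simp
qed

lemma tval_asubst: "tval N \<rho> (asubst_tm \<sigma> t) = tval N (\<lambda>i. tval N \<rho> (\<sigma> i)) t"
  by (induction t) auto

lemma tval_alift: "tval N (case_nat x \<rho>) (alift \<sigma> i) = case_nat x (\<lambda>i. tval N \<rho> (\<sigma> i)) i"
  by (simp add: alift_def tval_asubst split: nat.split)

lemma esat_asubst: "esat N \<rho> (asubst \<sigma> p) \<longleftrightarrow> esat N (\<lambda>i. tval N \<rho> (\<sigma> i)) p"
  by (induction p arbitrary: \<rho> \<sigma>) (simp_all add: tval_asubst tval_alift)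

lemma aterm_in_mono: "aterm_in n t \<Longrightarrow> n \<le> m \<Longrightarrow> aterm_in m t"
  by (induction t) auto

lemma afm_in_mono: "afm_in n p \<Longrightarrow> n \<le> m \<Longrightarrow> afm_in m p"
proof (induction p arbitrary: n m)
  case (AEx p)
  then show ?case by (metis Suc_le_mono afm_in.simps(5))
qed (use aterm_in_mono in \<open>(simp; blast)+\<close>)

lemma aterm_in_ex: "\<exists>n. aterm_in n t"
proof (induction t)
  case (Plus s t)
  then show ?case by (metis aterm_in.simps(4) aterm_in_mono max.cobounded1 max.cobounded2)
next
  case (Times s t)
  then show ?case by (metis aterm_in.simps(5) aterm_in_mono max.cobounded1 max.cobounded2)
qed auto

lemma afm_in_ex: "\<exists>n. afm_in n p"
proof (induction p)
  case (AEq s t)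
  then show ?case by (metis afm_in.simps(1) aterm_in_ex aterm_in_mono max.cobounded1 max.cobounded2)
next
  case (ALe s t)
  then show ?case by (metis afm_in.simps(2) aterm_in_ex aterm_in_mono max.cobounded1 max.cobounded2)
next
  case (AAnd p q)
  then show ?case by (metis afm_in.simps(4) afm_in_mono max.cobounded1 max.cobounded2)
next
  case (AEx p)
  then show ?case by (metis afm_in.simps(5) afm_in_mono le_SucI le_refl)
qed auto

text \<open>
  \<open>C\<close> is the set of admissible parameters.  Since the predicates live on valuations instead of tuples,
  the rules for quantifiers below need no side conditions on arities.
\<close>

definition pval :: "(nat \<Rightarrow> 'a + nat) \<Rightarrow> (nat \<Rightarrow> 'a) \<Rightarrow> nat \<Rightarrow> 'a" where
  "pval f \<rho> i = (case f i of Inl a \<Rightarrow> a | Inr j \<Rightarrow> \<rho> j)"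

definition defb :: "'a arith \<Rightarrow> 'a set \<Rightarrow> ((nat \<Rightarrow> 'a) \<Rightarrow> bool) \<Rightarrow> bool" where
  "defb N C P \<longleftrightarrow> (\<exists>p f. (\<forall>i a. f i = Inl a \<longrightarrow> a \<in> C) \<and> (\<forall>\<rho>. P \<rho> \<longleftrightarrow> esat N (pval f \<rho>) p))"

definition defn :: "'a arith \<Rightarrow> 'a set \<Rightarrow> ((nat \<Rightarrow> 'a) \<Rightarrow> 'a) \<Rightarrow> bool" where
  "defn N C t \<longleftrightarrow> defb N C (\<lambda>\<rho>. \<rho> 0 = t (\<lambda>i. \<rho> (Suc i)))"

locale arith_full =
  fixes M :: "'a arith"
  assumes adom_UNIV [simp]: "adom M = UNIV"
begin

abbreviation "D \<equiv> defb M"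
abbreviation "DT \<equiv> defn M"

section \<open>Closure of definable predicates and functions under logic and composition\<close>

lemma D_esat: "D C (\<lambda>\<rho>. esat M \<rho> p)"
proof -
  have "pval Inr \<rho> = \<rho>" for \<rho> :: "nat \<Rightarrow> 'a" by (rule ext) (simp add: pval_def)
  then show ?thesis unfolding defb_def by (intro exI[of _ p] exI[of _ Inr]) simp
qed

text \<open>Without parameters the map \<open>f\<close> of a \<open>defb\<close> witness is a
  renaming of variables and can be absorbed into the formula. Parameter-free predicates are
  therefore indexed by the countable type \<open>afm\<close>.\<close>

lemma D_iff_esat: "D {} P \<longleftrightarrow> (\<exists>p. \<forall>\<rho>. P \<rho> \<longleftrightarrow> esat M \<rho> p)"
proof
  assume "D {} P"
  then obtain p f where f: "\<forall>i a. f i \<noteq> Inl a" and p: "\<forall>\<rho>. P \<rho> \<longleftrightarrow> esat M (pval f \<rho>) p"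
    unfolding defb_def by auto
  define g where "g i = projr (f i)" for i
  have "f i = Inr (g i)" for i using f g_def by (cases "f i") auto
  then have "pval f \<rho> = (\<lambda>i. tval M \<rho> ((V \<circ> g) i))" for \<rho> by (auto simp: pval_def)
  then have "\<forall>\<rho>. P \<rho> \<longleftrightarrow> esat M \<rho> (asubst (V \<circ> g) p)" using p by (simp add: esat_asubst)
  then show "\<exists>p. \<forall>\<rho>. P \<rho> \<longleftrightarrow> esat M \<rho> p" by blast
next
  assume "\<exists>p. \<forall>\<rho>. P \<rho> \<longleftrightarrow> esat M \<rho> p"
  then obtain p where "P = (\<lambda>\<rho>. esat M \<rho> p)" by auto
  then show "D {} P" using D_esat by simp
qed

lemma D_mono: "D C P \<Longrightarrow> C \<subseteq> C' \<Longrightarrow> D C' P"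
  unfolding defb_def by blast

lemma DT_mono: "DT C t \<Longrightarrow> C \<subseteq> C' \<Longrightarrow> DT C' t"
  unfolding defn_def by (rule D_mono)

lemma D_neg: "D C P \<Longrightarrow> D C (\<lambda>\<rho>. \<not> P \<rho>)"
proof -
  assume "D C P"
  then obtain p f where "\<forall>i a. f i = Inl a \<longrightarrow> a \<in> C" "\<forall>\<rho>. P \<rho> \<longleftrightarrow> esat M (pval f \<rho>) p"
    unfolding defb_def by auto
  then show ?thesis unfolding defb_def by (intro exI[of _ "ANeg p"] exI[of _ f]) simp
qed

lemma D_conj:
  assumes "D C P" "D C Q"
  shows "D C (\<lambda>\<rho>. P \<rho> \<and> Q \<rho>)"
proof -
  obtain p f where f: "\<forall>i a. f i = Inl a \<longrightarrow> a \<in> C" "\<forall>\<rho>. P \<rho> \<longleftrightarrow> esat M (pval f \<rho>) p"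
    using assms(1) unfolding defb_def by auto
  obtain q g where g: "\<forall>i a. g i = Inl a \<longrightarrow> a \<in> C" "\<forall>\<rho>. Q \<rho> \<longleftrightarrow> esat M (pval g \<rho>) q"
    using assms(2) unfolding defb_def by auto
  \<comment> \<open>The two witnesses may use the same slot for different parameters, so the first
    is moved to the even slots and the second to the odd ones.\<close>
  define h where "h i = (if even i then f (i div 2) else g (i div 2))" for i
  let ?e = "\<lambda>i::nat. V (2 * i)" and ?o = "\<lambda>i::nat. V (2 * i + 1)"
  have "(\<lambda>i. tval M (pval h \<rho>) (?e i)) = pval f \<rho>" "(\<lambda>i. tval M (pval h \<rho>) (?o i)) = pval g \<rho>" for \<rho>
    by (auto simp: pval_def h_def)
  then have "\<forall>\<rho>. P \<rho> \<and> Q \<rho> \<longleftrightarrow> esat M (pval h \<rho>) (AAnd (asubst ?e p) (asubst ?o q))"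
    using f g by (simp add: esat_asubst)
  moreover have "\<forall>i a. h i = Inl a \<longrightarrow> a \<in> C" using f g by (simp add: h_def)
  ultimately show ?thesis unfolding defb_def by blast
qed

lemma D_ex:
  assumes "D C (\<lambda>\<rho>. P (\<rho> 0) (\<lambda>i. \<rho> (Suc i)))"
  shows "D C (\<lambda>\<rho>. \<exists>x. P x \<rho>)"
proof -
  obtain p f where f: "\<forall>i a. f i = Inl a \<longrightarrow> a \<in> C"
    "\<And>\<rho>. P (\<rho> 0) (\<lambda>i. \<rho> (Suc i)) \<longleftrightarrow> esat M (pval f \<rho>) p"
    using assms unfolding defb_def by auto
  \<comment> \<open>All slots that read the quantified variable become \<open>V 0\<close>; for them
    the value of \<open>g\<close>, which is \<open>Inr 0\<close> as \<open>0 - 1 = 0\<close>, is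
    never read.\<close>
  define \<sigma> where "\<sigma> i = (if f i = Inr 0 then V 0 else V (Suc i))" for i
  define g where "g i = (case f i of Inl a \<Rightarrow> Inl a | Inr j \<Rightarrow> Inr (j - 1))" for i
  have "(\<lambda>i. tval M (case_nat x (pval g \<rho>)) (\<sigma> i)) = pval f (case_nat x \<rho>)" for x \<rho>
    by (rule ext) (auto simp: \<sigma>_def pval_def g_def split: sum.split nat.split)
  moreover have "P x \<rho> \<longleftrightarrow> esat M (pval f (case_nat x \<rho>)) p" for x \<rho>
    using f(2)[of "case_nat x \<rho>"] by simp
  ultimately have "\<forall>\<rho>. (\<exists>x. P x \<rho>) \<longleftrightarrow> esat M (pval g \<rho>) (AEx (asubst \<sigma> p))"
    by (simp add: esat_asubst)
  moreover have "\<forall>i a. g i = Inl a \<longrightarrow> a \<in> C" using f by (auto simp: g_def split: sum.splits)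
  ultimately show ?thesis unfolding defb_def by blast
qed

lemma D_disj:
  assumes "D C P" "D C Q"
  shows "D C (\<lambda>\<rho>. P \<rho> \<or> Q \<rho>)"
proof -
  have "D C (\<lambda>\<rho>. \<not> (\<not> P \<rho> \<and> \<not> Q \<rho>))" by (intro D_neg D_conj assms)
  then show ?thesis by simp
qed

lemma D_imp:
  assumes "D C P" "D C Q"
  shows "D C (\<lambda>\<rho>. P \<rho> \<longrightarrow> Q \<rho>)"
proof -
  have "D C (\<lambda>\<rho>. \<not> P \<rho> \<or> Q \<rho>)" by (intro D_neg D_disj assms)
  then show ?thesis by simp
qed

lemma D_iff:
  assumes "D C P" "D C Q"
  shows "D C (\<lambda>\<rho>. P \<rho> \<longleftrightarrow> Q \<rho>)"
proof -
  have "D C (\<lambda>\<rho>. (P \<rho> \<longrightarrow> Q \<rho>) \<and> (Q \<rho> \<longrightarrow> P \<rho>))" by (intro D_conj D_imp assms)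
  then show ?thesis by (simp only: iff_conv_conj_imp)
qed

lemma D_all:
  assumes "D C (\<lambda>\<rho>. P (\<rho> 0) (\<lambda>i. \<rho> (Suc i)))"
  shows "D C (\<lambda>\<rho>. \<forall>x. P x \<rho>)"
proof -
  have "D C (\<lambda>\<rho>. \<not> (\<exists>x. \<not> P x \<rho>))" by (intro D_neg D_ex assms)
  then show ?thesis by simp
qed

lemma D_True: "D C (\<lambda>\<rho>. True)"
  using D_esat[of C "AEq Zero Zero"] by simp

lemma D_bool: "D C (\<lambda>\<rho>. b)"
  using D_True[of C] D_neg[OF D_True, of C] by (cases b) simp_all

lemma D_all_list: "(\<And>x. x \<in> set xs \<Longrightarrow> D C (P x)) \<Longrightarrow> D C (\<lambda>\<rho>. \<forall>x\<in>set xs. P x \<rho>)"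
proof (induction xs)
  case Nil
  show ?case using D_True by simp
next
  case (Cons x xs)
  have "D C (\<lambda>\<rho>. P x \<rho> \<and> (\<forall>x\<in>set xs. P x \<rho>))" by (rule D_conj) (use Cons in simp_all)
  then show ?case by simp
qed

lemma DT_var: "DT C (\<lambda>\<rho>. \<rho> i)"
  unfolding defn_def using D_esat[of C "AEq (V 0) (V (Suc i))"] by simp

lemma DT_const: "c \<in> C \<Longrightarrow> DT C (\<lambda>\<rho>. c)"
  unfolding defn_def defb_def
  by (intro exI[of _ "AEq (V 0) (V 1)"] exI[of _ "\<lambda>i. if i = 0 then Inr 0 else Inl c"])
    (auto simp: pval_def)

lemma D_rename: "D C P \<Longrightarrow> D C (\<lambda>\<rho>. P (\<lambda>i. \<rho> (g i)))"
proof -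
  assume "D C P"
  then obtain p f where f: "\<forall>i a. f i = Inl a \<longrightarrow> a \<in> C" "\<forall>\<rho>. P \<rho> \<longleftrightarrow> esat M (pval f \<rho>) p"
    unfolding defb_def by auto
  have "pval f (\<lambda>i. \<rho> (g i)) = pval (\<lambda>i. map_sum id g (f i)) \<rho>" for \<rho>
    by (rule ext) (auto simp: pval_def split: sum.split)
  moreover have "\<forall>i a. map_sum id g (f i) = Inl a \<longrightarrow> a \<in> C"
  proof (intro allI impI)
    fix i a assume "map_sum id g (f i) = Inl a"
    then show "a \<in> C" using f by (cases "f i") auto
  qed
  ultimately show ?thesis unfolding defb_def using f
    by (intro exI[of _ p] exI[of _ "\<lambda>i. map_sum id g (f i)"]) simp
qed

lemma DT_rename: "DT C t \<Longrightarrow> DT C (\<lambda>\<rho>. t (\<lambda>i. \<rho> (g i)))"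
  unfolding defn_def using D_rename[of C _ "\<lambda>i. case i of 0 \<Rightarrow> 0 | Suc i \<Rightarrow> Suc (g i)"] by fastforce

lemma DT_shift: "DT C t \<Longrightarrow> DT C (\<lambda>\<rho>. t (\<lambda>i. \<rho> (Suc i)))"
  by (rule DT_rename)

text \<open>A function is given by its graph only, so substitution goes through an existential
  quantifier.\<close>

lemma D_subst1:
  assumes "DT C t" "D C (\<lambda>\<rho>. P (\<rho> 0) (\<lambda>i. \<rho> (Suc i)))"
  shows "D C (\<lambda>\<rho>. P (t \<rho>) \<rho>)"
proof -
  have "D C (\<lambda>\<rho>. \<exists>x. x = t \<rho> \<and> P x \<rho>)"
    by (rule D_ex, rule D_conj) (use assms in \<open>auto simp: defn_def\<close>)
  then show ?thesis by simp
qed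

lemma D_eq: "DT C s \<Longrightarrow> DT C t \<Longrightarrow> D C (\<lambda>\<rho>. s \<rho> = t \<rho>)"
  by (rule D_subst1[of C s "\<lambda>x \<rho>. x = t \<rho>"]) (auto simp: defn_def)

lemma D_le: "DT C s \<Longrightarrow> DT C t \<Longrightarrow> D C (\<lambda>\<rho>. ale M (s \<rho>) (t \<rho>))"
  apply (rule D_subst1[of C s "\<lambda>x \<rho>. ale M x (t \<rho>)"], assumption)
  apply (rule D_subst1[of C "\<lambda>\<rho>. t (\<lambda>i. \<rho> (Suc i))" "\<lambda>x \<rho>. ale M (\<rho> 0) x"], erule DT_shift)
  using D_esat[of C "ALe (V 1) (V 0)"] by simp

lemma DT_subst1:
  assumes "DT C t" "DT C (\<lambda>\<rho>. u (\<rho> 0) (\<lambda>i. \<rho> (Suc i)))"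
  shows "DT C (\<lambda>\<rho>. u (t \<rho>) \<rho>)"
proof -
  have "D C (\<lambda>\<rho>. \<rho> 1 = u (\<rho> 0) (\<lambda>i. \<rho> (Suc (Suc i))))"
    using D_eq[OF DT_var DT_rename[OF assms(2), of "\<lambda>i. case i of 0 \<Rightarrow> 0 | Suc i \<Rightarrow> Suc (Suc i)"], of 1]
    by simp
  from D_subst1[OF DT_shift[OF assms(1)], where P="\<lambda>x \<rho>. \<rho> 0 = u x (\<lambda>i. \<rho> (Suc i))"] this
  show ?thesis unfolding defn_def by simp
qed

lemma DT_plus: "DT C s \<Longrightarrow> DT C t \<Longrightarrow> DT C (\<lambda>\<rho>. aplus M (s \<rho>) (t \<rho>))"
  apply (rule DT_subst1[of C s "\<lambda>x \<rho>. aplus M x (t \<rho>)"], assumption)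
  apply (rule DT_subst1[of C "\<lambda>\<rho>. t (\<lambda>i. \<rho> (Suc i))" "\<lambda>x \<rho>. aplus M (\<rho> 0) x"], erule DT_shift)
  unfolding defn_def using D_esat[of C "AEq (V 0) (Plus (V 2) (V 1))"] by (simp add: numeral_2_eq_2)

lemma DT_times: "DT C s \<Longrightarrow> DT C t \<Longrightarrow> DT C (\<lambda>\<rho>. atimes M (s \<rho>) (t \<rho>))"
  apply (rule DT_subst1[of C s "\<lambda>x \<rho>. atimes M x (t \<rho>)"], assumption)
  apply (rule DT_subst1[of C "\<lambda>\<rho>. t (\<lambda>i. \<rho> (Suc i))" "\<lambda>x \<rho>. atimes M (\<rho> 0) x"], erule DT_shift)
  unfolding defn_def using D_esat[of C "AEq (V 0) (Times (V 2) (V 1))"] by (simp add: numeral_2_eq_2)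

lemma DT_zero: "DT C (\<lambda>\<rho>. azero M)"
  unfolding defn_def using D_esat[of C "AEq (V 0) Zero"] by simp

lemma DT_one: "DT C (\<lambda>\<rho>. aone M)"
  unfolding defn_def using D_esat[of C "AEq (V 0) One"] by simp

lemma DT_tval: "(\<And>i. DT C (f i)) \<Longrightarrow> DT C (\<lambda>\<rho>. tval M (\<lambda>i. f i \<rho>) t)"
  by (induction t) (auto intro: DT_zero DT_one DT_plus DT_times)

lemma D_esat_comp: "(\<And>i. DT C (f i)) \<Longrightarrow> D C (\<lambda>\<rho>. esat M (\<lambda>i. f i \<rho>) p)"
proof (induction p arbitrary: f)
  case (AEx p)
  let ?g = "\<lambda>i. case i of 0 \<Rightarrow> (\<lambda>\<rho>. \<rho> 0) | Suc i \<Rightarrow> (\<lambda>\<rho>. f i (\<lambda>i. \<rho> (Suc i)))"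
  have "D C (\<lambda>\<rho>. esat M (\<lambda>i. ?g i \<rho>) p)"
    by (rule AEx.IH) (auto intro!: DT_var DT_shift AEx.prems split: nat.split)
  moreover have "(\<lambda>i. ?g i \<rho>) = case_nat (\<rho> 0) (\<lambda>i. f i (\<lambda>i. \<rho> (Suc i)))" for \<rho>
    by (rule ext) (simp split: nat.split)
  ultimately have "D C (\<lambda>\<rho>. \<exists>x. esat M (case_nat x (\<lambda>i. f i \<rho>)) p)" by (intro D_ex) simp
  then show ?case by simp
qed (auto intro!: D_eq D_le D_neg D_conj DT_tval)

lemma D_comp:
  assumes "D C P" "\<And>i. DT C (f i)"
  shows "D C (\<lambda>\<rho>. P (\<lambda>i. f i \<rho>))"
proof -
  obtain p g where g: "\<forall>i a. g i = Inl a \<longrightarrow> a \<in> C" "\<forall>\<rho>. P \<rho> \<longleftrightarrow> esat M (pval g \<rho>) p"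
    using assms(1) unfolding defb_def by auto
  have "D C (\<lambda>\<rho>. esat M (\<lambda>i. (case g i of Inl a \<Rightarrow> (\<lambda>_. a) | Inr j \<Rightarrow> f j) \<rho>) p)"
    by (rule D_esat_comp) (use g assms(2) in \<open>auto intro: DT_const split: sum.split\<close>)
  moreover have "(\<lambda>i. (case g i of Inl a \<Rightarrow> (\<lambda>_. a) | Inr j \<Rightarrow> f j) \<rho>) = pval g (\<lambda>i. f i \<rho>)" for \<rho>
    by (rule ext) (simp add: pval_def split: sum.split)
  ultimately show ?thesis using g(2) by simp
qed

lemma DT_comp:
  assumes "DT C t" "\<And>i. DT C (f i)"
  shows "DT C (\<lambda>\<rho>. t (\<lambda>i. f i \<rho>))"
proof -
  have "D C (\<lambda>\<rho>. (\<lambda>\<rho>. \<rho> 0 = t (\<lambda>i. \<rho> (Suc i)))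
      (\<lambda>i. (case i of 0 \<Rightarrow> (\<lambda>\<rho>. \<rho> 0) | Suc i \<Rightarrow> (\<lambda>\<rho>. f i (\<lambda>i. \<rho> (Suc i)))) \<rho>))"
    by (rule D_comp) (use assms in \<open>auto simp: defn_def[of M C t] intro!: DT_var DT_shift split: nat.split\<close>)
  then show ?thesis unfolding defn_def by simp
qed

lemma D_rel1: "D C (\<lambda>\<rho>. Q (\<rho> 0)) \<Longrightarrow> DT C s \<Longrightarrow> D C (\<lambda>\<rho>. Q (s \<rho>))"
  using D_comp[of C "\<lambda>\<rho>. Q (\<rho> 0)" "\<lambda>i. s"] by simp

lemma D_rel2:
  assumes "D C (\<lambda>\<rho>. Q (\<rho> 0) (\<rho> 1))" "DT C s" "DT C t"
  shows "D C (\<lambda>\<rho>. Q (s \<rho>) (t \<rho>))"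
  using D_comp[OF assms(1), of "\<lambda>i. if i = 0 then s else t"] assms(2,3) by simp

lemma DT_fun1: "DT C (\<lambda>\<rho>. Q (\<rho> 0)) \<Longrightarrow> DT C s \<Longrightarrow> DT C (\<lambda>\<rho>. Q (s \<rho>))"
  using DT_comp[of C "\<lambda>\<rho>. Q (\<rho> 0)" "\<lambda>i. s"] by simp

lemma DT_fun2:
  assumes "DT C (\<lambda>\<rho>. Q (\<rho> 0) (\<rho> 1))" "DT C s" "DT C t"
  shows "DT C (\<lambda>\<rho>. Q (s \<rho>) (t \<rho>))"
  using DT_comp[OF assms(1), of "\<lambda>i. if i = 0 then s else t"] assms(2,3) by simp

lemma DT_graph: "D C (\<lambda>\<rho>. \<rho> 0 = t (\<lambda>i. \<rho> (Suc i))) \<Longrightarrow> DT C t"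
  by (simp add: defn_def)

text \<open>A formula reads finitely many slots. This turns infinite valuations into finite data,
  which \<open>thin\<close> codes by one number.\<close>

lemma D_supp:
  assumes "D C P"
  shows "\<exists>n. \<forall>\<rho> \<rho>'. (\<forall>i<n. \<rho> i = \<rho>' i) \<longrightarrow> P \<rho> = P \<rho>'"
proof -
  obtain p f where f: "\<forall>\<rho>. P \<rho> \<longleftrightarrow> esat M (pval f \<rho>) p"
    using assms unfolding defb_def by auto
  obtain m where m: "afm_in m p" using afm_in_ex by blast
  define n where "n = Suc (Max ((\<lambda>i. case f i of Inl a \<Rightarrow> 0 | Inr j \<Rightarrow> j) ` {..<m} \<union> {0}))"
  have n: "j < n" if "f i = Inr j" "i < m" for i j
  proof -
    have "j \<in> (\<lambda>i. case f i of Inl a \<Rightarrow> 0 | Inr j \<Rightarrow> j) ` {..<m} \<union> {0}"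
      using that by (auto intro!: image_eqI[of _ _ i])
    then show ?thesis unfolding n_def by (metis Max_ge finite.emptyI finite.insertI finite_UnI finite_imageI finite_lessThan le_imp_less_Suc)
  qed
  have "P \<rho> = P \<rho>'" if "\<forall>i<n. \<rho> i = \<rho>' i" for \<rho> \<rho>'
    unfolding f[rule_format] by (rule esat_cong[OF m]) (use that n in \<open>auto simp: pval_def split: sum.split\<close>)
  then show ?thesis by blast
qed

lemma DT_supp:
  assumes "DT C t"
  shows "\<exists>n. \<forall>\<rho> \<rho>'. (\<forall>i<n. \<rho> i = \<rho>' i) \<longrightarrow> t \<rho> = t \<rho>'"
proof -
  obtain n where n: "\<And>\<rho> \<rho>'. (\<forall>i<n. \<rho> i = \<rho>' i) \<Longrightarrow>
      (\<rho> 0 = t (\<lambda>i. \<rho> (Suc i))) = (\<rho>' 0 = t (\<lambda>i. \<rho>' (Suc i)))"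
    using D_supp[OF assms[unfolded defn_def]] by blast
  have "t \<rho> = t \<rho>'" if "\<forall>i<n. \<rho> i = \<rho>' i" for \<rho> \<rho>'
    using n[of "case_nat (t \<rho>) \<rho>" "case_nat (t \<rho>) \<rho>'"] that by (auto split: nat.split)
  then show ?thesis by blast
qed

lemmas D_intros = D_neg D_conj D_disj D_imp D_iff D_ex D_all D_bool D_eq D_le
  DT_var DT_const DT_plus DT_times DT_zero DT_one UNIV_I

end

section \<open>Arithmetic in a model of PA\<close>

locale pa_model = arith_full M for M :: "'a arith" +
  assumes PA: "p \<in> PA \<Longrightarrow> asat M [] p"
begin

abbreviation zro ("\<zero>") where "\<zero> \<equiv> azero M"
abbreviation uno ("\<one>") where "\<one> \<equiv> aone M"
abbreviation pls (infixl "\<oplus>" 65) where "x \<oplus> y \<equiv> aplus M x y"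
abbreviation tms (infixl "\<otimes>" 70) where "x \<otimes> y \<equiv> atimes M x y"
abbreviation leq (infix "\<preceq>" 50) where "x \<preceq> y \<equiv> ale M x y"
definition lt (infix "\<prec>" 50) where "x \<prec> y \<longleftrightarrow> x \<preceq> y \<and> x \<noteq> y"

section \<open>The induction scheme for definable predicates with parameters\<close>

lemma esat_AAlls: "asat M e ((AAll ^^ n) q) \<longleftrightarrow> (\<forall>xs. length xs = n \<longrightarrow> asat M (xs @ e) q)"
proof (induction n arbitrary: e)
  case (Suc n)
  have "asat M e ((AAll ^^ Suc n) q) \<longleftrightarrow> (\<forall>x xs. length xs = n \<longrightarrow> asat M (xs @ x # e) q)"
    using Suc.IH by simp
  also have "\<dots> \<longleftrightarrow> (\<forall>xs. length xs = Suc n \<longrightarrow> asat M (xs @ e) q)"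
  proof (intro iffI allI impI)
    fix xs :: "'a list"
    assume *: "\<forall>x xs. length xs = n \<longrightarrow> asat M (xs @ x # e) q" and "length xs = Suc n"
    then obtain ys y where "xs = ys @ [y]" "length ys = n" by (metis length_Suc_conv_rev)
    then show "asat M (xs @ e) q" using * by simp
  next
    fix x and xs :: "'a list"
    assume *: "\<forall>xs. length xs = Suc n \<longrightarrow> asat M (xs @ e) q" and "length xs = n"
    then show "asat M (xs @ x # e) q" using *[rule_format, of "xs @ [x]"] by simp
  qed
  finally show ?case .
qed simp

lemma esat_induction_fm:
  "esat M \<rho> (induction_fm p) \<longleftrightarrow> (esat M (case_nat \<zero> \<rho>) p \<longrightarrow>
     (\<forall>x. esat M (case_nat x \<rho>) p \<longrightarrow> esat M (case_nat (x \<oplus> \<one>) \<rho>) p) \<longrightarrow>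
     (\<forall>x. esat M (case_nat x \<rho>) p))"
proof -
  have 1: "(\<lambda>i. tval M \<rho> (case_nat Zero V i)) = case_nat \<zero> \<rho>"
    by (rule ext) (simp split: nat.split)
  have 2: "(\<lambda>i. tval M (case_nat x \<rho>) (case_nat (Plus (V 0) One) (\<lambda>i. V (Suc i)) i)) = case_nat (x \<oplus> \<one>) \<rho>" for x
    by (rule ext) (simp split: nat.split)
  show ?thesis by (simp add: induction_fm_def esat_asubst 1 2; blast)
qed

lemma induct:
  assumes "D UNIV (\<lambda>\<rho>. P (\<rho> 0))" and "P \<zero>" and "\<And>x. P x \<Longrightarrow> P (x \<oplus> \<one>)"
  shows "P x"
proof -
  obtain p f where f: "\<And>\<rho>. P (\<rho> 0) \<longleftrightarrow> esat M (pval f \<rho>) p"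
    using assms(1) unfolding defb_def by auto
  \<comment> \<open>As \<open>P\<close> depends on \<open>\<rho> 0\<close> only, it may be evaluated
    at a constant valuation; then all non-parameter slots read \<open>x\<close> and become
    \<open>V 0\<close>, while the slot of a parameter moves up by one to stay free below the
    quantifier for \<open>x\<close>. The finitely many parameters that matter are listed in
    \<open>cs\<close>.\<close>
  define \<sigma> where "\<sigma> i = (case f i of Inl _ \<Rightarrow> V (Suc i) | Inr _ \<Rightarrow> V 0)" for i
  define c where "c i = (case f i of Inl a \<Rightarrow> a | Inr _ \<Rightarrow> \<zero>)" for i
  obtain n where n: "afm_in n (asubst \<sigma> p)" using afm_in_ex by blast
  define cs where "cs = map c [0..<n]"
  have P: "P x \<longleftrightarrow> esat M (case_nat x ((!) cs)) (asubst \<sigma> p)" for x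
  proof -
    have "(\<lambda>i. tval M (case_nat x c) (\<sigma> i)) = pval f (\<lambda>_. x)"
      by (rule ext) (simp add: \<sigma>_def c_def pval_def split: sum.split)
    then have "P x \<longleftrightarrow> esat M (case_nat x c) (asubst \<sigma> p)"
      using f[of "\<lambda>_. x"] by (simp add: esat_asubst)
    also have "\<dots> \<longleftrightarrow> esat M (case_nat x ((!) cs)) (asubst \<sigma> p)"
      by (rule esat_cong[OF n]) (auto simp: cs_def split: nat.split)
    finally show ?thesis .
  qed
  have "afm_in (Suc n) (asubst \<sigma> p)" using n afm_in_mono by (metis le_SucI le_refl)
  then have "(AAll ^^ n) (induction_fm (asubst \<sigma> p)) \<in> PA" unfolding PA_def by blast
  then have "asat M [] ((AAll ^^ n) (induction_fm (asubst \<sigma> p)))" by (rule PA)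
  then have "asat M cs (induction_fm (asubst \<sigma> p))" by (auto simp: esat_AAlls cs_def)
  then show ?thesis using assms(2,3) by (simp add: asat_esat esat_induction_fm P[symmetric])
qed

section \<open>Ordered semiring laws from the basic axioms\<close>

lemma succ_nz [simp]: "x \<oplus> \<one> \<noteq> \<zero>"
proof -
  have "asat M [] (AAll (ANeg (AEq (Plus (V 0) One) Zero)))" by (rule PA) (simp add: PA_def)
  then show ?thesis by simp
qed

lemma succ_inj [simp]: "x \<oplus> \<one> = y \<oplus> \<one> \<longleftrightarrow> x = y"
proof -
  have "asat M [] (AAll (AAll (AImp (AEq (Plus (V 1) One) (Plus (V 0) One)) (AEq (V 1) (V 0)))))"
    by (rule PA) (simp add: PA_def)
  then show ?thesis by auto
qed

lemma add_0 [simp]: "x \<oplus> \<zero> = x"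
proof -
  have "asat M [] (AAll (AEq (Plus (V 0) Zero) (V 0)))" by (rule PA) (simp add: PA_def)
  then show ?thesis by simp
qed

lemma add_succ: "x \<oplus> (y \<oplus> \<one>) = (x \<oplus> y) \<oplus> \<one>"
proof -
  have "asat M [] (AAll (AAll (AEq (Plus (V 1) (Plus (V 0) One)) (Plus (Plus (V 1) (V 0)) One))))"
    by (rule PA) (simp add: PA_def)
  then show ?thesis by simp
qed

lemma mult_0 [simp]: "x \<otimes> \<zero> = \<zero>"
proof -
  have "asat M [] (AAll (AEq (Times (V 0) Zero) Zero))" by (rule PA) (simp add: PA_def)
  then show ?thesis by simp
qed

lemma mult_succ: "x \<otimes> (y \<oplus> \<one>) = x \<otimes> y \<oplus> x"
proof -
  have "asat M [] (AAll (AAll (AEq (Times (V 1) (Plus (V 0) One)) (Plus (Times (V 1) (V 0)) (V 1)))))"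
    by (rule PA) (simp add: PA_def)
  then show ?thesis by simp
qed

lemma le_iff: "x \<preceq> y \<longleftrightarrow> (\<exists>z. x \<oplus> z = y)"
proof -
  have "asat M [] (AAll (AAll (AIff (ALe (V 1) (V 0)) (AEx (AEq (Plus (V 2) (V 0)) (V 1))))))"
    by (rule PA) (simp add: PA_def)
  then show ?thesis by (simp add: numeral_2_eq_2) blast
qed

lemma D_lt: "DT C s \<Longrightarrow> DT C t \<Longrightarrow> D C (\<lambda>\<rho>. s \<rho> \<prec> t \<rho>)"
  unfolding lt_def by (intro D_intros)

lemmas D_rules = D_intros D_lt

lemma add_assoc: "(x \<oplus> y) \<oplus> z = x \<oplus> (y \<oplus> z)"
proof (rule induct[of "\<lambda>z. (x \<oplus> y) \<oplus> z = x \<oplus> (y \<oplus> z)"])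
  show "D UNIV (\<lambda>\<rho>. (x \<oplus> y) \<oplus> \<rho> 0 = x \<oplus> (y \<oplus> \<rho> 0))" by (intro D_rules)
qed (simp_all add: add_succ)

lemma add_0_left [simp]: "\<zero> \<oplus> x = x"
proof (rule induct[of "\<lambda>x. \<zero> \<oplus> x = x"])
  show "D UNIV (\<lambda>\<rho>. \<zero> \<oplus> \<rho> 0 = \<rho> 0)" by (intro D_rules)
qed (simp_all add: add_succ)

lemma add_1_left: "\<one> \<oplus> x = x \<oplus> \<one>"
proof (rule induct[of "\<lambda>x. \<one> \<oplus> x = x \<oplus> \<one>"])
  show "D UNIV (\<lambda>\<rho>. \<one> \<oplus> \<rho> 0 = \<rho> 0 \<oplus> \<one>)" by (intro D_rules)
qed (simp_all add: add_succ)

lemma add_commute: "x \<oplus> y = y \<oplus> x"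
proof (rule induct[of "\<lambda>x. x \<oplus> y = y \<oplus> x"])
  show "D UNIV (\<lambda>\<rho>. \<rho> 0 \<oplus> y = y \<oplus> \<rho> 0)" by (intro D_rules)
  fix x assume "x \<oplus> y = y \<oplus> x"
  then show "(x \<oplus> \<one>) \<oplus> y = y \<oplus> (x \<oplus> \<one>)" by (metis add_assoc add_1_left)
qed simp

lemma add_left_commute: "x \<oplus> (y \<oplus> z) = y \<oplus> (x \<oplus> z)"
  by (metis add_assoc add_commute)

lemmas add_ac = add_assoc add_commute add_left_commute

lemma mult_0_left [simp]: "\<zero> \<otimes> x = \<zero>"
proof (rule induct[of "\<lambda>x. \<zero> \<otimes> x = \<zero>"])
  show "D UNIV (\<lambda>\<rho>. \<zero> \<otimes> \<rho> 0 = \<zero>)" by (intro D_rules)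
qed (simp_all add: mult_succ)

lemma mult_1_left [simp]: "\<one> \<otimes> x = x"
proof (rule induct[of "\<lambda>x. \<one> \<otimes> x = x"])
  show "D UNIV (\<lambda>\<rho>. \<one> \<otimes> \<rho> 0 = \<rho> 0)" by (intro D_rules)
qed (simp_all add: mult_succ)

lemma mult_1 [simp]: "x \<otimes> \<one> = x"
  using mult_succ[of x \<zero>] by simp

lemma distrib_left: "x \<otimes> (y \<oplus> z) = x \<otimes> y \<oplus> x \<otimes> z"
proof (rule induct[of "\<lambda>z. x \<otimes> (y \<oplus> z) = x \<otimes> y \<oplus> x \<otimes> z"])
  show "D UNIV (\<lambda>\<rho>. x \<otimes> (y \<oplus> \<rho> 0) = x \<otimes> y \<oplus> x \<otimes> \<rho> 0)" by (intro D_rules)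
qed (simp_all add: mult_succ add_assoc[symmetric])

lemma distrib_right: "(x \<oplus> y) \<otimes> z = x \<otimes> z \<oplus> y \<otimes> z"
proof (rule induct[of "\<lambda>z. (x \<oplus> y) \<otimes> z = x \<otimes> z \<oplus> y \<otimes> z"])
  show "D UNIV (\<lambda>\<rho>. (x \<oplus> y) \<otimes> \<rho> 0 = x \<otimes> \<rho> 0 \<oplus> y \<otimes> \<rho> 0)" by (intro D_rules)
qed (simp_all add: mult_succ add_ac)

lemma mult_commute: "x \<otimes> y = y \<otimes> x"
proof (rule induct[of "\<lambda>y. x \<otimes> y = y \<otimes> x"])
  show "D UNIV (\<lambda>\<rho>. x \<otimes> \<rho> 0 = \<rho> 0 \<otimes> x)" by (intro D_rules)
qed (simp_all add: mult_succ distrib_right)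

lemma mult_assoc: "(x \<otimes> y) \<otimes> z = x \<otimes> (y \<otimes> z)"
proof (rule induct[of "\<lambda>z. (x \<otimes> y) \<otimes> z = x \<otimes> (y \<otimes> z)"])
  show "D UNIV (\<lambda>\<rho>. (x \<otimes> y) \<otimes> \<rho> 0 = x \<otimes> (y \<otimes> \<rho> 0))" by (intro D_rules)
qed (simp_all add: mult_succ distrib_left)

lemma mult_left_commute: "x \<otimes> (y \<otimes> z) = y \<otimes> (x \<otimes> z)"
  by (metis mult_assoc mult_commute)

lemmas mult_ac = mult_assoc mult_commute mult_left_commute

lemma add_cancel [simp]: "x \<oplus> z = y \<oplus> z \<longleftrightarrow> x = y"
proof (rule induct[of "\<lambda>z. x \<oplus> z = y \<oplus> z \<longleftrightarrow> x = y"])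
  show "D UNIV (\<lambda>\<rho>. x \<oplus> \<rho> 0 = y \<oplus> \<rho> 0 \<longleftrightarrow> x = y)" by (intro D_rules)
qed (simp_all add: add_assoc[symmetric])

lemma add_cancel_left [simp]: "z \<oplus> x = z \<oplus> y \<longleftrightarrow> x = y"
  using add_cancel[of x z y] by (simp only: add_commute)

lemma zero_or_succ: "x = \<zero> \<or> (\<exists>y. x = y \<oplus> \<one>)"
proof (rule induct[of "\<lambda>x. x = \<zero> \<or> (\<exists>y. x = y \<oplus> \<one>)"])
  show "D UNIV (\<lambda>\<rho>. \<rho> 0 = \<zero> \<or> (\<exists>y. \<rho> 0 = y \<oplus> \<one>))" by (intro D_rules)
qed auto

lemma add_eq_0 [simp]: "x \<oplus> y = \<zero> \<longleftrightarrow> x = \<zero> \<and> y = \<zero>"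
  using zero_or_succ[of y] succ_nz by (auto simp: add_assoc[symmetric])

lemma le_linear: "x \<preceq> y \<or> y \<preceq> x"
proof (rule induct[of "\<lambda>x. x \<preceq> y \<or> y \<preceq> x"])
  show "D UNIV (\<lambda>\<rho>. \<rho> 0 \<preceq> y \<or> y \<preceq> \<rho> 0)" by (intro D_rules)
  show "\<zero> \<preceq> y \<or> y \<preceq> \<zero>" by (auto simp: le_iff)
next
  fix x assume "x \<preceq> y \<or> y \<preceq> x"
  then show "x \<oplus> \<one> \<preceq> y \<or> y \<preceq> x \<oplus> \<one>"
  proof
    assume "x \<preceq> y"
    then obtain z where z: "x \<oplus> z = y" by (auto simp: le_iff)
    show ?thesis
    proof (cases "z = \<zero>")
      case True then show ?thesis using z by (auto simp: le_iff)
    next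
      case False then obtain w where "z = w \<oplus> \<one>" using zero_or_succ by blast
      then have "x \<oplus> \<one> \<oplus> w = y" using z by (simp add: add_ac)
      then show ?thesis by (auto simp: le_iff)
    qed
  next
    assume "y \<preceq> x" then show ?thesis by (metis add_assoc le_iff)
  qed
qed

sublocale ord: linorder "(\<preceq>)" "(\<prec>)"
proof
  show refl: "x \<preceq> x" for x by (metis add_0 le_iff)
  show "x \<preceq> z" if "x \<preceq> y" "y \<preceq> z" for x y z using that by (metis add_assoc le_iff)
  show antisym: "x = y" if "x \<preceq> y" "y \<preceq> x" for x y
  proof -
    obtain u v where uv: "x \<oplus> u = y" "y \<oplus> v = x" using \<open>x \<preceq> y\<close> \<open>y \<preceq> x\<close> by (auto simp: le_iff)
    then have "x \<oplus> (u \<oplus> v) = x \<oplus> \<zero>" by (simp add: add_assoc[symmetric])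
    then have "u = \<zero>" by (simp only: add_cancel_left add_eq_0)
    then show ?thesis using uv by simp
  qed
  show "(x \<prec> y) = (x \<preceq> y \<and> \<not> y \<preceq> x)" for x y
    using antisym[of x y] refl by (auto simp: lt_def)
  show "x \<preceq> y \<or> y \<preceq> x" for x y by (rule le_linear)
qed

lemma zero_le [simp]: "\<zero> \<preceq> x" by (auto simp: le_iff)

lemma le_zero [simp]: "x \<preceq> \<zero> \<longleftrightarrow> x = \<zero>" by (auto simp: le_iff)

lemma not_lt_zero [simp]: "\<not> x \<prec> \<zero>" by (simp add: lt_def)

lemma le_add [simp]: "x \<preceq> x \<oplus> y" "x \<preceq> y \<oplus> x" by (auto simp: le_iff add_commute)

lemma lt_succ_le: "x \<prec> y \<oplus> \<one> \<longleftrightarrow> x \<preceq> y"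
proof
  assume "x \<prec> y \<oplus> \<one>"
  then obtain z where z: "x \<oplus> z = y \<oplus> \<one>" "z \<noteq> \<zero>" by (metis lt_def le_iff add_0)
  then obtain w where "z = w \<oplus> \<one>" using zero_or_succ by blast
  then have "x \<oplus> w = y" using z(1) by (simp add: add_assoc[symmetric])
  then show "x \<preceq> y" by (auto simp: le_iff)
next
  assume "x \<preceq> y"
  then have "x \<preceq> y \<oplus> \<one>" by (rule ord.order.trans) simp
  moreover have "x \<noteq> y \<oplus> \<one>"
  proof
    assume "x = y \<oplus> \<one>"
    then obtain z where "y \<oplus> (\<one> \<oplus> z) = y \<oplus> \<zero>" using \<open>x \<preceq> y\<close> by (auto simp: le_iff add_assoc)
    then have "\<one> = \<zero>" by (simp only: add_cancel_left add_eq_0)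
    then show False using succ_nz[of \<zero>] by simp
  qed
  ultimately show "x \<prec> y \<oplus> \<one>" by (simp add: lt_def)
qed

lemma succ_le_iff: "x \<oplus> \<one> \<preceq> y \<longleftrightarrow> x \<prec> y"
  using lt_succ_le[of y x] by (metis ord.not_le)

lemma zero_ne_one [simp]: "\<zero> \<noteq> \<one>" "\<one> \<noteq> \<zero>"
  using succ_nz[of \<zero>] by auto

lemma lt_succ [simp]: "x \<prec> x \<oplus> \<one>" by (simp add: lt_succ_le)

lemma add_le_cancel [simp]: "x \<oplus> z \<preceq> y \<oplus> z \<longleftrightarrow> x \<preceq> y"
proof -
  have "x \<oplus> z \<oplus> w = y \<oplus> z \<longleftrightarrow> x \<oplus> w = y" for w
    using add_cancel[of "x \<oplus> w" z y] by (simp add: add_ac)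
  then show ?thesis by (simp add: le_iff)
qed

lemma add_le_cancel_left [simp]: "z \<oplus> x \<preceq> z \<oplus> y \<longleftrightarrow> x \<preceq> y"
  using add_le_cancel[of x z y] by (simp only: add_commute)

lemma add_lt_cancel [simp]: "x \<oplus> z \<prec> y \<oplus> z \<longleftrightarrow> x \<prec> y" "z \<oplus> x \<prec> z \<oplus> y \<longleftrightarrow> x \<prec> y"
  by (simp_all add: lt_def)

lemma add_mono: "x \<preceq> y \<Longrightarrow> u \<preceq> v \<Longrightarrow> x \<oplus> u \<preceq> y \<oplus> v"
  by (metis add_le_cancel add_le_cancel_left ord.order.trans)

lemma mult_mono_right: "x \<preceq> y \<Longrightarrow> x \<otimes> z \<preceq> y \<otimes> z"
  by (auto simp: le_iff distrib_right)

lemma mult_mono_left: "x \<preceq> y \<Longrightarrow> z \<otimes> x \<preceq> z \<otimes> y"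
  by (auto simp: le_iff distrib_left)

lemma pos_iff: "\<zero> \<prec> x \<longleftrightarrow> x \<noteq> \<zero>"
  by (auto simp: lt_def)

lemma le_mult: "y \<noteq> \<zero> \<Longrightarrow> x \<preceq> x \<otimes> y"
  using mult_mono_left[of \<one> y x] succ_le_iff[of \<zero> y] by (simp add: pos_iff)

lemma mult_eq_0 [simp]: "x \<otimes> y = \<zero> \<longleftrightarrow> x = \<zero> \<or> y = \<zero>"
  using le_mult[of y x] by auto

lemma mult_eq_1: "x \<otimes> y = \<one> \<Longrightarrow> x = \<one>"
proof -
  assume xy: "x \<otimes> y = \<one>"
  then have "y \<noteq> \<zero>" "x \<noteq> \<zero>" by auto
  then have "x \<preceq> \<one>" "\<one> \<preceq> x" using le_mult[of y x] succ_le_iff[of \<zero> x] xy by (auto simp: pos_iff)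
  then show ?thesis by simp
qed

section \<open>Strong induction, least elements and definable Skolem functions\<close>

lemma strong_induct:
  assumes "D UNIV (\<lambda>\<rho>. P (\<rho> 0))" and "\<And>x. (\<And>y. y \<prec> x \<Longrightarrow> P y) \<Longrightarrow> P x"
  shows "P x"
proof -
  have "\<forall>y. y \<prec> x \<longrightarrow> P y" for x
  proof (rule induct[of "\<lambda>x. \<forall>y. y \<prec> x \<longrightarrow> P y"])
    show "D UNIV (\<lambda>\<rho>. \<forall>y. y \<prec> \<rho> 0 \<longrightarrow> P y)"
      by (intro D_rules D_rel1[OF assms(1)])
  next
    fix x assume *: "\<forall>y. y \<prec> x \<longrightarrow> P y"
    then have "P x" using assms(2) by blast
    then show "\<forall>y. y \<prec> x \<oplus> \<one> \<longrightarrow> P y" using * by (auto simp: lt_succ_le) (metis lt_def)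
  qed simp
  then show ?thesis using lt_succ by blast
qed

lemma least:
  assumes "D UNIV (\<lambda>\<rho>. P (\<rho> 0))" and "P x"
  shows "\<exists>y. P y \<and> (\<forall>z. P z \<longrightarrow> y \<preceq> z)"
proof (rule ccontr)
  assume *: "\<not> ?thesis"
  have "\<not> P x"
  proof (rule strong_induct[of "\<lambda>x. \<not> P x"])
    show "D UNIV (\<lambda>\<rho>. \<not> P (\<rho> 0))" by (intro D_rules assms)
  next
    fix x assume "\<And>y. y \<prec> x \<Longrightarrow> \<not> P y"
    then show "\<not> P x" using * by (metis ord.not_le)
  qed
  then show False using assms(2) by simp
qed

definition mu :: "('a \<Rightarrow> bool) \<Rightarrow> 'a" where
  "mu P = (if \<exists>x. P x then (THE y. P y \<and> (\<forall>z. P z \<longrightarrow> y \<preceq> z)) else \<zero>)"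

lemma mu_least:
  assumes "D UNIV (\<lambda>\<rho>. P (\<rho> 0))" and "P x"
  shows "P (mu P)" "mu P \<preceq> x"
proof -
  obtain y where y: "P y \<and> (\<forall>z. P z \<longrightarrow> y \<preceq> z)" using least[OF assms] by blast
  then have "mu P = y" unfolding mu_def using assms(2) ord.order.antisym
    by (auto intro!: the_equality)
  then show "P (mu P)" "mu P \<preceq> x" using y assms(2) by auto
qed

text \<open>Freezing the other coordinates as parameters reduces a predicate of several variables to
  one variable, the form in which induction and the least number principle apply.\<close>

lemma D_fix:
  assumes "D C P"
  shows "D UNIV (\<lambda>\<rho>. P (case_nat (\<rho> 0) \<rho>'))"
proof -
  have "D UNIV (\<lambda>\<rho>. P (\<lambda>i. case_nat (\<lambda>\<rho>. \<rho> 0) (\<lambda>i \<rho>. \<rho>' i) i \<rho>))"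
    by (rule D_comp[OF D_mono[OF assms]]) (auto intro: DT_var DT_const split: nat.split)
  moreover have "(\<lambda>i. case_nat (\<lambda>\<rho>. \<rho> 0) (\<lambda>i \<rho>. \<rho>' i) i \<rho>) = case_nat (\<rho> 0) \<rho>'" for \<rho> :: "nat \<Rightarrow> 'a"
    by (rule ext) (simp split: nat.split)
  ultimately show ?thesis by simp
qed

text \<open>Least witnesses give Skolem functions that need no new parameters; this is why definable
  functions alone suffice for the existential case of the theorem of Los.\<close>

lemma DT_mu:
  assumes "D C (\<lambda>\<rho>. P (\<rho> 0) (\<lambda>i. \<rho> (Suc i)))"
  shows "DT C (\<lambda>\<rho>. mu (\<lambda>x. P x \<rho>))"
proof (rule DT_graph)
  have least: "D UNIV (\<lambda>\<rho>'. P (\<rho>' 0) \<rho>)" for \<rho>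
    using D_fix[OF assms, of \<rho>] by simp
  have "y = mu (\<lambda>x. P x \<rho>) \<longleftrightarrow>
      (P y \<rho> \<and> (\<forall>z. P z \<rho> \<longrightarrow> y \<preceq> z)) \<or> (\<not> (\<exists>z. P z \<rho>) \<and> y = \<zero>)" for y \<rho>
  proof (cases "\<exists>z. P z \<rho>")
    case True
    then show ?thesis using mu_least[OF least[of \<rho>]] by (metis ord.order.antisym)
  next
    case False then show ?thesis by (simp add: mu_def)
  qed
  moreover have "D C (\<lambda>\<rho>. (P (\<rho> 0) (\<lambda>i. \<rho> (Suc i)) \<and> (\<forall>z. P z (\<lambda>i. \<rho> (Suc i)) \<longrightarrow> \<rho> 0 \<preceq> z)) \<or>
     (\<not> (\<exists>z. P z (\<lambda>i. \<rho> (Suc i))) \<and> \<rho> 0 = \<zero>))"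
    using D_rename[OF assms, of "\<lambda>i. if i = 0 then 0 else Suc i"]
    by (intro D_rules assms) simp_all
  ultimately show "D C (\<lambda>\<rho>. \<rho> 0 = mu (\<lambda>x. P x (\<lambda>i. \<rho> (Suc i))))" by simp
qed

end

section \<open>Coding of finite sets and sequences\<close>

context pa_model
begin

section \<open>Pairing\<close>

definition pr :: "'a \<Rightarrow> 'a \<Rightarrow> 'a" where "pr x y = (x \<oplus> y) \<otimes> (x \<oplus> y) \<oplus> x"

text \<open>All values with the same sum \<open>s\<close> lie between \<open>s * s\<close> and
  \<open>s * s + s\<close>, hence below the next square; so the sum, and then both components, can
  be read off. Unlike Cantor's pairing this needs no division by two.\<close>

lemma pr_lt:
  assumes "x \<oplus> y \<prec> u \<oplus> v"
  shows "pr x y \<prec> pr u v"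
proof -
  let ?s = "x \<oplus> y" and ?t = "u \<oplus> v"
  have 3: "(?s \<oplus> \<one>) \<otimes> (?s \<oplus> \<one>) \<preceq> ?t \<otimes> ?t"
    using assms mult_mono_left mult_mono_right ord.order.trans succ_le_iff by metis
  have 1: "pr x y \<preceq> ?s \<otimes> ?s \<oplus> ?s" unfolding pr_def by (intro add_mono) simp_all
  have 2: "?s \<otimes> ?s \<oplus> ?s \<prec> (?s \<oplus> \<one>) \<otimes> (?s \<oplus> \<one>)"
  proof -
    have "(?s \<oplus> \<one>) \<otimes> (?s \<oplus> \<one>) = (?s \<otimes> ?s \<oplus> ?s \<oplus> ?s) \<oplus> \<one>"
      by (simp add: distrib_left distrib_right add_ac)
    then show ?thesis by (simp add: lt_succ_le)
  qed
  have 4: "?t \<otimes> ?t \<preceq> pr u v" unfolding pr_def by simp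
  show ?thesis
    using ord.less_le_trans[OF ord.less_le_trans[OF ord.le_less_trans[OF 1 2] 3] 4] .
qed

lemma pr_lt2: "y \<prec> v \<Longrightarrow> pr x y \<prec> pr x v"
  by (rule pr_lt) simp

lemma pr_inj [simp]: "pr x y = pr u v \<longleftrightarrow> x = u \<and> y = v"
proof
  assume eq: "pr x y = pr u v"
  then have "\<not> x \<oplus> y \<prec> u \<oplus> v" "\<not> u \<oplus> v \<prec> x \<oplus> y" using pr_lt by fastforce+
  then have s: "x \<oplus> y = u \<oplus> v" by simp
  then have "x = u" using eq unfolding pr_def by simp
  then show "x = u \<and> y = v" using s by simp
qed simp

definition pf :: "'a \<Rightarrow> 'a" where "pf z = mu (\<lambda>x. \<exists>y. pr x y = z)"
definition ps :: "'a \<Rightarrow> 'a" where "ps z = mu (\<lambda>y. \<exists>x. pr x y = z)"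

lemma DT_pr: "DT C s \<Longrightarrow> DT C t \<Longrightarrow> DT C (\<lambda>\<rho>. pr (s \<rho>) (t \<rho>))"
  unfolding pr_def by (intro D_rules)

lemma DT_pf: "DT C s \<Longrightarrow> DT C (\<lambda>\<rho>. pf (s \<rho>))"
  by (rule DT_fun1[of C pf]) (unfold pf_def, intro DT_mu D_rules DT_pr)

lemma DT_ps: "DT C s \<Longrightarrow> DT C (\<lambda>\<rho>. ps (s \<rho>))"
  by (rule DT_fun1[of C ps]) (unfold ps_def, intro DT_mu D_rules DT_pr)

lemma pf_pr [simp]: "pf (pr x y) = x"
proof -
  have "\<exists>v. pr (pf (pr x y)) v = pr x y" unfolding pf_def
    by (rule mu_least(1)[of "\<lambda>u. \<exists>v. pr u v = pr x y" x]) (intro D_rules DT_pr, auto)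
  then show ?thesis by auto
qed

lemma ps_pr [simp]: "ps (pr x y) = y"
proof -
  have "\<exists>u. pr u (ps (pr x y)) = pr x y" unfolding ps_def
    by (rule mu_least(1)[of "\<lambda>v. \<exists>u. pr u v = pr x y" y]) (intro D_rules DT_pr, auto)
  then show ?thesis by auto
qed

section \<open>Divisibility and coprime numbers\<close>

definition dv :: "'a \<Rightarrow> 'a \<Rightarrow> bool" where "dv a b \<longleftrightarrow> (\<exists>k. a \<otimes> k = b)"
definition cop :: "'a \<Rightarrow> 'a \<Rightarrow> bool" where "cop a b \<longleftrightarrow> (\<forall>u. dv u a \<longrightarrow> dv u b \<longrightarrow> u = \<one>)"

lemma D_dv: "DT C s \<Longrightarrow> DT C t \<Longrightarrow> D C (\<lambda>\<rho>. dv (s \<rho>) (t \<rho>))"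
  unfolding dv_def by (intro D_rules DT_shift)

lemma dv_refl [simp]: "dv a a" unfolding dv_def by (metis mult_1)

lemma dv_0 [simp]: "dv a \<zero>" unfolding dv_def by (metis mult_0)

lemma dv_mult: "dv a b \<Longrightarrow> dv a (b \<otimes> c)" "dv a b \<Longrightarrow> dv a (c \<otimes> b)"
  unfolding dv_def by (metis mult_assoc, metis mult_assoc mult_commute)

lemma dv_trans: "dv a b \<Longrightarrow> dv b c \<Longrightarrow> dv a c"
  unfolding dv_def by (metis mult_assoc)

text \<open>There is no subtraction; the quotients \<open>k\<close> and \<open>m\<close> are
  compared instead, and a smaller \<open>m\<close> forces \<open>c\<close> to be zero.\<close>

lemma dv_diff:
  assumes "dv a b" "dv a (b \<oplus> c)"
  shows "dv a c"
proof -
  obtain k m where k: "a \<otimes> k = b" and m: "a \<otimes> m = b \<oplus> c" using assms unfolding dv_def by auto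
  show ?thesis
  proof (cases "k \<preceq> m")
    case True
    then obtain z where "m = k \<oplus> z" by (auto simp: le_iff)
    then have "a \<otimes> z = c" using k m by (simp add: distrib_left)
    then show ?thesis unfolding dv_def by blast
  next
    case False
    then have "b \<oplus> c \<preceq> b \<oplus> \<zero>" using mult_mono_left[of m k a] k m by simp
    then have "c \<preceq> \<zero>" by (simp only: add_le_cancel_left)
    then show ?thesis by simp
  qed
qed

lemma division: "n \<noteq> \<zero> \<Longrightarrow> \<exists>k r. b = n \<otimes> k \<oplus> r \<and> r \<prec> n"
proof (rule induct[of "\<lambda>b. \<exists>k r. b = n \<otimes> k \<oplus> r \<and> r \<prec> n"])
  show "D UNIV (\<lambda>\<rho>. \<exists>k r. \<rho> 0 = n \<otimes> k \<oplus> r \<and> r \<prec> n)" by (intro D_rules)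
next
  assume "n \<noteq> \<zero>"
  then show "\<exists>k r. \<zero> = n \<otimes> k \<oplus> r \<and> r \<prec> n"
    by (intro exI[of _ \<zero>]) (simp add: pos_iff)
next
  fix b assume "n \<noteq> \<zero>" "\<exists>k r. b = n \<otimes> k \<oplus> r \<and> r \<prec> n"
  then obtain k r where kr: "b = n \<otimes> k \<oplus> r" "r \<prec> n" by blast
  show "\<exists>k r. b \<oplus> \<one> = n \<otimes> k \<oplus> r \<and> r \<prec> n"
  proof (cases "r \<oplus> \<one> \<prec> n")
    case True
    then show ?thesis using kr by (metis add_assoc)
  next
    case False
    then have "r \<oplus> \<one> = n" using kr(2) by (metis lt_def succ_le_iff)
    then have "b \<oplus> \<one> = n \<otimes> (k \<oplus> \<one>) \<oplus> \<zero>" using kr by (simp add: distrib_left add_assoc)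
    then show ?thesis using \<open>n \<noteq> \<zero>\<close> pos_iff by blast
  qed
qed

text \<open>The least \<open>n > 0\<close> with \<open>a dvd n c\<close> divides all such \<open>n\<close>, in particular \<open>a\<close> and \<open>b\<close>.\<close>

lemma euclid:
  assumes "cop a b" "dv a (b \<otimes> c)"
  shows "dv a c"
proof (cases "b = \<zero>")
  case True
  then have "a = \<one>" using assms(1) unfolding cop_def by simp
  then show ?thesis by (simp add: dv_def)
next
  case False
  let ?P = "\<lambda>n. n \<noteq> \<zero> \<and> dv a (n \<otimes> c)"
  have "D UNIV (\<lambda>\<rho>. \<rho> 0 \<noteq> \<zero> \<and> dv a (\<rho> 0 \<otimes> c))" by (intro D_rules D_dv)
  from least[OF this, of b] obtain n where n: "?P n" and le: "\<And>z. ?P z \<Longrightarrow> n \<preceq> z"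
    using assms(2) False by auto
  have "dv n m" if m: "dv a (m \<otimes> c)" for m
  proof -
    obtain k r where kr: "m = n \<otimes> k \<oplus> r" "r \<prec> n" using division n by blast
    have "dv a (n \<otimes> k \<otimes> c)" using n dv_mult(1)[of a "n \<otimes> c" k] by (simp add: mult_ac)
    moreover have "dv a (n \<otimes> k \<otimes> c \<oplus> r \<otimes> c)" using m kr by (simp add: distrib_right)
    ultimately have "dv a (r \<otimes> c)" by (rule dv_diff)
    then have "r = \<zero>" using le kr(2) by (metis ord.not_le)
    then show ?thesis using kr unfolding dv_def by auto
  qed
  then have "dv n a" "dv n b" using assms(2) dv_mult(1)[OF dv_refl] by blast+
  then have "n = \<one>" using assms(1) unfolding cop_def by blast
  then show ?thesis using n by simp
qed

text \<open>Goedel's coding: \<open>d\<close> is a pair of a number \<open>c\<close> and a step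
  \<open>e\<close>, and \<open>u\<close> belongs to the coded set if the modulus
  \<open>(u + 1) * e + 1\<close> divides \<open>c\<close>.\<close>

definition E :: "'a \<Rightarrow> 'a \<Rightarrow> bool" where
  "E u d \<longleftrightarrow> dv ((u \<oplus> \<one>) \<otimes> ps d \<oplus> \<one>) (pf d)"

lemma D_E: "DT C s \<Longrightarrow> DT C t \<Longrightarrow> D C (\<lambda>\<rho>. E (s \<rho>) (t \<rho>))"
  unfolding E_def by (intro D_rules D_dv DT_ps DT_pf)

text \<open>A substitute for the factorial of \<open>b\<close>, whose definition would already need
  coded sequences; mere existence can be proved by induction.\<close>

lemma common_multiple: "\<exists>e. e \<noteq> \<zero> \<and> (\<forall>i. i \<noteq> \<zero> \<longrightarrow> i \<preceq> b \<longrightarrow> dv i e)"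
proof (rule induct[of "\<lambda>b. \<exists>e. e \<noteq> \<zero> \<and> (\<forall>i. i \<noteq> \<zero> \<longrightarrow> i \<preceq> b \<longrightarrow> dv i e)"])
  show "D UNIV (\<lambda>\<rho>. \<exists>e. e \<noteq> \<zero> \<and> (\<forall>i. i \<noteq> \<zero> \<longrightarrow> i \<preceq> \<rho> 0 \<longrightarrow> dv i e))"
    by (intro D_rules D_dv)
  show "\<exists>e. e \<noteq> \<zero> \<and> (\<forall>i. i \<noteq> \<zero> \<longrightarrow> i \<preceq> \<zero> \<longrightarrow> dv i e)"
    using zero_ne_one(2) le_zero by blast
next
  fix b assume "\<exists>e. e \<noteq> \<zero> \<and> (\<forall>i. i \<noteq> \<zero> \<longrightarrow> i \<preceq> b \<longrightarrow> dv i e)"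
  then obtain e where e: "e \<noteq> \<zero>" "\<And>i. i \<noteq> \<zero> \<Longrightarrow> i \<preceq> b \<Longrightarrow> dv i e" by blast
  have "dv i (e \<otimes> (b \<oplus> \<one>))" if i: "i \<noteq> \<zero>" "i \<preceq> b \<oplus> \<one>" for i
  proof (cases "i = b \<oplus> \<one>")
    case False
    then have "i \<preceq> b" using i(2) by (metis lt_succ_le lt_def)
    then show ?thesis using e(2) i(1) dv_mult by blast
  qed (simp add: dv_mult)
  then show "\<exists>e. e \<noteq> \<zero> \<and> (\<forall>i. i \<noteq> \<zero> \<longrightarrow> i \<preceq> b \<oplus> \<one> \<longrightarrow> dv i e)"
    using e(1) by (intro exI[of _ "e \<otimes> (b \<oplus> \<one>)"]) simp
qed

text \<open>The difference of the two moduli is \<open>e * (j - i)\<close>, and a common divisor is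
  coprime to \<open>e\<close> because a modulus is one more than a multiple of \<open>e\<close>. So
  it divides \<open>j - i\<close>, which divides \<open>e\<close> since it is at most
  \<open>b\<close>; being coprime to \<open>e\<close>, the divisor is \<open>1\<close>.\<close>

lemma cop_code:
  assumes "\<And>i. i \<noteq> \<zero> \<Longrightarrow> i \<preceq> b \<Longrightarrow> dv i e" and "i \<prec> j" "j \<preceq> b"
  shows "cop ((i \<oplus> \<one>) \<otimes> e \<oplus> \<one>) ((j \<oplus> \<one>) \<otimes> e \<oplus> \<one>)"
  unfolding cop_def
proof (intro allI impI)
  fix u assume u: "dv u ((i \<oplus> \<one>) \<otimes> e \<oplus> \<one>)" "dv u ((j \<oplus> \<one>) \<otimes> e \<oplus> \<one>)"
  have cop: "v = \<one>" if "dv v u" "dv v e" for v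
  proof -
    have "dv v ((i \<oplus> \<one>) \<otimes> e)" using that dv_mult by blast
    then have "dv v \<one>" using dv_diff dv_trans[OF that(1) u(1)] by blast
    then show ?thesis unfolding dv_def using mult_eq_1 by blast
  qed
  obtain z where z: "i \<oplus> z = j" "z \<noteq> \<zero>" using assms(2) by (metis lt_def le_iff add_0)
  then have "z \<preceq> b" using assms(3) le_add(2)[of z i] by (metis ord.order.trans)
  then have "dv z e" using assms(1) z(2) by blast
  have "(j \<oplus> \<one>) \<otimes> e \<oplus> \<one> = ((i \<oplus> \<one>) \<otimes> e \<oplus> \<one>) \<oplus> e \<otimes> z"
    unfolding z(1)[symmetric] by (simp add: distrib_left distrib_right add_ac mult_ac)
  then have "dv u (e \<otimes> z)" using u dv_diff by metis
  moreover have "cop u e" using cop unfolding cop_def by blast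
  ultimately have "dv u z" using euclid by blast
  then have "dv u e" using \<open>dv z e\<close> dv_trans by blast
  then show "u = \<one>" using cop by simp
qed

lemma set_coding:
  assumes X: "D UNIV (\<lambda>\<rho>. X (\<rho> 0))"
  shows "\<exists>d. \<forall>i. i \<prec> b \<longrightarrow> (E i d \<longleftrightarrow> X i)"
proof -
  obtain e where e: "e \<noteq> \<zero>" "\<And>i. i \<noteq> \<zero> \<Longrightarrow> i \<preceq> b \<Longrightarrow> dv i e" using common_multiple by blast
  define q where "q i = (i \<oplus> \<one>) \<otimes> e \<oplus> \<one>" for i
  have cop: "cop (q i) (q j)" if "i \<prec> b" "j \<prec> b" "i \<noteq> j" for i j
  proof -
    have "i \<prec> j \<or> j \<prec> i" using that(3) by (metis ord.not_less_iff_gr_or_eq)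
    then show ?thesis unfolding q_def using cop_code[OF e(2), of i j] cop_code[OF e(2), of j i] that
      by (auto simp: cop_def)
  qed
  \<comment> \<open>The empty product \<open>\<one>\<close> has to code the empty set.\<close>
  have q1: "\<not> dv (q i) \<one>" for i
  proof
    assume "dv (q i) \<one>"
    then have "(i \<oplus> \<one>) \<otimes> e \<oplus> \<one> = \<zero> \<oplus> \<one>" using mult_eq_1 unfolding dv_def q_def by auto
    then show False using e(1) by (simp only: succ_inj mult_eq_0 succ_nz) simp
  qed
  let ?P = "\<lambda>k. k \<preceq> b \<longrightarrow> (\<exists>c. \<forall>i. i \<prec> b \<longrightarrow> (dv (q i) c \<longleftrightarrow> X i \<and> i \<prec> k))"
  have "?P b"
  proof (rule induct[of ?P])
    have X': "D UNIV (\<lambda>\<rho>. X (t \<rho>))" if "DT UNIV t" for t using D_rel1[OF X that] .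
    show "D UNIV (\<lambda>\<rho>. \<rho> 0 \<preceq> b \<longrightarrow> (\<exists>c. \<forall>i. i \<prec> b \<longrightarrow> (dv (q i) c \<longleftrightarrow> X i \<and> i \<prec> \<rho> 0)))"
      unfolding q_def by (intro D_rules X' D_dv)
    show "?P \<zero>" using q1 by (intro impI exI[of _ \<one>]) simp
  next
    fix k assume IH: "?P k"
    show "?P (k \<oplus> \<one>)"
    proof
      assume "k \<oplus> \<one> \<preceq> b"
      then have k: "k \<prec> b" by (simp add: succ_le_iff)
      then obtain c where c: "\<And>i. i \<prec> b \<Longrightarrow> dv (q i) c \<longleftrightarrow> X i \<and> i \<prec> k" using IH by (auto simp: lt_def)
      have "\<forall>i. i \<prec> b \<longrightarrow> (dv (q i) (if X k then q k \<otimes> c else c) \<longleftrightarrow> X i \<and> i \<prec> k \<oplus> \<one>)"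
      proof (intro allI impI)
        fix i assume i: "i \<prec> b"
        show "dv (q i) (if X k then q k \<otimes> c else c) \<longleftrightarrow> X i \<and> i \<prec> k \<oplus> \<one>"
        proof (cases "i = k")
          case True
          then show ?thesis using c[OF i] by (auto intro: dv_mult)
        next
          case False
          then have "dv (q i) (q k \<otimes> c) \<longleftrightarrow> dv (q i) c"
            using euclid[OF cop[OF i k False]] dv_mult by blast
          moreover have "i \<prec> k \<oplus> \<one> \<longleftrightarrow> i \<prec> k" using False by (metis lt_succ_le lt_def)
          ultimately show ?thesis using c[OF i] by simp
        qed
      qed
      then show "\<exists>c. \<forall>i. i \<prec> b \<longrightarrow> (dv (q i) c \<longleftrightarrow> X i \<and> i \<prec> k \<oplus> \<one>)" by blast
    qed
  qed
  then obtain c where "\<And>i. i \<prec> b \<Longrightarrow> dv (q i) c \<longleftrightarrow> X i" by auto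
  then show ?thesis by (intro exI[of _ "pr c e"]) (simp add: E_def q_def)
qed

section \<open>Sequences of standard length\<close>

definition beta :: "'a \<Rightarrow> 'a \<Rightarrow> 'a" where "beta d i = mu (\<lambda>x. E (pr i x) d)"

lemma DT_beta: "DT C s \<Longrightarrow> DT C t \<Longrightarrow> DT C (\<lambda>\<rho>. beta (s \<rho>) (t \<rho>))"
  by (rule DT_fun2[of C beta]) (unfold beta_def, intro DT_mu D_E D_rules DT_pr)

primrec num :: "nat \<Rightarrow> 'a" where
  "num 0 = \<zero>"
| "num (Suc n) = num n \<oplus> \<one>"

lemma num_lt [simp]: "num m \<prec> num n \<longleftrightarrow> m < n"
proof -
  have lt: "m < n \<Longrightarrow> num m \<prec> num n" for m n
    by (induction n) (auto simp: less_Suc_eq lt_succ_le intro: ord.order.strict_implies_order)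
  then show ?thesis using lt[of n m] by (metis nat_neq_iff ord.less_asym ord.less_irrefl)
qed

lemma num_inj [simp]: "num m = num n \<longleftrightarrow> m = n"
  using num_lt[of m n] num_lt[of n m] by (metis nat_neq_iff ord.less_irrefl)

lemma lt_numD: "x \<prec> num n \<Longrightarrow> \<exists>i<n. x = num i"
  by (induction n) (auto simp: lt_succ_le, metis less_Suc_eq lt_def)

lemma D_in_list: "D UNIV (\<lambda>\<rho>. \<rho> 0 \<in> set us)"
proof (induction us)
  case Nil show ?case using D_bool[of UNIV False] by simp
next
  case (Cons u us)
  have "D UNIV (\<lambda>\<rho>. \<rho> 0 = u \<or> \<rho> 0 \<in> set us)" by (intro D_rules Cons)
  then show ?case by simp
qed

lemma list_bound: "\<exists>b. \<forall>u\<in>set us. u \<prec> b"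
proof (induction us)
  case (Cons u us)
  then obtain b where b: "\<forall>u\<in>set us. u \<prec> b" by blast
  have "v \<prec> b \<oplus> u \<oplus> \<one>" if "v \<preceq> b \<or> v \<preceq> u" for v
    using that by (auto simp: lt_succ_le intro: ord.order.trans)
  then show ?case using b by (intro exI[of _ "b \<oplus> u \<oplus> \<one>"]) (auto simp: lt_def)
qed simp

lemma beta_coding: "\<exists>d. \<forall>i<length xs. beta d (num i) = xs ! i"
proof -
  define us where "us = map (\<lambda>i. pr (num i) (xs ! i)) [0..<length xs]"
  obtain b where b: "\<And>u. u \<in> set us \<Longrightarrow> u \<prec> b" using list_bound by blast
  obtain d where d: "\<And>i. i \<prec> b \<Longrightarrow> E i d \<longleftrightarrow> i \<in> set us" using set_coding[OF D_in_list] by blast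
  have "beta d (num i) = xs ! i" if i: "i < length xs" for i
  proof -
    have us: "pr (num i) (xs ! i) \<in> set us" using i by (auto simp: us_def)
    have def: "D UNIV (\<lambda>\<rho>. E (pr (num i) (\<rho> 0)) d)" by (intro D_E DT_pr D_rules)
    have "E (pr (num i) (xs ! i)) d" using d b us by blast
    note least = mu_least[of "\<lambda>x. E (pr (num i) x) d", OF def this, folded beta_def]
    \<comment> \<open>\<open>E\<close> is controlled below \<open>b\<close> only. Minimality of
      \<open>beta\<close> and monotonicity of \<open>pr\<close> in its second argument keep the new
      pair below \<open>b\<close>.\<close>
    have "pr (num i) (beta d (num i)) \<prec> b"
    proof (cases "beta d (num i) = xs ! i")
      case False
      then show ?thesis using pr_lt2[of "beta d (num i)" "xs ! i" "num i"] least(2) b[OF us]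
        by (metis lt_def ord.order.strict_trans)
    qed (use b us in simp)
    then have "pr (num i) (beta d (num i)) \<in> set us" using least(1) d by blast
    then show ?thesis by (auto simp: us_def)
  qed
  then show ?thesis by blast
qed

end

section \<open>Thinning out definable unbounded sets\<close>

context pa_model
begin

section \<open>Unbounded sets and properties of almost all of their elements\<close>

definition unb :: "('a \<Rightarrow> bool) \<Rightarrow> bool" where "unb X \<longleftrightarrow> (\<forall>a. \<exists>x. a \<prec> x \<and> X x)"

definition ev :: "('a \<Rightarrow> bool) \<Rightarrow> ('a \<Rightarrow> bool) \<Rightarrow> bool" where
  "ev X P \<longleftrightarrow> (\<exists>a. \<forall>x. a \<prec> x \<longrightarrow> X x \<longrightarrow> P x)"

lemma ev_mono: "ev X P \<Longrightarrow> (\<And>x. Y x \<Longrightarrow> X x) \<Longrightarrow> (\<And>x. P x \<Longrightarrow> Q x) \<Longrightarrow> ev Y Q"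
  unfolding ev_def by blast

lemma ev_conj:
  assumes "ev X P" "ev X Q"
  shows "ev X (\<lambda>x. P x \<and> Q x)"
proof -
  obtain a b where "\<forall>x. a \<prec> x \<longrightarrow> X x \<longrightarrow> P x" "\<forall>x. b \<prec> x \<longrightarrow> X x \<longrightarrow> Q x"
    using assms unfolding ev_def by blast
  then have "\<forall>x. a \<oplus> b \<prec> x \<longrightarrow> X x \<longrightarrow> P x \<and> Q x"
    using le_add ord.order.strict_trans1 by blast
  then show ?thesis unfolding ev_def by blast
qed

lemma ev_gt: "ev X (\<lambda>x. a \<prec> x)"
  unfolding ev_def by blast

text \<open>
  No coding of sequences is needed here: an element \<open>x\<close> of \<open>X\<close> itself represents the initial segment
  \<open>Q z x\<close>, \<open>z \<prec> w\<close>, of its row.  The good elements at stage \<open>w\<close> are those whose segment is shared by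
  unboundedly many elements of \<open>X\<close> and is, among these segments, the first one in the lexicographic
  order with \<open>False\<close> before \<open>True\<close>.
\<close>

lemma cohesive:
  assumes Q: "D C (\<lambda>\<rho>. Q (\<rho> 0) (\<rho> 1))" and X: "D C (\<lambda>\<rho>. X (\<rho> 0))" and unb: "unb X"
  obtains H where "D C (\<lambda>\<rho>. H (\<rho> 0))" "unb H" "\<And>x. H x \<Longrightarrow> X x"
    "\<And>z. ev H (Q z) \<or> ev H (\<lambda>x. \<not> Q z x)"
proof -
  define same where "same w x x' \<longleftrightarrow> (\<forall>z. z \<prec> w \<longrightarrow> (Q z x \<longleftrightarrow> Q z x'))" for w x x'
  define big where "big w x \<longleftrightarrow> (\<forall>a. \<exists>x'. a \<prec> x' \<and> X x' \<and> same w x x')" for w x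
  define good where "good x w \<longleftrightarrow> X x \<and> big w x \<and> (\<forall>z. z \<prec> w \<longrightarrow> Q z x \<longrightarrow>
     \<not> (\<forall>a. \<exists>x'. a \<prec> x' \<and> X x' \<and> same z x x' \<and> \<not> Q z x'))" for x w
  have D_same: "D B (\<lambda>\<rho>. same (s \<rho>) (t \<rho>) (u \<rho>))"
    if "DT B s" "DT B t" "DT B u" "C \<subseteq> B" for s t u B
    unfolding same_def by (intro D_rules D_rel2[OF D_mono[OF Q \<open>C \<subseteq> B\<close>]] DT_shift that)
  have D_big: "D B (\<lambda>\<rho>. big (s \<rho>) (t \<rho>))" if "DT B s" "DT B t" "C \<subseteq> B" for s t B
    unfolding big_def by (intro D_rules D_rel1[OF D_mono[OF X \<open>C \<subseteq> B\<close>]] D_same DT_shift that)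
  have D_good: "D B (\<lambda>\<rho>. good (s \<rho>) (t \<rho>))" if "DT B s" "DT B t" "C \<subseteq> B" for s t B
    unfolding good_def
    by (intro D_rules D_rel1[OF D_mono[OF X \<open>C \<subseteq> B\<close>]] D_rel2[OF D_mono[OF Q \<open>C \<subseteq> B\<close>]] D_same D_big
        DT_shift that)
  have same_sym: "same w x y \<Longrightarrow> same w y x" and same_refl: "same w x x" for w x y
    by (auto simp: same_def)
  have same_trans: "same w x y \<Longrightarrow> same w y z \<Longrightarrow> same w x z" for w x y z
    by (auto simp: same_def)
  have same_le: "same w x y \<Longrightarrow> w' \<preceq> w \<Longrightarrow> same w' x y" for w w' x y
    unfolding same_def using ord.order.strict_trans2 by blast
  have same_succ: "same (w \<oplus> \<one>) x y \<longleftrightarrow> same w x y \<and> (Q w x \<longleftrightarrow> Q w y)" for w x y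
    unfolding same_def lt_succ_le by (metis lt_def ord.order.refl)
  have good_same: "good x' w" if "good x w" "same w x x'" "X x'" for x x' w
    unfolding good_def
  proof (intro conjI allI impI)
    show "X x'" by fact
    show "big w x'" using that(1,2) same_trans same_sym unfolding good_def big_def by blast
    fix z assume z: "z \<prec> w" "Q z x'"
    then have "Q z x" using that(2) same_def by blast
    then have "\<not> (\<forall>a. \<exists>y. a \<prec> y \<and> X y \<and> same z x y \<and> \<not> Q z y)"
      using that(1) z(1) unfolding good_def by blast
    moreover have "same z x x'" using same_le that(2) z(1) by (simp add: lt_def)
    ultimately show "\<not> (\<forall>a. \<exists>y. a \<prec> y \<and> X y \<and> same z x' y \<and> \<not> Q z y)"
      using same_trans by blast
  qed
  have good_le: "good x w'" if "good x w" "w' \<preceq> w" for x w w'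
    unfolding good_def
  proof (intro conjI allI impI)
    show "X x" using that unfolding good_def by blast
    show "big w' x" using that same_le unfolding good_def big_def by blast
    fix z assume z: "z \<prec> w'" "Q z x"
    then have "z \<prec> w" using that(2) ord.order.strict_trans2 by blast
    then show "\<not> (\<forall>a. \<exists>y. a \<prec> y \<and> X y \<and> same z x y \<and> \<not> Q z y)"
      using z that(1) unfolding good_def by blast
  qed
  have ex_good: "\<exists>x. good x w" for w
  proof (rule induct[of "\<lambda>w. \<exists>x. good x w"])
    show "D UNIV (\<lambda>\<rho>. \<exists>x. good x (\<rho> 0))" by (intro D_rules D_good) simp
    show "\<exists>x. good x \<zero>" using unb unfolding unb_def good_def big_def same_def by auto
  next
    fix w assume "\<exists>x. good x w"
    then obtain x where x: "good x w" by blast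
    have *: "good x' (w \<oplus> \<one>)" if x': "X x'" "same w x x'"
      and big: "\<forall>a. \<exists>y. a \<prec> y \<and> X y \<and> same w x y \<and> (Q w y \<longleftrightarrow> Q w x')"
      and Q': "Q w x' \<Longrightarrow> \<not> (\<forall>a. \<exists>y. a \<prec> y \<and> X y \<and> same w x y \<and> \<not> Q w y)" for x'
      unfolding good_def
    proof (intro conjI allI impI)
      show "X x'" by fact
      show "big (w \<oplus> \<one>) x'" unfolding big_def same_succ using big x'(2) same_trans same_sym by blast
      fix z assume z: "z \<prec> w \<oplus> \<one>" "Q z x'"
      show "\<not> (\<forall>a. \<exists>y. a \<prec> y \<and> X y \<and> same z x' y \<and> \<not> Q z y)"
      proof (cases "z = w")
        case True
        then show ?thesis using Q' z(2) x'(2) same_trans by blast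
      next
        case False
        then have "z \<prec> w" using z(1) by (metis lt_succ_le lt_def)
        then show ?thesis using good_same[OF x x'(2,1)] z(2) unfolding good_def by blast
      qed
    qed
    \<comment> \<open>The first unbounded segment is extended by \<open>False\<close> if that keeps
      it unbounded. Otherwise almost all elements with this segment satisfy \<open>Q w\<close>, and
      the extension by \<open>True\<close> is unbounded.\<close>
    show "\<exists>x. good x (w \<oplus> \<one>)"
    proof (cases "\<forall>a. \<exists>y. a \<prec> y \<and> X y \<and> same w x y \<and> \<not> Q w y")
      case True
      then obtain x' where "X x'" "same w x x'" "\<not> Q w x'" by blast
      then show ?thesis using *[of x'] True by auto
    next
      case False
      then obtain b where b: "\<And>y. b \<prec> y \<Longrightarrow> X y \<Longrightarrow> same w x y \<Longrightarrow> Q w y" by blast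
      have "\<exists>y. a \<prec> y \<and> X y \<and> same w x y \<and> Q w y" for a
      proof -
        obtain y where y: "a \<oplus> b \<prec> y" "X y" "same w x y" using x unfolding good_def big_def by blast
        then have "a \<prec> y" "b \<prec> y" using le_add ord.order.strict_trans1 by blast+
        then show ?thesis using b y by blast
      qed
      then obtain x' where "X x'" "same w x x'" "Q w x'"
        and "\<forall>a. \<exists>y. a \<prec> y \<and> X y \<and> same w x y \<and> Q w y" by blast
      then show ?thesis using *[of x'] False by auto
    qed
  qed
  have good_unique: "\<forall>x x'. good x w \<longrightarrow> good x' w \<longrightarrow> same w x x'" for w
  proof (rule induct[of "\<lambda>w. \<forall>x x'. good x w \<longrightarrow> good x' w \<longrightarrow> same w x x'"])
    show "D UNIV (\<lambda>\<rho>. \<forall>x x'. good x (\<rho> 0) \<longrightarrow> good x' (\<rho> 0) \<longrightarrow> same (\<rho> 0) x x')"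
      by (intro D_rules D_good D_same) simp_all
    show "\<forall>x x'. good x \<zero> \<longrightarrow> good x' \<zero> \<longrightarrow> same \<zero> x x'" by (simp add: same_def)
  next
    fix w assume IH: "\<forall>x x'. good x w \<longrightarrow> good x' w \<longrightarrow> same w x x'"
    have "Q w x'" if x: "good x (w \<oplus> \<one>)" and x': "good x' (w \<oplus> \<one>)" and "Q w x" for x x'
    proof (rule ccontr)
      assume "\<not> Q w x'"
      have "same w x x'" using IH good_le[OF x le_add(1)] good_le[OF x' le_add(1)] by blast
      moreover have "\<forall>a. \<exists>y. a \<prec> y \<and> X y \<and> same w x' y \<and> (Q w x' \<longleftrightarrow> Q w y)"
        using x' unfolding good_def big_def same_succ by blast
      ultimately have "\<forall>a. \<exists>y. a \<prec> y \<and> X y \<and> same w x y \<and> \<not> Q w y"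
        using \<open>\<not> Q w x'\<close> same_trans by blast
      then show False using x \<open>Q w x\<close> lt_succ unfolding good_def by blast
    qed
    then show "\<forall>x x'. good x (w \<oplus> \<one>) \<longrightarrow> good x' (w \<oplus> \<one>) \<longrightarrow> same (w \<oplus> \<one>) x x'"
      unfolding same_succ using IH good_le[OF _ le_add(1)] by blast
  qed
  \<comment> \<open>One element is chosen for each stage \<open>y\<close>, good at that stage and
    not below it, so that \<open>H\<close> follows the first unbounded branch. Minimality keeps an
    element chosen for an earlier stage from exceeding one chosen for a later stage.\<close>
  define m where "m y h \<longleftrightarrow> y \<preceq> h \<and> good h y \<and> (\<forall>x. y \<preceq> x \<longrightarrow> good x y \<longrightarrow> h \<preceq> x)" for y h
  have ex_m: "\<exists>h. m y h" for y
  proof -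
    obtain x where x: "good x y" using ex_good by blast
    then obtain x' where "y \<prec> x'" "X x'" "same y x x'" unfolding good_def big_def by blast
    then have "y \<preceq> x' \<and> good x' y" using good_same x by (auto simp: lt_def)
    moreover have "D UNIV (\<lambda>\<rho>. y \<preceq> \<rho> 0 \<and> good (\<rho> 0) y)" by (intro D_rules D_good) simp
    ultimately show ?thesis unfolding m_def using least[of "\<lambda>x. y \<preceq> x \<and> good x y"] by blast
  qed
  define H where "H h \<longleftrightarrow> (\<exists>y. m y h)" for h
  show ?thesis
  proof
    show "D C (\<lambda>\<rho>. H (\<rho> 0))" unfolding H_def m_def by (intro D_rules D_good) simp_all
    show "unb H" unfolding unb_def
    proof
      fix a
      obtain h where h: "m (a \<oplus> \<one>) h" using ex_m by blast
      then have "a \<prec> h" unfolding m_def succ_le_iff by (elim conjE)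
      then show "\<exists>x. a \<prec> x \<and> H x" using h unfolding H_def by (intro exI conjI)
    qed
    show "X x" if "H x" for x using that unfolding H_def m_def good_def by blast
    fix z
    obtain g where g: "m (z \<oplus> \<one>) g" using ex_m by blast
    have "Q z h \<longleftrightarrow> Q z g" if gh: "g \<prec> h" "H h" for h
    proof -
      obtain y where y: "m y h" using gh(2) H_def by blast
      \<comment> \<open>If \<open>h\<close> came from an earlier stage, \<open>g\<close> would be a
        candidate there too, so \<open>h\<close> could not lie above \<open>g\<close>.\<close>
      have "z \<oplus> \<one> \<preceq> y"
      proof (rule ccontr)
        assume "\<not> z \<oplus> \<one> \<preceq> y"
        then have "y \<preceq> z \<oplus> \<one>" by simp
        then have "y \<preceq> g" "good g y" using g good_le unfolding m_def by auto
        then have "h \<preceq> g" using y unfolding m_def by blast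
        then show False using gh(1) by simp
      qed
      then have "good h (z \<oplus> \<one>)" using y good_le unfolding m_def by blast
      then have "same (z \<oplus> \<one>) h g" using good_unique g unfolding m_def by blast
      then show ?thesis unfolding same_succ by blast
    qed
    then show "ev H (Q z) \<or> ev H (\<lambda>x. \<not> Q z x)" unfolding ev_def by (cases "Q z g") blast+
  qed
qed

text \<open>Collection for a definable function: the initial segment may be infinite when seen from
  outside, so the bound is found by induction inside the model.\<close>

lemma bounding:
  assumes "DT UNIV (\<lambda>\<rho>. G (\<rho> 0))"
  shows "\<exists>g. \<forall>s. s \<preceq> a \<longrightarrow> G s \<preceq> g"
proof (rule induct[of "\<lambda>a. \<exists>g. \<forall>s. s \<preceq> a \<longrightarrow> G s \<preceq> g"])
  show "D UNIV (\<lambda>\<rho>. \<exists>g. \<forall>s. s \<preceq> \<rho> 0 \<longrightarrow> G s \<preceq> g)" by (intro D_rules DT_fun1[OF assms])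
next
  show "\<exists>g. \<forall>s. s \<preceq> \<zero> \<longrightarrow> G s \<preceq> g" by (intro exI[of _ "G \<zero>"]) simp
next
  fix a assume "\<exists>g. \<forall>s. s \<preceq> a \<longrightarrow> G s \<preceq> g"
  then obtain g where g: "\<And>s. s \<preceq> a \<Longrightarrow> G s \<preceq> g" by blast
  have "G s \<preceq> g \<oplus> G (a \<oplus> \<one>)" if "s \<preceq> a \<oplus> \<one>" for s
  proof (cases "s = a \<oplus> \<one>")
    case False
    then have "s \<preceq> a" using that by (metis lt_def lt_succ_le)
    then show ?thesis using g le_add(1) ord.order.trans by blast
  qed simp
  then show "\<exists>g. \<forall>s. s \<preceq> a \<oplus> \<one> \<longrightarrow> G s \<preceq> g" by blast
qed

text \<open>The greedy subset: scanning upwards, \<open>x\<close> is accepted if it exceeds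
  \<open>G s\<close> for all \<open>s\<close> accepted so far. The recursion refers to its own past,
  so it is carried out on codes \<open>d\<close> of the accepted elements below
  \<open>b\<close>.\<close>

lemma sparse:
  assumes G: "DT C (\<lambda>\<rho>. G (\<rho> 0))" and X: "D C (\<lambda>\<rho>. X (\<rho> 0))" and unb: "unb X"
  obtains Y where "D C (\<lambda>\<rho>. Y (\<rho> 0))" "unb Y" "\<And>x. Y x \<Longrightarrow> X x"
    "\<And>x x'. Y x \<Longrightarrow> Y x' \<Longrightarrow> x \<prec> x' \<Longrightarrow> G x \<prec> x'"
proof -
  define gd where "gd b d \<longleftrightarrow>
    (\<forall>x. x \<prec> b \<longrightarrow> (E x d \<longleftrightarrow> X x \<and> (\<forall>s. s \<prec> x \<longrightarrow> E s d \<longrightarrow> G s \<prec> x)))" for b d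
  have D_gd: "D B (\<lambda>\<rho>. gd (s \<rho>) (t \<rho>))" if "DT B s" "DT B t" "C \<subseteq> B" for s t B
    unfolding gd_def
    by (intro D_rules D_E D_rel1[OF D_mono[OF X \<open>C \<subseteq> B\<close>]] DT_fun1[OF DT_mono[OF G \<open>C \<subseteq> B\<close>]]
        DT_shift that)
  have ex_gd: "\<exists>d. gd b d" for b
  proof (rule induct[of "\<lambda>b. \<exists>d. gd b d"])
    show "D UNIV (\<lambda>\<rho>. \<exists>d. gd (\<rho> 0) d)" by (intro D_rules D_gd) simp
    show "\<exists>d. gd \<zero> d" by (simp add: gd_def)
  next
    fix b assume "\<exists>d. gd b d"
    then obtain d where d: "gd b d" by blast
    define B where "B \<longleftrightarrow> X b \<and> (\<forall>s. s \<prec> b \<longrightarrow> E s d \<longrightarrow> G s \<prec> b)"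
    have "D UNIV (\<lambda>\<rho>. \<rho> 0 \<prec> b \<and> E (\<rho> 0) d \<or> \<rho> 0 = b \<and> B)" by (intro D_rules D_E)
    then obtain d' where d': "\<And>x. x \<prec> b \<oplus> \<one> \<Longrightarrow> E x d' \<longleftrightarrow> x \<prec> b \<and> E x d \<or> x = b \<and> B"
      using set_coding[of "\<lambda>x. x \<prec> b \<and> E x d \<or> x = b \<and> B"] by blast
    have *: "E s d' \<longleftrightarrow> E s d" if "s \<prec> b" for s
      using d'[of s] that by (metis lt_succ_le lt_def)
    have "gd (b \<oplus> \<one>) d'" unfolding gd_def
    proof (intro allI impI)
      fix x assume x: "x \<prec> b \<oplus> \<one>"
      show "E x d' \<longleftrightarrow> X x \<and> (\<forall>s. s \<prec> x \<longrightarrow> E s d' \<longrightarrow> G s \<prec> x)"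
      proof (cases "x = b")
        case True
        then show ?thesis using d'[OF x] * by (auto simp: B_def)
      next
        case False
        then have xb: "x \<prec> b" using x by (metis lt_def lt_succ_le)
        then have "E s d' \<longleftrightarrow> E s d" if "s \<prec> x" for s using * that ord.order.strict_trans by blast
        then show ?thesis using d xb * unfolding gd_def by blast
      qed
    qed
    then show "\<exists>d. gd (b \<oplus> \<one>) d" by blast
  qed
  have unique: "gd b d \<Longrightarrow> gd b' d' \<Longrightarrow> x \<prec> b \<Longrightarrow> x \<prec> b' \<Longrightarrow> E x d \<longleftrightarrow> E x d'" for b d b' d' x
  proof (rule strong_induct[of "\<lambda>x. x \<prec> b \<longrightarrow> x \<prec> b' \<longrightarrow> (E x d \<longleftrightarrow> E x d')", rule_format])
    show "D UNIV (\<lambda>\<rho>. \<rho> 0 \<prec> b \<longrightarrow> \<rho> 0 \<prec> b' \<longrightarrow> (E (\<rho> 0) d \<longleftrightarrow> E (\<rho> 0) d'))"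
      by (intro D_rules D_E)
  next
    fix x assume d: "gd b d" "gd b' d'" and x: "x \<prec> b" "x \<prec> b'"
      and IH: "\<And>y. y \<prec> x \<Longrightarrow> y \<prec> b \<Longrightarrow> y \<prec> b' \<Longrightarrow> E y d \<longleftrightarrow> E y d'"
    have "E y d \<longleftrightarrow> E y d'" if "y \<prec> x" for y
      using IH that x ord.order.strict_trans by blast
    then show "E x d \<longleftrightarrow> E x d'" using d x unfolding gd_def by blast
  qed
  define Y where "Y x \<longleftrightarrow> (\<exists>d. gd (x \<oplus> \<one>) d \<and> E x d)" for x
  have Y: "Y x \<longleftrightarrow> E x d" if "gd b d" "x \<prec> b" for x b d
    unfolding Y_def using unique[OF that(1) _ that(2)] ex_gd lt_succ by blast
  have Y_iff: "Y x \<longleftrightarrow> X x \<and> (\<forall>s. s \<prec> x \<longrightarrow> Y s \<longrightarrow> G s \<prec> x)" for x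
  proof -
    obtain d where d: "gd (x \<oplus> \<one>) d" using ex_gd by blast
    have "Y s \<longleftrightarrow> E s d" if "s \<preceq> x" for s using Y[OF d] that by (simp add: lt_succ_le)
    then show ?thesis using d lt_succ[of x] unfolding gd_def by (metis lt_def ord.order.refl)
  qed
  show ?thesis
  proof
    show "D C (\<lambda>\<rho>. Y (\<rho> 0))" unfolding Y_def by (intro D_rules D_gd D_E) simp
    show "X x" if "Y x" for x using that Y_iff by blast
    show "G x \<prec> x'" if "Y x" "Y x'" "x \<prec> x'" for x x' using that Y_iff by blast
    \<comment> \<open>Were all accepted elements at most \<open>a\<close>, their values under
      \<open>G\<close> would have a common bound \<open>g\<close>, and an element of
      \<open>X\<close> above both \<open>a\<close> and \<open>g\<close> would be accepted.\<close>
    show "unb Y" unfolding unb_def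
    proof (rule ccontr, simp only: not_all not_ex)
      assume "\<exists>a. \<forall>x. \<not> (a \<prec> x \<and> Y x)"
      then obtain a where a: "\<And>x. a \<prec> x \<Longrightarrow> \<not> Y x" by blast
      obtain g where g: "\<And>s. s \<preceq> a \<Longrightarrow> G s \<preceq> g" using bounding[OF DT_mono[OF G]] by blast
      obtain x where x: "a \<oplus> g \<prec> x" "X x" using unb unfolding unb_def by blast
      then have ax: "a \<prec> x" "g \<prec> x" using le_add ord.order.strict_trans1 by blast+
      have "G s \<prec> x" if "Y s" for s
        using a[of s] that g[of s] ax(2) by (metis ord.not_less ord.order.strict_trans1)
      then have "Y x" using Y_iff x(2) by blast
      then show False using a ax(1) by blast
    qed
  qed
qed

text \<open>Cohesiveness for the fibres of \<open>F y\<close> makes \<open>F y\<close> on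
  \<open>H\<close> either eventually constant or divergent. In the divergent case the gaps of
  \<open>Y\<close> are so large that neither \<open>F y\<close> nor its inverse can lead from one
  large element of \<open>Y\<close> to a different one.\<close>

lemma thin_binary:
  assumes F: "DT C (\<lambda>\<rho>. F (\<rho> 0) (\<rho> 1))" and X: "D C (\<lambda>\<rho>. X (\<rho> 0))" and unb: "unb X"
  obtains Y where "D C (\<lambda>\<rho>. Y (\<rho> 0))" "unb Y" "\<And>x. Y x \<Longrightarrow> X x"
    "\<And>y. (\<exists>c. ev Y (\<lambda>x. F y x = c)) \<or> ev Y (\<lambda>x. Y (F y x) \<longrightarrow> F y x = x)"
proof -
  \<comment> \<open>\<open>z\<close> codes an argument \<open>y\<close> together with a value
    \<open>c\<close>, so that a single cohesive set decides all the predicates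
    \<open>F y x = c\<close>.\<close>
  have "D C (\<lambda>\<rho>. F (pf (\<rho> 0)) (\<rho> 1) = ps (\<rho> 0))"
    by (intro D_rules DT_fun2[OF F] DT_pf DT_ps)
  from cohesive[OF this X unb] obtain H where H: "D C (\<lambda>\<rho>. H (\<rho> 0))" "unb H" "\<And>x. H x \<Longrightarrow> X x"
    and coh: "\<And>z. ev H (\<lambda>x. F (pf z) x = ps z) \<or> ev H (\<lambda>x. F (pf z) x \<noteq> ps z)" by blast
  define inf where "inf y \<longleftrightarrow> (\<forall>b. ev H (\<lambda>x. b \<prec> F y x))" for y
  have D_F: "DT UNIV (\<lambda>\<rho>. F (s \<rho>) (t \<rho>))" if "DT UNIV s" "DT UNIV t" for s t
    by (intro DT_fun2[OF DT_mono[OF F]] that) simp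
  have D_H: "D UNIV (\<lambda>\<rho>. H (s \<rho>))" if "DT UNIV s" for s
    by (intro D_rel1[OF D_mono[OF H(1)]] that) simp
  have dichotomy: "(\<exists>c. ev H (\<lambda>x. F y x = c)) \<or> inf y" for y
  proof (rule disjCI)
    assume "\<not> inf y"
    show "\<exists>c. ev H (\<lambda>x. F y x = c)"
    proof (rule ccontr)
      assume *: "\<nexists>c. ev H (\<lambda>x. F y x = c)"
      have ne: "ev H (\<lambda>x. F y x \<noteq> c)" for c using coh[of "pr y c"] * by auto
      \<comment> \<open>The bound is raised one step at a time, by discarding one more value;
        induction inside the model carries this through nonstandard \<open>b\<close>.\<close>
      have "ev H (\<lambda>x. b \<prec> F y x)" for b
      proof (rule induct[of "\<lambda>b. ev H (\<lambda>x. b \<prec> F y x)"])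
        show "D UNIV (\<lambda>\<rho>. ev H (\<lambda>x. \<rho> 0 \<prec> F y x))" unfolding ev_def by (intro D_rules D_F D_H)
        show "ev H (\<lambda>x. \<zero> \<prec> F y x)" using ne[of \<zero>] by (simp add: pos_iff)
        show "ev H (\<lambda>x. b \<oplus> \<one> \<prec> F y x)" if "ev H (\<lambda>x. b \<prec> F y x)" for b
          by (rule ev_mono[OF ev_conj[OF that ne[of "b \<oplus> \<one>"]]])
            (metis lt_def succ_le_iff)+
      qed
      then show False using \<open>\<not> inf y\<close> unfolding inf_def by blast
    qed
  qed
  \<comment> \<open>The first condition will rule out jumps upwards from \<open>b\<close>, the
    second one jumps down to \<open>b\<close>. The second bound exists only for divergent
    \<open>F y\<close>. \<open>G b\<close> then serves all \<open>y\<close> up to \<open>b\<close>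
    at once, which covers each fixed \<open>y\<close> from some point on.\<close>
  define bd where "bd b y g \<longleftrightarrow> F y b \<preceq> g \<and> (inf y \<longrightarrow> (\<forall>x. H x \<longrightarrow> F y x \<preceq> b \<longrightarrow> x \<preceq> g))" for b y g
  have D_bd: "D B (\<lambda>\<rho>. bd (s \<rho>) (t \<rho>) (u \<rho>))" if "DT B s" "DT B t" "DT B u" "C \<subseteq> B" for s t u B
    unfolding bd_def inf_def ev_def
    by (intro D_rules D_rel1[OF D_mono[OF H(1) \<open>C \<subseteq> B\<close>]] DT_fun2[OF DT_mono[OF F \<open>C \<subseteq> B\<close>]] DT_shift that)
  define G where "G b = mu (\<lambda>g. \<forall>y. y \<preceq> b \<longrightarrow> bd b y g)" for b
  have "\<exists>g. \<forall>y. y \<preceq> b \<longrightarrow> bd b y g" for b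
  proof -
    define g1 where "g1 y = mu (bd b y)" for y
    have "bd b y (g1 y)" for y
    proof -
      have "\<exists>g. bd b y g"
      proof (cases "inf y")
        case True
        then obtain a where a: "\<And>x. a \<prec> x \<Longrightarrow> H x \<Longrightarrow> b \<prec> F y x" unfolding inf_def ev_def by blast
        have "x \<preceq> a \<oplus> F y b" if "H x" "F y x \<preceq> b" for x
          using a[of x] that le_add(1) by (metis ord.not_less ord.order.trans)
        then show ?thesis unfolding bd_def using le_add(2) by blast
      qed (auto simp: bd_def)
      moreover have "D UNIV (\<lambda>\<rho>. bd b y (\<rho> 0))" by (intro D_bd D_rules) simp
      ultimately show ?thesis unfolding g1_def using mu_least(1) by blast
    qed
    moreover have "bd b y g'" if "bd b y g" "g \<preceq> g'" for y g g'
      using that unfolding bd_def using ord.order.trans by blast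
    moreover have "DT UNIV (\<lambda>\<rho>. g1 (\<rho> 0))" unfolding g1_def by (intro DT_mu D_bd D_rules) simp
    ultimately show ?thesis using bounding[of g1 b] by blast
  qed
  moreover have "D UNIV (\<lambda>\<rho>. \<forall>y. y \<preceq> b \<longrightarrow> bd b y (\<rho> 0))" for b by (intro D_rules D_bd) simp
  ultimately have G: "y \<preceq> b \<Longrightarrow> bd b y (G b)" for y b
    unfolding G_def using mu_least(1)[of "\<lambda>g. \<forall>y. y \<preceq> b \<longrightarrow> bd b y g"] by blast
  have "DT C (\<lambda>\<rho>. G (\<rho> 0))" unfolding G_def by (intro DT_mu D_rules D_bd) simp
  from sparse[OF this H(1,2)] obtain Y where Y: "D C (\<lambda>\<rho>. Y (\<rho> 0))" "unb Y" "\<And>x. Y x \<Longrightarrow> H x"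
    and sp: "\<And>x x'. Y x \<Longrightarrow> Y x' \<Longrightarrow> x \<prec> x' \<Longrightarrow> G x \<prec> x'" by blast
  show ?thesis
  proof
    show "X x" if "Y x" for x using that Y(3) H(3) by blast
    fix y
    show "(\<exists>c. ev Y (\<lambda>x. F y x = c)) \<or> ev Y (\<lambda>x. Y (F y x) \<longrightarrow> F y x = x)"
    proof (cases "inf y")
      case True
      then have "ev H (\<lambda>x. y \<prec> F y x)" unfolding inf_def by (rule spec)
      then have "ev Y (\<lambda>x. y \<prec> F y x)" by (rule ev_mono) (use Y(3) in blast)+
      from ev_conj[OF ev_gt this] have ev: "ev Y (\<lambda>x. y \<prec> x \<and> y \<prec> F y x)" .
      have "F y x = x" if "y \<prec> x" "y \<prec> F y x" "Y x" "Y (F y x)" for x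
      proof (rule ccontr)
        assume "F y x \<noteq> x"
        then consider "x \<prec> F y x" | "F y x \<prec> x" using ord.linorder_cases by blast
        then show False
        proof cases
          case 1
          then have "G x \<prec> F y x" using sp that by blast
          moreover have "F y x \<preceq> G x" using G[of y x] that(1) by (simp add: bd_def lt_def)
          ultimately show False by simp
        next
          case 2
          then have "G (F y x) \<prec> x" using sp that by blast
          moreover have "x \<preceq> G (F y x)" using G[of y "F y x"] that True Y(3) by (simp add: bd_def lt_def)
          ultimately show False by simp
        qed
      qed
      then have "ev Y (\<lambda>x. Y (F y x) \<longrightarrow> F y x = x)" using ev unfolding ev_def by blast
      then show ?thesis ..
    next
      case False
      then obtain c where "ev H (\<lambda>x. F y x = c)" using dichotomy[of y] by (elim disjE exE) blast+
      then have "ev Y (\<lambda>x. F y x = c)" by (rule ev_mono) (use Y(3) in blast)+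
      then show ?thesis by (intro disjI1 exI)
    qed
  qed (fact Y)+
qed

lemma DT_num: "DT C (\<lambda>\<rho>. num n)"
  by (induction n) (auto intro!: DT_zero DT_plus DT_one)

text \<open>The other coordinates of \<open>s\<close> act as parameters: later they hold the values
  of the smaller generators, while \<open>q\<close> is the largest one.\<close>

definition thins :: "((nat \<Rightarrow> 'a) \<Rightarrow> 'a) \<Rightarrow> nat \<Rightarrow> ('a \<Rightarrow> bool) \<Rightarrow> bool" where
  "thins F q Y \<longleftrightarrow>
    (\<forall>s. (\<exists>c. ev Y (\<lambda>x. F (s(q := x)) = c)) \<or> ev Y (\<lambda>x. Y (F (s(q := x))) \<longrightarrow> F (s(q := x)) = x))"

text \<open>\<open>F\<close> reads a standard finite number of coordinates, so each choice of
  parameters is coded by one number \<open>d\<close>, and the binary case applies to the functions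
  \<open>F2 d\<close>.\<close>

lemma thin:
  assumes F: "DT C F" and X: "D C (\<lambda>\<rho>. X (\<rho> 0))" and unb: "unb X"
  shows "\<exists>Y. D C (\<lambda>\<rho>. Y (\<rho> 0)) \<and> unb Y \<and> (\<forall>x. Y x \<longrightarrow> X x) \<and> thins F q Y"
proof -
  define F2 where "F2 d x = F (\<lambda>i. if i = q then x else beta d (num i))" for d x
  have "DT C (\<lambda>\<rho>. if i = q then \<rho> 1 else beta (\<rho> 0) (num i))" for i
    by (cases "i = q") (auto intro!: DT_var DT_beta DT_num)
  then have "DT C (\<lambda>\<rho>. F2 (\<rho> 0) (\<rho> 1))" unfolding F2_def by (rule DT_comp[OF F])
  from thin_binary[OF this X unb] obtain Y where Y: "D C (\<lambda>\<rho>. Y (\<rho> 0))" "unb Y" "\<And>x. Y x \<Longrightarrow> X x"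
    "\<And>y. (\<exists>c. ev Y (\<lambda>x. F2 y x = c)) \<or> ev Y (\<lambda>x. Y (F2 y x) \<longrightarrow> F2 y x = x)" by blast
  obtain n where n: "\<And>\<rho> \<rho>'. (\<forall>i<n. \<rho> i = \<rho>' i) \<Longrightarrow> F \<rho> = F \<rho>'" using DT_supp[OF F] by blast
  have "(\<exists>c. ev Y (\<lambda>x. F (s(q := x)) = c)) \<or> ev Y (\<lambda>x. Y (F (s(q := x))) \<longrightarrow> F (s(q := x)) = x)" for s
  proof -
    obtain d where d: "\<forall>i<n. beta d (num i) = s i" using beta_coding[of "map s [0..<n]"] by auto
    have "F (s(q := x)) = F2 d x" for x unfolding F2_def by (rule n) (use d in auto)
    then show ?thesis using Y(4)[of d] by simp
  qed
  then show ?thesis unfolding thins_def using Y(1-3) by blast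
qed

end

section \<open>The back-and-forth relations in nonstandard models\<close>

lemma funpow_AEx_in: "afm_in (n + j) p \<Longrightarrow> afm_in n ((AEx ^^ j) p)"
  by (induction j arbitrary: n p) auto

lemma aqfree_asubst: "aqfree p \<Longrightarrow> aqfree (asubst \<sigma> p)"
  by (induction p arbitrary: \<sigma>) auto

lemma aterm_in_rename:
  "aterm_in n t \<Longrightarrow> (\<And>i. i < n \<Longrightarrow> g i < m) \<Longrightarrow> aterm_in m (asubst_tm (\<lambda>i. V (g i)) t)"
  by (induction t) auto

lemma afm_in_rename:
  "aqfree p \<Longrightarrow> afm_in n p \<Longrightarrow> (\<And>i. i < n \<Longrightarrow> g i < m) \<Longrightarrow> afm_in m (asubst (\<lambda>i. V (g i)) p)"
  by (induction p) (auto intro: aterm_in_rename)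

lemma aterm_in_asubst: "(\<And>i. aterm_in n (\<sigma> i)) \<Longrightarrow> aterm_in n (asubst_tm \<sigma> t)"
  by (induction t) auto

lemma afm_in_asubst: "(\<And>i. aterm_in n (\<sigma> i)) \<Longrightarrow> afm_in n (asubst \<sigma> p)"
proof (induction p arbitrary: n \<sigma>)
  case (AEx p)
  have "aterm_in (Suc n) (alift \<sigma> i)" for i
    using AEx.prems aterm_in_rename[of n _ Suc "Suc n"] by (auto simp: alift_def split: nat.split)
  then show ?case using AEx.IH by simp
qed (auto intro: aterm_in_asubst)

lemma aqf_enum_surj: "aqfree p \<Longrightarrow> \<exists>k. aqf_enum k = p"
proof -
  have "inj (\<lambda>i. AEq (V i) (V i))" by (auto simp: inj_def)
  then have "infinite (range (\<lambda>i. AEq (V i) (V i)))" using finite_imageD by blast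
  moreover have "range (\<lambda>i. AEq (V i) (V i)) \<subseteq> {p. aqfree p}" by auto
  ultimately have "infinite {p. aqfree p}" using finite_subset by blast
  then have "range (from_nat_into {p. aqfree p}) = {p. aqfree p}"
    using range_from_nat_into[of "{p. aqfree p}"] countableI_type by fastforce
  then show "aqfree p \<Longrightarrow> ?thesis" unfolding aqf_enum_def by (metis imageE mem_Collect_eq)
qed

lemma enat_less_SucD: "\<gamma> < enat (Suc n) \<Longrightarrow> \<exists>k\<le>n. \<gamma> = enat k"
  by (cases \<gamma>) auto

section \<open>The back-and-forth relation preserves all formulas\<close>

definition eqt :: "'a arith \<Rightarrow> 'a list \<Rightarrow> 'a list \<Rightarrow> bool" where
  "eqt N a b \<longleftrightarrow> length a = length b \<and> (\<forall>p. afm_in (length a) p \<longrightarrow> (asat N a p \<longleftrightarrow> asat N b p))"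

context arith_full
begin

lemma bf_le_0: "bf_le M 0 a b \<longleftrightarrow> length a = length b \<and>
    (\<forall>i<length a. afm_in (length a) (aqf_enum i) \<longrightarrow> (asat M a (aqf_enum i) \<longleftrightarrow> asat M b (aqf_enum i)))"
  by (subst bf_le.simps) simp

lemma bf_le_pos: "\<beta> \<noteq> 0 \<Longrightarrow> bf_le M \<beta> a b \<longleftrightarrow> length a = length b \<and>
    (\<forall>\<gamma>. \<gamma> < \<beta> \<longrightarrow> (\<forall>d. \<exists>c. bf_le M \<gamma> (b @ d) (a @ c)))"
  by (subst bf_le.simps) (simp add: lists_UNIV)

lemma bf_le_Suc: "bf_le M (enat (Suc n)) a b \<longleftrightarrow> length a = length b \<and>
    (\<forall>k\<le>n. \<forall>d. \<exists>c. bf_le M (enat k) (b @ d) (a @ c))"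
  by (subst bf_le_pos) (auto simp: zero_enat_def dest: enat_less_SucD)

lemma bf_le_length: "bf_le M \<beta> a b \<Longrightarrow> length a = length b"
  by (subst (asm) bf_le.simps) simp

lemma bf_le_ext:
  assumes "bf_le M (enat (Suc n)) a b"
  shows "\<exists>c. length c = length d \<and> bf_le M (enat n) (b @ d) (a @ c)"
proof -
  obtain c where "bf_le M (enat n) (b @ d) (a @ c)" using assms unfolding bf_le_Suc by blast
  moreover then have "length c = length d" using bf_le_length[of "enat n" "b @ d" "a @ c"] assms bf_le_Suc by auto
  ultimately show ?thesis by blast
qed

text \<open>The empty move already swaps the two sides, so both directions are available at the
  price of one level.\<close>

lemma bf_le_swap: "bf_le M (enat (Suc n)) a b \<Longrightarrow> bf_le M (enat n) b a"
  using bf_le_ext[of n a b "[]"] by simp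

lemma bf_le_pred: "bf_le M (enat (Suc n)) a b \<Longrightarrow> bf_le M (enat n) a b"
proof (cases n)
  case 0
  assume "bf_le M (enat (Suc n)) a b"
  then have "bf_le M 0 b a" using bf_le_swap[of n a b] 0 by (simp add: zero_enat_def)
  then have "bf_le M 0 a b" by (auto simp: bf_le_0)
  then show ?thesis using 0 by (simp add: zero_enat_def)
next
  case (Suc k)
  assume "bf_le M (enat (Suc n)) a b"
  then show ?thesis unfolding Suc bf_le_Suc using le_SucI by blast
qed

lemma bf_le_mono: "bf_le M (enat n) a b \<Longrightarrow> k \<le> n \<Longrightarrow> bf_le M (enat k) a b"
  by (induction n) (auto simp: le_Suc_eq dest: bf_le_pred)

text \<open>Level 0 tests only as many quantifier-free formulas as the tuple is long. At level 1 the
  tuple can be lengthened by \<open>d\<close> until the index of the given formula is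
  covered.\<close>

lemma bf_le_qfree:
  assumes "bf_le M (enat (Suc 0)) a b" "aqfree p" "afm_in n p" "\<And>i. i < n \<Longrightarrow> g i < length a"
  shows "esat M (\<lambda>i. a ! g i) p \<longleftrightarrow> esat M (\<lambda>i. b ! g i) p"
proof -
  let ?q = "asubst (\<lambda>i. V (g i)) p"
  obtain k where k: "aqf_enum k = ?q" using aqf_enum_surj[OF aqfree_asubst[OF assms(2)]] by blast
  obtain d :: "'a list" where d: "length d = Suc k" by (rule that[OF length_replicate])
  obtain c where c: "length c = length d" "bf_le M (enat 0) (b @ d) (a @ c)"
    using bf_le_ext[OF assms(1)] by blast
  have len: "length a = length b" using bf_le_length assms(1) by blast
  have "afm_in (length (b @ d)) ?q" by (rule afm_in_rename[OF assms(2,3)]) (use assms(4) len in force)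
  then have "asat M (b @ d) ?q \<longleftrightarrow> asat M (a @ c) ?q"
    using c(2) d unfolding k[symmetric] zero_enat_def[symmetric] bf_le_0 by simp
  then have "esat M (\<lambda>i. (b @ d) ! g i) p \<longleftrightarrow> esat M (\<lambda>i. (a @ c) ! g i) p"
    by (simp add: asat_esat esat_asubst)
  moreover have "esat M (\<lambda>i. (b @ d) ! g i) p \<longleftrightarrow> esat M (\<lambda>i. b ! g i) p"
    by (rule esat_cong[OF assms(3)]) (use assms(4) len in \<open>simp add: nth_append\<close>)
  moreover have "esat M (\<lambda>i. (a @ c) ! g i) p \<longleftrightarrow> esat M (\<lambda>i. a ! g i) p"
    by (rule esat_cong[OF assms(3)]) (use assms(4) len in \<open>simp add: nth_append\<close>)
  ultimately show ?thesis by simp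
qed

text \<open>Each quantifier costs two levels, one for the move and one for the swap of sides. The
  map \<open>g\<close> is there because de Bruijn indices put the new element first, whereas the
  game appends it at the end.\<close>

lemma bf_le_formula:
  "\<exists>k. \<forall>a b n g. bf_le M (enat k) a b \<longrightarrow> afm_in n p \<longrightarrow> (\<forall>i<n. g i < length a) \<longrightarrow>
     (esat M (\<lambda>i. a ! g i) p \<longleftrightarrow> esat M (\<lambda>i. b ! g i) p)"
proof (induction p)
  case (AEq s t)
  show ?case by (intro exI[of _ "Suc 0"] allI impI, rule bf_le_qfree) auto
next
  case (ALe s t)
  show ?case by (intro exI[of _ "Suc 0"] allI impI, rule bf_le_qfree) auto
next
  case (ANeg p)
  then show ?case by simp
next
  case (AAnd p q)
  obtain k where k: "\<And>a b n g. bf_le M (enat k) a b \<Longrightarrow> afm_in n p \<Longrightarrow> (\<forall>i<n. g i < length a) \<Longrightarrow>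
     (esat M (\<lambda>i. a ! g i) p \<longleftrightarrow> esat M (\<lambda>i. b ! g i) p)" using AAnd by blast
  obtain l where l: "\<And>a b n g. bf_le M (enat l) a b \<Longrightarrow> afm_in n q \<Longrightarrow> (\<forall>i<n. g i < length a) \<Longrightarrow>
     (esat M (\<lambda>i. a ! g i) q \<longleftrightarrow> esat M (\<lambda>i. b ! g i) q)" using AAnd by blast
  show ?case
  proof (intro exI[of _ "max k l"] allI impI)
    fix a b n and g :: "nat \<Rightarrow> nat"
    assume *: "bf_le M (enat (max k l)) a b" "afm_in n (AAnd p q)" "\<forall>i<n. g i < length a"
    then have "bf_le M (enat k) a b" "bf_le M (enat l) a b" by (auto intro: bf_le_mono)
    then show "esat M (\<lambda>i. a ! g i) (AAnd p q) \<longleftrightarrow> esat M (\<lambda>i. b ! g i) (AAnd p q)"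
      using k[of a b n g] l[of a b n g] *(2,3) by simp
  qed
next
  case (AEx p)
  then obtain k where k: "\<And>a b n g. bf_le M (enat k) a b \<Longrightarrow> afm_in n p \<Longrightarrow> (\<forall>i<n. g i < length a) \<Longrightarrow>
     (esat M (\<lambda>i. a ! g i) p \<longleftrightarrow> esat M (\<lambda>i. b ! g i) p)" by blast
  have one: "esat M (\<lambda>i. b ! g i) (AEx p)" if bf: "bf_le M (enat (Suc k)) b a"
    and n: "afm_in n (AEx p)" "\<forall>i<n. g i < length a" and sat: "esat M (\<lambda>i. a ! g i) (AEx p)" for a b n g
  proof -
    obtain x where x: "esat M (case_nat x (\<lambda>i. a ! g i)) p" using sat by auto
    obtain c where c: "length c = 1" "bf_le M (enat k) (a @ [x]) (b @ c)"
      using bf_le_ext[OF bf, of "[x]"] by auto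
    then obtain y where y: "c = [y]" by (auto simp: length_Suc_conv)
    have len: "length a = length b" using bf_le_length[OF bf] by simp
    let ?g = "case_nat (length a) g"
    have p: "afm_in (Suc n) p" using n(1) by simp
    have g: "?g i < length (a @ [x])" if "i < Suc n" for i
      using n(2) that by (cases i) (auto simp: less_Suc_eq)
    have *: "(a @ [x]) ! ?g i = case_nat x (\<lambda>i. a ! g i) i" "(b @ [y]) ! ?g i = case_nat y (\<lambda>i. b ! g i) i"
      if "i < Suc n" for i
      using n(2) len that by (cases i; simp add: nth_append)+
    have "esat M (\<lambda>i. (a @ [x]) ! ?g i) p \<longleftrightarrow> esat M (\<lambda>i. (b @ [y]) ! ?g i) p"
      using k[OF c(2)[unfolded y] p] g by blast
    moreover have "esat M (\<lambda>i. (a @ [x]) ! ?g i) p \<longleftrightarrow> esat M (case_nat x (\<lambda>i. a ! g i)) p"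
      by (rule esat_cong[OF p]) (rule *)
    moreover have "esat M (\<lambda>i. (b @ [y]) ! ?g i) p \<longleftrightarrow> esat M (case_nat y (\<lambda>i. b ! g i)) p"
      by (rule esat_cong[OF p]) (rule *)
    ultimately show ?thesis using x by auto
  qed
  show ?case
  proof (intro exI[of _ "Suc (Suc k)"] allI impI)
    fix a b n and g :: "nat \<Rightarrow> nat"
    assume bf: "bf_le M (enat (Suc (Suc k))) a b" and n: "afm_in n (AEx p)" "\<forall>i<n. g i < length a"
    have "\<forall>i<n. g i < length b" using n(2) bf_le_length[OF bf] by simp
    then show "esat M (\<lambda>i. a ! g i) (AEx p) \<longleftrightarrow> esat M (\<lambda>i. b ! g i) (AEx p)"
      using one[OF bf_le_swap[OF bf] n] one[OF bf_le_pred[OF bf] n(1)] by blast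
  qed
qed

lemma bf_le_omega_eqt:
  assumes "bf_le M \<infinity> a b"
  shows "eqt M a b"
proof -
  have "asat M a p \<longleftrightarrow> asat M b p" if p: "afm_in (length a) p" for p
  proof -
    obtain k where k: "\<And>a b n g. bf_le M (enat k) a b \<Longrightarrow> afm_in n p \<Longrightarrow> (\<forall>i<n. g i < length a) \<Longrightarrow>
       (esat M (\<lambda>i. a ! g i) p \<longleftrightarrow> esat M (\<lambda>i. b ! g i) p)" using bf_le_formula[of p] by blast
    have "bf_le M (enat (Suc k)) a b" using assms unfolding bf_le_Suc by (auto simp: bf_le_pos[of \<infinity>])
    then have "bf_le M (enat k) a b" by (rule bf_le_pred)
    from k[OF this p, of "\<lambda>i. i"] show ?thesis by (simp add: asat_esat)
  qed
  then show ?thesis using bf_le_length[OF assms] by (simp add: eqt_def)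
qed

end

text \<open>The internal game compares single operations only, so a formula is transferred by
  playing the values of all its subterms.\<close>

primrec subtms :: "aterm \<Rightarrow> aterm list" where
  "subtms (V i) = [V i]"
| "subtms Zero = [Zero]"
| "subtms One = [One]"
| "subtms (Plus s t) = Plus s t # subtms s @ subtms t"
| "subtms (Times s t) = Times s t # subtms s @ subtms t"

primrec fmtms :: "afm \<Rightarrow> aterm list" where
  "fmtms (AEq s t) = subtms s @ subtms t"
| "fmtms (ALe s t) = subtms s @ subtms t"
| "fmtms (ANeg p) = fmtms p"
| "fmtms (AAnd p q) = fmtms p @ fmtms q"
| "fmtms (AEx p) = fmtms p"

section \<open>The internal game and the converse in nonstandard models\<close>

context pa_model
begin

definition at3 :: "'a \<Rightarrow> 'a \<Rightarrow> 'a \<Rightarrow> 'a \<Rightarrow> 'a \<Rightarrow> 'a \<Rightarrow> bool" where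
  "at3 x y z x' y' z' \<longleftrightarrow> (x = y \<longleftrightarrow> x' = y') \<and> (x \<preceq> y \<longleftrightarrow> x' \<preceq> y') \<and> (x \<oplus> y = z \<longleftrightarrow> x' \<oplus> y' = z') \<and>
     (x \<otimes> y = z \<longleftrightarrow> x' \<otimes> y' = z') \<and> (x = \<zero> \<longleftrightarrow> x' = \<zero>) \<and> (x = \<one> \<longleftrightarrow> x' = \<one>)"

text \<open>
  A back-and-forth game inside the model: the moves are codes of sequences of a possibly nonstandard
  length \<open>m\<close>, and \<open>k\<close> is the number of the remaining moves.  For standard \<open>k\<close> the winning condition is
  arithmetical, which replaces the use of partial truth definitions.
\<close>

primrec G :: "nat \<Rightarrow> 'a \<Rightarrow> ('a \<times> 'a) list \<Rightarrow> bool" where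
  "G 0 m pl \<longleftrightarrow> (\<forall>p\<in>set pl. \<forall>q\<in>set pl. \<forall>r\<in>set pl. \<forall>i. i \<prec> m \<longrightarrow> (\<forall>j. j \<prec> m \<longrightarrow> (\<forall>l. l \<prec> m \<longrightarrow>
     at3 (beta (fst p) i) (beta (fst q) j) (beta (fst r) l) (beta (snd p) i) (beta (snd q) j) (beta (snd r) l))))"
| "G (Suc k) m pl \<longleftrightarrow> (\<forall>d. \<exists>c. G k m ((d, c) # pl)) \<and> (\<forall>c. \<exists>d. G k m ((d, c) # pl))"

text \<open>\<open>k\<close> is fixed from outside and the formula grows with it, while the length
  \<open>\<rho> t\<close> and the codes of the moves are variables and may be nonstandard.\<close>

lemma D_G: "D UNIV (\<lambda>\<rho>. G k (\<rho> t) (map (\<lambda>(i, j). (\<rho> i, \<rho> j)) vs))"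
proof (induction k arbitrary: t vs)
  case 0
  have "D UNIV (\<lambda>\<rho>. \<forall>p\<in>set vs. \<forall>q\<in>set vs. \<forall>r\<in>set vs. \<forall>i. i \<prec> \<rho> t \<longrightarrow> (\<forall>j. j \<prec> \<rho> t \<longrightarrow> (\<forall>l. l \<prec> \<rho> t \<longrightarrow>
     at3 (beta (\<rho> (fst p)) i) (beta (\<rho> (fst q)) j) (beta (\<rho> (fst r)) l)
       (beta (\<rho> (snd p)) i) (beta (\<rho> (snd q)) j) (beta (\<rho> (snd r)) l))))"
    unfolding at3_def by (intro D_all_list D_rules DT_beta)
  then show ?case by (simp add: case_prod_unfold)
next
  case (Suc k)
  let ?vs = "map (\<lambda>(i, j). (i + 2, j + 2)) vs"
  have "D UNIV (\<lambda>\<rho>. G k (\<rho> (t + 2)) (map (\<lambda>(i, j). (\<rho> i, \<rho> j)) ((1, 0) # ?vs)))" by (rule Suc)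
  then have 1: "D UNIV (\<lambda>\<rho>. \<forall>d. \<exists>c. G k (\<rho> t) ((d, c) # map (\<lambda>(i, j). (\<rho> i, \<rho> j)) vs))"
    by (intro D_all D_ex) (simp add: o_def case_prod_unfold)
  have "D UNIV (\<lambda>\<rho>. G k (\<rho> (t + 2)) (map (\<lambda>(i, j). (\<rho> i, \<rho> j)) ((0, 1) # ?vs)))" by (rule Suc)
  then have 2: "D UNIV (\<lambda>\<rho>. \<forall>c. \<exists>d. G k (\<rho> t) ((d, c) # map (\<lambda>(i, j). (\<rho> i, \<rho> j)) vs))"
    by (intro D_all D_ex) (simp add: o_def case_prod_unfold)
  show ?case using D_conj[OF 1 2] by simp
qed

lemma G_swap: "G k m (map prod.swap pl) \<longleftrightarrow> G k m pl"
proof (induction k arbitrary: pl)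
  case 0
  have "at3 x y z x' y' z' \<longleftrightarrow> at3 x' y' z' x y z" for x y z x' y' z' by (auto simp: at3_def)
  then show ?case by simp
next
  case (Suc k)
  have "G k m ((c, d) # map prod.swap pl) \<longleftrightarrow> G k m ((d, c) # pl)" for c d
    using Suc[of "(d, c) # pl"] by simp
  then show ?case by auto
qed

text \<open>The newest pair comes first: a move extends the tuple of entries at the front, where
  quantifiers place their variables.\<close>

definition ents :: "nat \<Rightarrow> ('a \<times> 'a) list \<Rightarrow> ('a \<times> 'a) list" where
  "ents j pl = concat (map (\<lambda>p. map (\<lambda>i. (beta (fst p) (num i), beta (snd p) (num i))) [0..<j]) pl)"

lemma length_ents: "length (ents j pl) = j * length pl"
  unfolding ents_def by (induction pl) auto

lemma ents_Cons: "ents j ((d, c) # pl) =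
    zip (map (\<lambda>i. beta d (num i)) [0..<j]) (map (\<lambda>i. beta c (num i)) [0..<j]) @ ents j pl"
  unfolding ents_def by (simp add: zip_map_map zip_same_conv_map o_def)

lemma in_ents: "p \<in> set pl \<Longrightarrow> i < j \<Longrightarrow> (beta (fst p) (num i), beta (snd p) (num i)) \<in> set (ents j pl)"
  unfolding ents_def by (auto intro!: bexI[of _ p])

definition agree :: "afm set \<Rightarrow> 'a list \<Rightarrow> 'a list \<Rightarrow> bool" where
  "agree \<Delta> xs ys \<longleftrightarrow> (\<forall>p\<in>\<Delta>. esat M ((!) xs) p \<longleftrightarrow> esat M ((!) ys) p)"

lemma agree_sym: "agree \<Delta> xs ys \<Longrightarrow> agree \<Delta> ys xs"
  by (simp add: agree_def)

lemma ex_snoc: "(\<exists>x xs. length xs = j \<and> Q (xs @ [x])) \<longleftrightarrow> (\<exists>xs. length xs = Suc j \<and> Q xs)"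
  by (auto simp: length_Suc_conv_rev)

lemma esat_funpow_AEx: "esat M \<rho> ((AEx ^^ j) p) \<longleftrightarrow>
    (\<exists>xs. length xs = j \<and> esat M (\<lambda>n. if n < j then xs ! n else \<rho> (n - j)) p)"
proof (induction j arbitrary: \<rho>)
  case (Suc j)
  have *: "(\<lambda>n. if n < j then xs ! n else case_nat x \<rho> (n - j)) =
    (\<lambda>n. if n < Suc j then (xs @ [x]) ! n else \<rho> (n - Suc j))" if "length xs = j" for x xs
  proof
    fix n
    show "(if n < j then xs ! n else case_nat x \<rho> (n - j)) = (if n < Suc j then (xs @ [x]) ! n else \<rho> (n - Suc j))"
    proof (cases "n - j")
      case (Suc k)
      then have "n - Suc j = k" "\<not> n < Suc j" by auto
      then show ?thesis using Suc by simp
    qed (use that in \<open>auto simp: nth_append\<close>)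
  qed
  have "esat M \<rho> ((AEx ^^ Suc j) p) \<longleftrightarrow>
    (\<exists>x xs. length xs = j \<and> esat M (\<lambda>n. if n < j then xs ! n else case_nat x \<rho> (n - j)) p)"
    using Suc by simp
  also have "\<dots> \<longleftrightarrow>
    (\<exists>x xs. length xs = j \<and> esat M (\<lambda>n. if n < Suc j then (xs @ [x]) ! n else \<rho> (n - Suc j)) p)"
    using * by (metis (no_types, lifting))
  also have "\<dots> \<longleftrightarrow>
    (\<exists>xs. length xs = Suc j \<and> esat M (\<lambda>n. if n < Suc j then xs ! n else \<rho> (n - Suc j)) p)"
    using ex_snoc[of j "\<lambda>xs. esat M (\<lambda>n. if n < Suc j then xs ! n else \<rho> (n - Suc j)) p"] .
  finally show ?case .
qed simp

lemma ex_diagram: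
  assumes "finite \<Delta>" "\<forall>p\<in>\<Delta>. afm_in n p"
  shows "\<exists>q. afm_in n q \<and> (\<forall>\<rho>. esat M \<rho> q \<longleftrightarrow> (\<forall>p\<in>\<Delta>. esat M \<rho> p \<longleftrightarrow> p \<in> S))"
  using assms
proof (induction rule: finite_induct)
  case empty
  show ?case by (intro exI[of _ "AEq Zero Zero"]) simp
next
  case (insert p \<Delta>)
  then obtain q where q: "afm_in n q" "\<And>\<rho>. esat M \<rho> q \<longleftrightarrow> (\<forall>p\<in>\<Delta>. esat M \<rho> p \<longleftrightarrow> p \<in> S)" by auto
  then show ?case using insert.prems
    by (intro exI[of _ "AAnd (if p \<in> S then p else ANeg p) q"]) auto
qed

text \<open>Which formulas of \<open>\<Delta>\<close> hold at \<open>ds @ xs\<close> is expressed by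
  a single formula; quantifying its first \<open>j\<close> variables gives finitely many formulas,
  one for each subset of \<open>\<Delta>\<close>. Agreement on these provides an answer
  \<open>cs\<close> to \<open>ds\<close>.\<close>

lemma agree_extend:
  assumes "finite \<Delta>" "\<forall>p\<in>\<Delta>. afm_in (n + j) p"
  shows "\<exists>\<Delta>'. finite \<Delta>' \<and> (\<forall>p\<in>\<Delta>'. afm_in n p) \<and> (\<forall>xs ys ds. agree \<Delta>' xs ys \<longrightarrow> length ds = j \<longrightarrow>
    (\<exists>cs. length cs = j \<and> agree \<Delta> (ds @ xs) (cs @ ys)))"
proof -
  obtain q where q: "\<And>S. afm_in (n + j) (q S)"
    "\<And>S \<rho>. esat M \<rho> (q S) \<longleftrightarrow> (\<forall>p\<in>\<Delta>. esat M \<rho> p \<longleftrightarrow> p \<in> S)"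
    using ex_diagram[OF assms] by metis
  let ?D = "(\<lambda>S. (AEx ^^ j) (q S)) ` Pow \<Delta>"
  have nth: "(!) (ds @ xs) = (\<lambda>n. if n < j then ds ! n else xs ! (n - j))" if "length ds = j" for ds xs :: "'a list"
    using that by (intro ext) (simp add: nth_append)
  have "\<exists>cs. length cs = j \<and> agree \<Delta> (ds @ xs) (cs @ ys)"
    if ag: "agree ?D xs ys" and ds: "length ds = j" for xs ys ds
  proof -
    define S where "S = {p \<in> \<Delta>. esat M ((!) (ds @ xs)) p}"
    have "esat M ((!) xs) ((AEx ^^ j) (q S))"
      unfolding esat_funpow_AEx using ds nth[OF ds, of xs] by (intro exI[of _ ds]) (auto simp: q S_def)
    moreover have "(AEx ^^ j) (q S) \<in> ?D" by (auto simp: S_def)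
    ultimately have "esat M ((!) ys) ((AEx ^^ j) (q S))" using ag unfolding agree_def by blast
    then obtain cs where cs: "length cs = j" "esat M ((!) (cs @ ys)) (q S)"
      unfolding esat_funpow_AEx using nth by metis
    then show ?thesis by (intro exI[of _ cs]) (auto simp: q agree_def S_def)
  qed
  moreover have "finite ?D" using assms(1) by simp
  moreover have "\<forall>p\<in>?D. afm_in n p" using q(1) funpow_AEx_in by blast
  ultimately show ?thesis by blast
qed

lemma beta_fun: "\<exists>d. \<forall>i<n. beta d (num i) = f i"
  using beta_coding[of "map f [0..<n]"] by simp

lemma map_beta_coding: "length cs = j \<Longrightarrow> \<exists>c. map (\<lambda>i. beta c (num i)) [0..<j] = cs"
  by (rule exE[OF beta_coding[of cs]]) (auto intro!: exI nth_equalityI)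

text \<open>For a standard length \<open>j\<close> this is an Ehrenfeucht-Fraisse game on finite
  tuples, so finitely many formulas about the entries decide that \<open>k\<close> rounds can be
  survived. They depend on \<open>j\<close>, \<open>l\<close> and \<open>k\<close> only, not on the
  moves played so far.\<close>

lemma G_standard:
  "\<exists>\<Delta>. finite \<Delta> \<and> (\<forall>p\<in>\<Delta>. afm_in (j * l) p) \<and>
     (\<forall>pl. length pl = l \<longrightarrow> agree \<Delta> (map fst (ents j pl)) (map snd (ents j pl)) \<longrightarrow> G k (num j) pl)"
proof (induction k arbitrary: l)
  case 0
  let ?n = "j * l"
  let ?f = "\<lambda>(a, b, c). {AEq (V a) (V b), ALe (V a) (V b), AEq (Plus (V a) (V b)) (V c),
     AEq (Times (V a) (V b)) (V c), AEq (V a) Zero, AEq (V a) One}"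
  define A where "A = \<Union>(?f ` ({..<?n} \<times> {..<?n} \<times> {..<?n}))"
  have "finite A" unfolding A_def by auto
  moreover have "\<forall>p\<in>A. afm_in ?n p" unfolding A_def by auto
  moreover have "G 0 (num j) pl"
    if len: "length pl = l" and ag: "agree A (map fst (ents j pl)) (map snd (ents j pl))" for pl
  proof -
    have "at3 (fst u) (fst v) (fst w) (snd u) (snd v) (snd w)"
      if uvw: "u \<in> set (ents j pl)" "v \<in> set (ents j pl)" "w \<in> set (ents j pl)" for u v w
    proof -
      obtain a b c where abc: "a < ?n" "b < ?n" "c < ?n"
        "u = ents j pl ! a" "v = ents j pl ! b" "w = ents j pl ! c"
        using uvw len by (metis in_set_conv_nth length_ents)
      have "?f (a, b, c) \<subseteq> A" unfolding A_def by (rule UN_upper) (use abc in simp)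
      then have "agree (?f (a, b, c)) (map fst (ents j pl)) (map snd (ents j pl))"
        using ag unfolding agree_def by (meson subsetD)
      then show ?thesis using abc len by (simp add: agree_def at3_def length_ents)
    qed
    then have "at3 (beta (fst p) (num i)) (beta (fst q) (num i')) (beta (fst r) (num i''))
        (beta (snd p) (num i)) (beta (snd q) (num i')) (beta (snd r) (num i''))"
      if "p \<in> set pl" "q \<in> set pl" "r \<in> set pl" "i < j" "i' < j" "i'' < j" for p q r i i' i''
      using in_ents[OF that(1,4)] in_ents[OF that(2,5)] in_ents[OF that(3,6)] by fastforce
    then show ?thesis by (auto dest!: lt_numD)
  qed
  ultimately show ?case by blast
next
  case (Suc k)
  obtain \<Delta> where \<Delta>: "finite \<Delta>" "\<forall>p\<in>\<Delta>. afm_in (j * l + j) p"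
    "\<And>pl. length pl = Suc l \<Longrightarrow> agree \<Delta> (map fst (ents j pl)) (map snd (ents j pl)) \<Longrightarrow> G k (num j) pl"
    using Suc[of "Suc l"] by (auto simp: add.commute)
  obtain \<Delta>' where \<Delta>': "finite \<Delta>'" "\<forall>p\<in>\<Delta>'. afm_in (j * l) p"
    "\<And>xs ys ds. agree \<Delta>' xs ys \<Longrightarrow> length ds = j \<Longrightarrow> \<exists>cs. length cs = j \<and> agree \<Delta> (ds @ xs) (cs @ ys)"
    using agree_extend[OF \<Delta>(1,2)] by blast
  have Suc_k: "G (Suc k) (num j) pl"
    if len: "length pl = l" and ag: "agree \<Delta>' (map fst (ents j pl)) (map snd (ents j pl))" for pl
  proof -
    let ?s = "\<lambda>d. map (\<lambda>i. beta d (num i)) [0..<j]"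
    have G: "G k (num j) ((d, c) # pl)"
      if "agree \<Delta> (?s d @ map fst (ents j pl)) (?s c @ map snd (ents j pl))" for d c
      using \<Delta>(3)[of "(d, c) # pl"] that len by (simp add: ents_Cons map_fst_zip map_snd_zip)
    have "\<exists>c. G k (num j) ((d, c) # pl)" for d
    proof -
      have "length (?s d) = j" by simp
      from \<Delta>'(3)[OF ag this] obtain cs where cs: "length cs = j"
        "agree \<Delta> (?s d @ map fst (ents j pl)) (cs @ map snd (ents j pl))" by (elim exE conjE)
      obtain c where c: "?s c = cs" using map_beta_coding[OF cs(1)] by (elim exE)
      show ?thesis by (rule exI[of _ c], rule G) (simp only: c cs(2))
    qed
    moreover have "\<exists>d. G k (num j) ((d, c) # pl)" for c
    proof -
      have "length (?s c) = j" by simp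
      from \<Delta>'(3)[OF agree_sym[OF ag] this] obtain ds where ds: "length ds = j"
        "agree \<Delta> (?s c @ map snd (ents j pl)) (ds @ map fst (ents j pl))" by (elim exE conjE)
      obtain d where d: "?s d = ds" using map_beta_coding[OF ds(1)] by (elim exE)
      show ?thesis by (rule exI[of _ d], rule G) (simp only: d agree_sym[OF ds(2)])
    qed
    ultimately show ?thesis by simp
  qed
  show ?case
    by (intro exI[of _ \<Delta>'] conjI allI impI) (fact \<Delta>'(1), fact \<Delta>'(2), rule Suc_k)
qed

definition nonstd :: "'a \<Rightarrow> bool" where "nonstd m \<longleftrightarrow> (\<forall>i. num i \<prec> m)"

text \<open>A definable predicate that held at all standard numbers and at no nonstandard one would
  define the standard cut, against induction.\<close>

lemma overspill:
  assumes "D UNIV (\<lambda>\<rho>. P (\<rho> 0))" "\<And>j. P (num j)" "nonstd m"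
  shows "\<exists>m. nonstd m \<and> P m"
proof (rule ccontr)
  assume *: "\<not> ?thesis"
  have std: "\<exists>n. x = num n" if "P x" for x
  proof -
    have "\<not> nonstd x" using * \<open>P x\<close> by blast
    then obtain i where "\<not> num i \<prec> x" unfolding nonstd_def by blast
    then have "x \<preceq> num i" by simp
    then have "x \<prec> num (Suc i)" by (simp add: lt_succ_le)
    then show ?thesis using lt_numD by blast
  qed
  have "P m"
  proof (rule induct[of P, OF assms(1)])
    show "P \<zero>" using assms(2)[of 0] by simp
    fix x assume "P x"
    then obtain n where "x = num n" using std by blast
    then show "P (x \<oplus> \<one>)" using assms(2)[of "Suc n"] by simp
  qed
  then show False using assms(3) * by blast
qed

definition link :: "'a \<Rightarrow> ('a \<times> 'a) list \<Rightarrow> 'a \<Rightarrow> 'a \<Rightarrow> bool" where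
  "link m pl x y \<longleftrightarrow> (\<exists>p\<in>set pl. \<exists>u. u \<prec> m \<and> x = beta (fst p) u \<and> y = beta (snd p) u)"

text \<open>\<open>L\<close> is a partial isomorphism that need not be total. The induction over the
  term works because the value of every subterm lies in its domain, where the graphs of the
  operations can be compared.\<close>

lemma aval_link:
  assumes iso: "\<And>x x' y y' z z'. L x x' \<Longrightarrow> L y y' \<Longrightarrow> L z z' \<Longrightarrow> at3 x y z x' y' z'"
    and ab: "\<And>i. i < length a \<Longrightarrow> L (a ! i) (b ! i)"
  shows "aterm_in (length a) t \<Longrightarrow> (\<And>s. s \<in> set (subtms t) \<Longrightarrow> \<exists>w. L (aval M a s) w) \<Longrightarrow>
    L (aval M a t) (aval M b t)"
proof (induction t)
  case (V i)
  then show ?case using ab by simp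
next
  case Zero
  then obtain w where w: "L \<zero> w" by auto
  then have "w = \<zero>" using iso[OF w w w] by (simp add: at3_def)
  then show ?case using w by simp
next
  case One
  then obtain w where w: "L \<one> w" by auto
  then have "w = \<one>" using iso[OF w w w] by (simp add: at3_def)
  then show ?case using w by simp
next
  case (Plus s t)
  have st: "L (aval M a s) (aval M b s)" "L (aval M a t) (aval M b t)"
    using Plus.prems by (auto intro: Plus.IH)
  obtain w where w: "L (aval M a s \<oplus> aval M a t) w" using Plus.prems(2)[of "Plus s t"] by auto
  then have "w = aval M b s \<oplus> aval M b t" using iso[OF st w] by (simp add: at3_def)
  then show ?case using w by simp
next
  case (Times s t)
  have st: "L (aval M a s) (aval M b s)" "L (aval M a t) (aval M b t)"
    using Times.prems by (auto intro: Times.IH)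
  obtain w where w: "L (aval M a s \<otimes> aval M a t) w" using Times.prems(2)[of "Times s t"] by auto
  then have "w = aval M b s \<otimes> aval M b t" using iso[OF st w] by (simp add: at3_def)
  then show ?case using w by simp
qed

lemma asat_link:
  assumes iso: "\<And>x x' y y' z z'. L x x' \<Longrightarrow> L y y' \<Longrightarrow> L z z' \<Longrightarrow> at3 x y z x' y' z'"
    and ab: "\<And>i. i < length a \<Longrightarrow> L (a ! i) (b ! i)"
  shows "aqfree p \<Longrightarrow> afm_in (length a) p \<Longrightarrow> (\<And>s. s \<in> set (fmtms p) \<Longrightarrow> \<exists>w. L (aval M a s) w) \<Longrightarrow>
    asat M a p \<longleftrightarrow> asat M b p"
proof (induction p)
  case (AEq s t)
  note link = aval_link[where L=L and a=a and b=b, OF iso ab]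
  from AEq have st: "L (aval M a s) (aval M b s)" "L (aval M a t) (aval M b t)"
    by (auto intro: link)
  show ?case using iso[OF st st(1)] by (simp add: at3_def)
next
  case (ALe s t)
  note link = aval_link[where L=L and a=a and b=b, OF iso ab]
  from ALe have st: "L (aval M a s) (aval M b s)" "L (aval M a t) (aval M b t)"
    by (auto intro: link)
  show ?case using iso[OF st st(1)] by (simp add: at3_def)
qed auto

text \<open>Moves of nonstandard length \<open>m\<close> absorb all tuples of standard length. One
  round more than the level is kept in reserve: it plays the values of all subterms of the formula
  tested at level 0.\<close>

lemma G_bf_le:
  assumes "nonstd m"
  shows "G (Suc k) m pl \<Longrightarrow> length a = length b \<Longrightarrow> (\<And>i. i < length a \<Longrightarrow> link m pl (a ! i) (b ! i)) \<Longrightarrow>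
    bf_le M (enat k) a b"
proof (induction k arbitrary: pl a b)
  case 0
  have "asat M a p \<longleftrightarrow> asat M b p" if p: "aqfree p" "afm_in (length a) p" for p
  proof -
    define vs where "vs = map (aval M a) (fmtms p)"
    obtain d where d: "\<And>i. i < length vs \<Longrightarrow> beta d (num i) = vs ! i" using beta_coding by blast
    obtain c where c: "G 0 m ((d, c) # pl)" using 0(1)[unfolded G.simps(2)[of 0]] by blast
    show ?thesis
    proof (rule asat_link[where L="link m ((d, c) # pl)", OF _ _ p])
      show "at3 x y z x' y' z'" if "link m ((d, c) # pl) x x'" "link m ((d, c) # pl) y y'"
        "link m ((d, c) # pl) z z'" for x x' y y' z z'
        using c that unfolding link_def by (auto simp only: G.simps)
      show "link m ((d, c) # pl) (a ! i) (b ! i)" if "i < length a" for i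
        using 0(3)[OF that] unfolding link_def by auto
      fix s assume "s \<in> set (fmtms p)"
      then have "aval M a s \<in> set vs" by (simp add: vs_def)
      then obtain i where i: "i < length vs" "aval M a s = vs ! i" by (metis in_set_conv_nth)
      then have "link m ((d, c) # pl) (aval M a s) (beta c (num i))"
        unfolding link_def using d[OF i(1)] assms i(2)
        by (intro bexI[of _ "(d, c)"] exI[of _ "num i"]) (simp_all add: nonstd_def)
      then show "\<exists>w. link m ((d, c) # pl) (aval M a s) w" by blast
    qed
  qed
  moreover have "aqfree (aqf_enum i)" for i
    unfolding aqf_enum_def using from_nat_into[of "{p. aqfree p}" i] aqfree.simps(1) by blast
  ultimately show ?case using 0(2) by (simp add: bf_le_0 zero_enat_def[symmetric])
next
  case (Suc k)
  have "\<exists>c. bf_le M (enat n) (b @ d) (a @ c)" if n: "n \<le> k" for n d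
  proof -
    obtain c0 where c0: "\<And>i. i < length d \<Longrightarrow> beta c0 (num i) = d ! i" using beta_coding by blast
    \<comment> \<open>The relation swaps sides with each level: \<open>d\<close> is appended to
      \<open>b\<close>, so it is played on the second side, and \<open>G_swap\<close> then exchanges
      the sides.\<close>
    obtain d0 where "G (Suc k) m ((d0, c0) # pl)"
      using Suc.prems(1)[unfolded G.simps(2)[of "Suc k"]] by blast
    then have G: "G (Suc k) m (map prod.swap ((d0, c0) # pl))" by (simp only: G_swap)
    define c where "c = map (\<lambda>i. beta d0 (num i)) [0..<length d]"
    have "bf_le M (enat k) (b @ d) (a @ c)"
    proof (rule Suc.IH[OF G])
      show "length (b @ d) = length (a @ c)" using Suc.prems(2) by (simp add: c_def)
      fix i assume i: "i < length (b @ d)"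
      show "link m (map prod.swap ((d0, c0) # pl)) ((b @ d) ! i) ((a @ c) ! i)"
      proof (cases "i < length a")
        case True
        then have "link m pl (a ! i) (b ! i)" using Suc.prems(3) by blast
        then show ?thesis using True Suc.prems(2) by (auto simp: nth_append link_def)
      next
        case False
        then obtain j where j: "i = length a + j" "j < length d"
          using i Suc.prems(2) by (metis add_diff_inverse_nat length_append nat_add_left_cancel_less)
        have "num j \<prec> m" using assms by (simp add: nonstd_def)
        then show ?thesis using j Suc.prems(2) c0 by (auto simp: nth_append link_def c_def)
      qed
    qed
    then show ?thesis using bf_le_mono n by blast
  qed
  then show ?case using Suc.prems(2) by (auto simp: bf_le_Suc)
qed

lemma eqt_bf_le:
  assumes eq: "eqt M a b" and m: "nonstd m0"
  shows "bf_le M (enat k) a b"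
proof -
  define n where "n = length a"
  have n: "length a = n" "length b = n" using eq by (auto simp: eqt_def n_def)
  \<comment> \<open>The existence of the codes belongs to the overspilled statement: codes chosen
    for a standard length promise nothing about a nonstandard one.\<close>
  let ?P = "\<lambda>m. \<exists>d c. (\<forall>i\<in>set [0..<n]. beta d (num i) = a ! i \<and> beta c (num i) = b ! i) \<and> G (Suc k) m [(d, c)]"
  have "D UNIV (\<lambda>\<rho>. G (Suc k) (\<rho> 2) (map (\<lambda>(i, j). (\<rho> i, \<rho> j)) [(1, 0)]))" by (rule D_G)
  then have DG: "D UNIV (\<lambda>\<rho>. G (Suc k) (\<rho> (Suc (Suc 0))) [(\<rho> (Suc 0), \<rho> 0)])"
    by (simp add: numeral_2_eq_2)
  have "\<exists>m. nonstd m \<and> ?P m"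
  proof (rule overspill[OF _ _ m])
    show "D UNIV (\<lambda>\<rho>. ?P (\<rho> 0))"
      by (intro D_ex D_conj[OF _ DG] D_all_list D_rules DT_beta)
  next
    fix j
    \<comment> \<open>The length \<open>max n j\<close> keeps all of \<open>a\<close> and
      \<open>b\<close> in the codes even if \<open>j < n\<close>. The zeros beyond \<open>n\<close>
      make each entry the value of a term in \<open>a\<close>, respectively in \<open>b\<close>, so
      formulas about entries become formulas about the tuples.\<close>
    obtain d where d: "\<And>i. i < max n j \<Longrightarrow> beta d (num i) = (if i < n then a ! i else \<zero>)"
      using beta_fun[of "max n j" "\<lambda>i. if i < n then a ! i else \<zero>"] by blast
    obtain c where c: "\<And>i. i < max n j \<Longrightarrow> beta c (num i) = (if i < n then b ! i else \<zero>)"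
      using beta_fun[of "max n j" "\<lambda>i. if i < n then b ! i else \<zero>"] by blast
    have "G (Suc k) (num j) [(d, c)]"
    proof -
      obtain \<Delta> where \<Delta>: "\<forall>p\<in>\<Delta>. afm_in j p"
        "\<And>pl. length pl = 1 \<Longrightarrow> agree \<Delta> (map fst (ents j pl)) (map snd (ents j pl)) \<Longrightarrow> G (Suc k) (num j) pl"
        using G_standard[of j 1 "Suc k"] by auto
      let ?\<sigma> = "\<lambda>i. if i < n then V i else Zero"
      have e: "map fst (ents j [(d, c)]) ! i = tval M ((!) a) (?\<sigma> i)"
        "map snd (ents j [(d, c)]) ! i = tval M ((!) b) (?\<sigma> i)" if "i < j" for i
        using that d[of i] c[of i] by (auto simp: ents_def)
      have "esat M ((!) (map fst (ents j [(d, c)]))) p \<longleftrightarrow> esat M ((!) (map snd (ents j [(d, c)]))) p"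
        if "p \<in> \<Delta>" for p
      proof -
        have p: "afm_in j p" using \<Delta>(1) that by blast
        have "esat M ((!) (map fst (ents j [(d, c)]))) p \<longleftrightarrow> esat M ((!) a) (asubst ?\<sigma> p)"
          unfolding esat_asubst by (rule esat_cong[OF p]) (rule e)
        moreover have "esat M ((!) (map snd (ents j [(d, c)]))) p \<longleftrightarrow> esat M ((!) b) (asubst ?\<sigma> p)"
          unfolding esat_asubst by (rule esat_cong[OF p]) (rule e)
        moreover have "afm_in n (asubst ?\<sigma> p)" by (rule afm_in_asubst) simp
        ultimately show ?thesis using eq n by (simp add: eqt_def asat_esat)
      qed
      then show ?thesis using \<Delta>(2) by (simp add: agree_def)
    qed
    then show "?P (num j)" using d c by (intro exI[of _ d] exI[of _ c]) simp
  qed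
  then obtain m d c where mdc: "nonstd m" "\<forall>i\<in>set [0..<n]. beta d (num i) = a ! i \<and> beta c (num i) = b ! i"
    "G (Suc k) m [(d, c)]" by (elim exE conjE)
  have "link m [(d, c)] (a ! i) (b ! i)" if "i < length a" for i
    unfolding link_def using mdc(1,2) n that
    by (intro bexI[of _ "(d, c)"] exI[of _ "num i"]) (simp_all add: nonstd_def)
  then show ?thesis using n by (intro G_bf_le[OF mdc(1,3)]) simp_all
qed

lemma bf_le_omega_iff:
  assumes "nonstd m"
  shows "bf_le M \<infinity> a b \<longleftrightarrow> eqt M a b"
proof
  assume eq: "eqt M a b"
  have "\<exists>c. bf_le M \<gamma> (b @ d) (a @ c)" if lt: "\<gamma> < \<infinity>" for \<gamma> d
  proof -
    obtain k where "\<gamma> = enat k" using lt by (cases \<gamma>) auto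
    then show ?thesis using eqt_bf_le[OF eq assms, of "Suc k"] bf_le_ext by blast
  qed
  then show "bf_le M \<infinity> a b" using eq by (simp add: bf_le_pos eqt_def)
qed (rule bf_le_omega_eqt)

end

section \<open>Iterated ultrapowers along a linear order\<close>

text \<open>Zorn's lemma is applied to families with the finite intersection property rather than to
  filters; maximality then yields complements, supersets and intersections.\<close>

lemma ultrafilter_exists:
  fixes B :: "'b set set"
  assumes fip: "\<And>S. finite S \<Longrightarrow> S \<subseteq> B \<Longrightarrow> \<Inter>S \<noteq> {}"
  obtains U :: "('b \<Rightarrow> bool) \<Rightarrow> bool" where "\<And>P. U (\<lambda>x. \<not> P x) \<longleftrightarrow> \<not> U P"
    "\<And>P Q. U P \<Longrightarrow> U Q \<Longrightarrow> U (\<lambda>x. P x \<and> Q x)" "\<And>P Q. U P \<Longrightarrow> (\<And>x. P x \<Longrightarrow> Q x) \<Longrightarrow> U Q"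
    "\<And>A. A \<in> B \<Longrightarrow> U (\<lambda>x. x \<in> A)"
proof -
  define \<F> where "\<F> = {C. B \<subseteq> C \<and> (\<forall>S. finite S \<longrightarrow> S \<subseteq> C \<longrightarrow> \<Inter>S \<noteq> {})}"
  have "\<exists>F\<in>\<F>. \<forall>X\<in>\<F>. F \<subseteq> X \<longrightarrow> X = F"
  proof (rule subset_Zorn_nonempty)
    show "\<F> \<noteq> {}" using fip unfolding \<F>_def by auto
    fix \<C> assume \<C>: "\<C> \<noteq> {}" "subset.chain \<F> \<C>"
    have "\<Inter>S \<noteq> {}" if S: "finite S" "S \<subseteq> \<Union>\<C>" for S
    proof -
      obtain C where "C \<in> \<C>" "S \<subseteq> C"
        using finite_subset_Union_chain[OF S \<C>] by blast
      then show ?thesis using S(1) \<C>(2) unfolding \<F>_def subset.chain_def by blast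
    qed
    then show "\<Union>\<C> \<in> \<F>" using \<C> unfolding \<F>_def subset.chain_def by blast
  qed
  then obtain F where F: "F \<in> \<F>" "\<And>X. X \<in> \<F> \<Longrightarrow> F \<subseteq> X \<Longrightarrow> X = F" by blast
  have fipF: "\<Inter>S \<noteq> {}" if "finite S" "S \<subseteq> F" for S using F(1) that unfolding \<F>_def by blast
  have not_fip: "\<exists>S. finite S \<and> S \<subseteq> F \<and> A \<inter> \<Inter>S = {}" if A: "A \<notin> F" for A
  proof -
    have "insert A F \<notin> \<F>" using F(2)[of "insert A F"] A by blast
    then obtain S where S: "finite S" "S \<subseteq> insert A F" "\<Inter>S = {}" using F(1) unfolding \<F>_def by blast
    have "A \<inter> \<Inter>(S - {A}) = {}" using S(3) by blast
    then show ?thesis using S(1,2) by (intro exI[of _ "S - {A}"]) auto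
  qed
  have neg: "- A \<in> F \<longleftrightarrow> A \<notin> F" for A
  proof
    assume "- A \<in> F"
    then show "A \<notin> F" using fipF[of "{A, - A}"] by auto
  next
    assume A: "A \<notin> F"
    show "- A \<in> F"
    proof (rule ccontr)
      assume "- A \<notin> F"
      then obtain S S' where "finite S" "S \<subseteq> F" "A \<inter> \<Inter>S = {}" "finite S'" "S' \<subseteq> F" "- A \<inter> \<Inter>S' = {}"
        using not_fip[OF A] not_fip[of "- A"] by blast
      then show False using fipF[of "S \<union> S'"] by (simp add: Inter_Un_distrib) blast
    qed
  qed
  have mono: "A' \<in> F" if "A \<in> F" "A \<subseteq> A'" for A A'
    using that neg[of A'] fipF[of "{A, - A'}"] by auto
  have inter: "A \<inter> A' \<in> F" if "A \<in> F" "A' \<in> F" for A A'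
    using that neg[of "A \<inter> A'"] fipF[of "{A, A', - (A \<inter> A')}"] by auto
  show ?thesis
  proof (rule that[of "\<lambda>P. {x. P x} \<in> F"])
    show "{x. \<not> P x} \<in> F \<longleftrightarrow> {x. P x} \<notin> F" for P using neg[of "{x. P x}"] by (simp add: Collect_neg_eq)
    show "{x. P x \<and> Q x} \<in> F" if "{x. P x} \<in> F" "{x. Q x} \<in> F" for P Q
      using inter[OF that] by (simp add: Collect_conj_eq)
    show "{x. Q x} \<in> F" if "{x. P x} \<in> F" "\<And>x. P x \<Longrightarrow> Q x" for P Q
      using mono[OF that(1)] that(2) by blast
    show "{x. x \<in> A} \<in> F" if "A \<in> B" for A using F(1) that unfolding \<F>_def by auto
  qed
qed

text \<open>
  The type generated by \<open>U\<close> plays the role of a minimal type: in the models below, it is realized by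
  the generators only.
\<close>

locale ultra_model = pa_model M for M :: "'a arith" +
  fixes U :: "('a \<Rightarrow> bool) \<Rightarrow> bool"
  assumes U_neg: "U (\<lambda>x. \<not> P x) \<longleftrightarrow> \<not> U P"
    and U_conjI: "U P \<Longrightarrow> U Q \<Longrightarrow> U (\<lambda>x. P x \<and> Q x)"
    and U_mono: "U P \<Longrightarrow> (\<And>x. P x \<Longrightarrow> Q x) \<Longrightarrow> U Q"
    and U_tail: "U (\<lambda>x. a \<prec> x)"
    and U_thin: "DT {} F \<Longrightarrow> \<exists>Y. D {} (\<lambda>\<rho>. Y (\<rho> 0)) \<and> U Y \<and> thins F q Y"

text \<open>Without parameters there are countably many pairs of a function and a coordinate, so one
  descending sequence of definable unbounded sets meets all requirements. No lower bound of the
  sequence is formed: its members and the tails have the finite intersection property.\<close>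

lemma (in pa_model) ultra_model_exists: "\<exists>U. ultra_model M U"
proof -
  \<comment> \<open>Stage \<open>n\<close> reads its number as a formula and a coordinate. It acts
    only if the formula is the graph of a function, which is then unique.\<close>
  let ?R = "\<lambda>n Y Y'. (\<forall>x. Y' x \<longrightarrow> Y x) \<and> (\<forall>F p q. from_nat n = (p :: afm, q) \<longrightarrow>
      (\<forall>\<rho>. \<rho> 0 = F (\<lambda>i. \<rho> (Suc i)) \<longleftrightarrow> esat M \<rho> p) \<longrightarrow> thins F q Y')"
  have "\<exists>f. \<forall>n. (D {} (\<lambda>\<rho>. f n (\<rho> 0)) \<and> unb (f n)) \<and> ?R n (f n) (f (Suc n))"
  proof (rule dependent_nat_choice)
    show "\<exists>Y. D {} (\<lambda>\<rho>. Y (\<rho> 0)) \<and> unb Y"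
      by (intro exI[of _ "\<lambda>x. True"] conjI D_bool) (auto simp: unb_def intro: lt_succ)
  next
    fix Y n assume Y: "D {} (\<lambda>\<rho>. Y (\<rho> 0)) \<and> unb Y"
    obtain p q where pq: "from_nat n = (p :: afm, q :: nat)" by (cases "from_nat n :: afm \<times> nat")
    show "\<exists>Y'. (D {} (\<lambda>\<rho>. Y' (\<rho> 0)) \<and> unb Y') \<and> ?R n Y Y'"
    proof (cases "\<exists>F. \<forall>\<rho>. \<rho> 0 = F (\<lambda>i. \<rho> (Suc i)) \<longleftrightarrow> esat M \<rho> p")
      case True
      then obtain F where F: "\<forall>\<rho>. \<rho> 0 = F (\<lambda>i. \<rho> (Suc i)) \<longleftrightarrow> esat M \<rho> p" by blast
      have DF: "DT {} F" unfolding defn_def D_iff_esat using F by blast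
      obtain Y' where Y': "D {} (\<lambda>\<rho>. Y' (\<rho> 0))" "unb Y'" "\<And>x. Y' x \<Longrightarrow> Y x"
        "thins F q Y'"
        using thin[where q=q, OF DF conjunct1[OF Y] conjunct2[OF Y]] by blast
      have "F' = F" if F': "\<forall>\<rho>. \<rho> 0 = F' (\<lambda>i. \<rho> (Suc i)) \<longleftrightarrow> esat M \<rho> p" for F'
      proof
        fix s
        show "F' s = F s" using F F' spec[OF F, of "case_nat (F s) s"] spec[OF F', of "case_nat (F s) s"] by simp
      qed
      then show ?thesis using Y' pq by (intro exI[of _ Y']) auto
    next
      case False
      then show ?thesis using Y pq by (intro exI[of _ Y]) auto
    qed
  qed
  then obtain f where f: "\<And>n. D {} (\<lambda>\<rho>. f n (\<rho> 0))" "\<And>n. unb (f n)" and R: "\<And>n. ?R n (f n) (f (Suc n))"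
    by blast
  have dec: "f n x \<Longrightarrow> m \<le> n \<Longrightarrow> f m x" for m n x
  proof (induction n)
    case (Suc n) then show ?case using R[of n] by (cases "m = Suc n") auto
  qed auto
  let ?A = "\<lambda>(n, a). {x. f n x \<and> a \<prec> x}"
  have "\<Inter>S \<noteq> {}" if S: "finite S" "S \<subseteq> range ?A" for S
  proof -
    have "\<exists>n a. ?A (n, a) \<subseteq> \<Inter>S" using S
    proof (induction rule: finite_induct)
      case (insert B S)
      then obtain n a where na: "?A (n, a) \<subseteq> \<Inter>S" by blast
      obtain m b where mb: "B = ?A (m, b)" using insert.prems by auto
      have "?A (max n m, a \<oplus> b) \<subseteq> ?A (n, a) \<inter> ?A (m, b)"
        using dec[of "max n m"] le_add ord.order.strict_trans1 by (auto; blast)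
      then show ?case using na mb by blast
    qed auto
    then obtain n a where "?A (n, a) \<subseteq> \<Inter>S" by blast
    moreover have "?A (n, a) \<noteq> {}" using f(2)[of n] unfolding unb_def by auto
    ultimately show ?thesis by blast
  qed
  then obtain U :: "('a \<Rightarrow> bool) \<Rightarrow> bool" where U: "\<And>P. U (\<lambda>x. \<not> P x) \<longleftrightarrow> \<not> U P"
    "\<And>P Q. U P \<Longrightarrow> U Q \<Longrightarrow> U (\<lambda>x. P x \<and> Q x)" "\<And>P Q. U P \<Longrightarrow> (\<And>x. P x \<Longrightarrow> Q x) \<Longrightarrow> U Q"
    "\<And>A. A \<in> range ?A \<Longrightarrow> U (\<lambda>x. x \<in> A)" using ultrafilter_exists[of "range ?A"] by blast
  have fU: "U (\<lambda>x. f n x \<and> a \<prec> x)" for n a using U(4)[of "?A (n, a)"] by auto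
  have "ultra_model M U"
  proof (unfold_locales)
    show "U (\<lambda>x. a \<prec> x)" for a using U(3)[OF fU[of 0 a]] by blast
    fix F :: "(nat \<Rightarrow> 'a) \<Rightarrow> 'a" and q :: nat assume "DT {} F"
    then obtain p where p: "\<forall>\<rho>. \<rho> 0 = F (\<lambda>i. \<rho> (Suc i)) \<longleftrightarrow> esat M \<rho> p" unfolding defn_def D_iff_esat by blast
    have "from_nat (to_nat (p, q)) = (p, q)" by simp
    then have "thins F q (f (Suc (to_nat (p, q))))" using R[of "to_nat (p, q)"] p by blast
    moreover have "U (f n)" for n using U(3)[OF fU[of n \<zero>]] by blast
    ultimately show "\<exists>Y. D {} (\<lambda>\<rho>. Y (\<rho> 0)) \<and> U Y \<and> thins F q Y" using f(1) by blast
  qed (use U(1-3) in blast)+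
  then show ?thesis by blast
qed

section \<open>Finite supports and increasing lists in a linear order\<close>

definition slt :: "(nat, lsym) struct \<Rightarrow> nat \<Rightarrow> nat \<Rightarrow> bool" where
  "slt L a b \<longleftrightarrow> rel L Leq [a, b] \<and> a \<noteq> b"

definition supp :: "nat set \<Rightarrow> ((nat \<Rightarrow> 'a) \<Rightarrow> 'b) \<Rightarrow> bool" where
  "supp A P \<longleftrightarrow> (\<forall>s s'. (\<forall>q\<in>A. s q = s' q) \<longrightarrow> P s = P s')"

lemma supp_mono: "supp A P \<Longrightarrow> A \<subseteq> B \<Longrightarrow> supp B P"
  unfolding supp_def by blast

definition fsup :: "(nat, lsym) struct \<Rightarrow> ((nat \<Rightarrow> 'a) \<Rightarrow> 'b) \<Rightarrow> bool" where
  "fsup L P \<longleftrightarrow> (\<exists>A. finite A \<and> A \<subseteq> dom L \<and> supp A P)"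

lemma fsup_const: "fsup L (\<lambda>s. c)"
  unfolding fsup_def supp_def by blast

lemma fsup_comp: "fsup L P \<Longrightarrow> fsup L (\<lambda>s. f (P s))"
  unfolding fsup_def supp_def by metis

lemma fsup_comp2:
  assumes "fsup L P" "fsup L Q"
  shows "fsup L (\<lambda>s. f (P s) (Q s))"
proof -
  obtain A B where "finite A" "A \<subseteq> dom L" "supp A P" "finite B" "B \<subseteq> dom L" "supp B Q"
    using assms unfolding fsup_def by blast
  moreover from this have "supp (A \<union> B) (\<lambda>s. f (P s) (Q s))" unfolding supp_def by (metis UnI1 UnI2)
  ultimately show ?thesis unfolding fsup_def by (metis Un_least finite_UnI)
qed

lemmas fsup_eq = fsup_comp2[where f="(=)"]
lemmas fsup_and = fsup_comp2[where f="(\<and>)"]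

lemma fsup_fin:
  fixes F :: "nat \<Rightarrow> (nat \<Rightarrow> 'a) \<Rightarrow> 'b" and P :: "(nat \<Rightarrow> 'a) \<Rightarrow> 'c"
  assumes "\<And>i. fsup L (F i)" and "\<And>s s'. (\<And>i. i < n \<Longrightarrow> F i s = F i s') \<Longrightarrow> P s = P s'"
  shows "fsup L P"
proof -
  obtain A where A: "\<And>i. finite (A i)" "\<And>i. A i \<subseteq> dom L" "\<And>i. supp (A i) (F i)"
    using assms(1) unfolding fsup_def by metis
  have "supp (\<Union>i<n. A i) P" unfolding supp_def
  proof (intro allI impI)
    fix s s' :: "nat \<Rightarrow> 'a" assume "\<forall>q\<in>\<Union>i<n. A i. s q = s' q"
    then have "F i s = F i s'" if "i < n" for i using A(3)[of i] that unfolding supp_def by blast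
    then show "P s = P s'" using assms(2) by blast
  qed
  then show ?thesis unfolding fsup_def using A by (intro exI[of _ "\<Union>i<n. A i"]) auto
qed

context
  fixes L :: "(nat, lsym) struct"
  assumes L: "L \<in> countable_LO"
begin

lemma slt_irrefl: "\<not> slt L a a" by (simp add: slt_def)

lemma slt_trans: "slt L a b \<Longrightarrow> slt L b c \<Longrightarrow> slt L a c"
proof -
  assume ab: "slt L a b" and bc: "slt L b c"
  have "trans {(x, y). rel L Leq [x, y]}" "antisym {(x, y). rel L Leq [x, y]}"
    using L unfolding countable_LO_def linear_order_on_def partial_order_on_def preorder_on_def by auto
  then show ?thesis using ab bc unfolding slt_def trans_def antisym_def by blast
qed

lemma slt_total: "a \<in> dom L \<Longrightarrow> b \<in> dom L \<Longrightarrow> a \<noteq> b \<Longrightarrow> slt L a b \<or> slt L b a"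
  using L unfolding countable_LO_def linear_order_on_def total_on_def slt_def by auto

lemma leq_iff: "a \<in> dom L \<Longrightarrow> b \<in> dom L \<Longrightarrow> rel L Leq [a, b] \<longleftrightarrow> a = b \<or> slt L a b"
  using L unfolding countable_LO_def linear_order_on_def partial_order_on_def preorder_on_def
    refl_on_def slt_def by auto

lemma sorted_unique:
  "sorted_wrt (slt L) xs \<Longrightarrow> sorted_wrt (slt L) ys \<Longrightarrow> set xs = set ys \<Longrightarrow> xs = ys"
proof (induction xs arbitrary: ys)
  case (Cons x xs)
  then obtain y ys' where ys: "ys = y # ys'" by (cases ys) auto
  have "x = y"
  proof (rule ccontr)
    assume "x \<noteq> y"
    then have "x \<in> set ys'" "y \<in> set xs" using Cons.prems(3) ys by auto
    then have "slt L y x" "slt L x y" using Cons.prems ys by auto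
    then show False using slt_trans slt_irrefl by blast
  qed
  moreover have "x \<notin> set xs" "y \<notin> set ys'" using Cons.prems ys slt_irrefl by auto
  ultimately show ?case using Cons ys by (metis insert_ident list.simps(15) sorted_wrt.simps(2))
qed simp

lemma sorted_exists: "finite A \<Longrightarrow> A \<subseteq> dom L \<Longrightarrow> \<exists>xs. sorted_wrt (slt L) xs \<and> set xs = A"
proof (induction rule: finite_induct)
  case (insert x A)
  then obtain xs where xs: "sorted_wrt (slt L) xs" "set xs = A" by auto
  let ?ys = "filter (\<lambda>z. slt L z x) xs @ x # filter (\<lambda>z. slt L x z) xs"
  have "slt L z x \<or> slt L x z" if "z \<in> A" for z
    using slt_total[of z x] insert.prems insert.hyps(2) that by auto
  then have "set ?ys = insert x A" using xs(2) by auto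
  moreover have "sorted_wrt (slt L) ?ys" using xs(1)
    by (auto simp: sorted_wrt_append sorted_wrt_filter intro: slt_trans)
  ultimately show ?case by blast
qed simp

end

section \<open>Iterated ultrafilter quantifiers\<close>

context ultra_model
begin

lemma U_conj: "U (\<lambda>x. P x \<and> Q x) \<longleftrightarrow> U P \<and> U Q"
  using U_conjI U_mono[of "\<lambda>x. P x \<and> Q x" P] U_mono[of "\<lambda>x. P x \<and> Q x" Q] by blast

lemma U_const [simp]: "U (\<lambda>x. b) \<longleftrightarrow> b"
proof -
  have "U (\<lambda>x. True)" by (rule U_mono[OF U_tail]) simp
  then show ?thesis using U_neg[of "\<lambda>x. True"] by (cases b) auto
qed

text \<open>The Fubini product of \<open>U\<close> along \<open>qs\<close>. The head is the
  outermost quantifier, so for an increasing list each generator is chosen after the smaller ones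
  and, by \<open>U_tail\<close>, above them.\<close>

primrec AE :: "nat list \<Rightarrow> ((nat \<Rightarrow> 'a) \<Rightarrow> bool) \<Rightarrow> (nat \<Rightarrow> 'a) \<Rightarrow> bool" where
  "AE [] P s \<longleftrightarrow> P s"
| "AE (q # qs) P s \<longleftrightarrow> U (\<lambda>x. AE qs P (s(q := x)))"

lemma AE_append: "AE (xs @ ys) P s \<longleftrightarrow> AE xs (AE ys P) s"
  by (induction xs arbitrary: s) auto

lemma AE_neg: "AE qs (\<lambda>s. \<not> P s) s \<longleftrightarrow> \<not> AE qs P s"
  by (induction qs arbitrary: s) (auto simp: U_neg)

lemma AE_conj: "AE qs (\<lambda>s. P s \<and> Q s) s \<longleftrightarrow> AE qs P s \<and> AE qs Q s"
  by (induction qs arbitrary: s) (auto simp: U_conj)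

lemma AE_mono: "AE qs P s \<Longrightarrow> (\<And>s. P s \<Longrightarrow> Q s) \<Longrightarrow> AE qs Q s"
proof (induction qs arbitrary: s)
  case (Cons q qs)
  have "U (\<lambda>x. AE qs P (s(q := x)))" using Cons.prems(1) by simp
  then have "U (\<lambda>x. AE qs Q (s(q := x)))" by (rule U_mono) (erule Cons.IH, erule Cons.prems(2))
  then show ?case by simp
qed simp

lemma AE_cong: "supp A P \<Longrightarrow> (\<And>q. q \<in> A \<Longrightarrow> q \<notin> set qs \<Longrightarrow> s q = s' q) \<Longrightarrow> AE qs P s = AE qs P s'"
proof (induction qs arbitrary: s s')
  case Nil
  then show ?case unfolding supp_def by (metis AE.simps(1) empty_iff list.set(1))
next
  case (Cons q qs)
  have "AE qs P (s(q := x)) = AE qs P (s'(q := x))" for x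
    by (rule Cons.IH[OF Cons.prems(1)]) (use Cons.prems(2) in auto)
  then show ?case by simp
qed

text \<open>A coordinate that \<open>P\<close> does not read contributes a constant predicate, on
  which \<open>U\<close> has no influence.\<close>

lemma AE_filter: "supp B P \<Longrightarrow> AE (filter (\<lambda>q. q \<in> B) qs) P s = AE qs P s"
proof (induction qs arbitrary: s)
  case (Cons q qs)
  show ?case
  proof (cases "q \<in> B")
    case False
    have "AE qs P (s(q := x)) = AE qs P s" for x
      by (rule AE_cong[OF Cons.prems]) (use False in auto)
    then show ?thesis using Cons False by simp
  qed (use Cons in simp)
qed simp

text \<open>A finitely additive 0-1 measure on the predicates of finite support, the limit of the
  Fubini products over finite suborders. The starting valuation is overwritten on the
  support.\<close>

definition W :: "(nat, lsym) struct \<Rightarrow> ((nat \<Rightarrow> 'a) \<Rightarrow> bool) \<Rightarrow> bool" where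
  "W L P \<longleftrightarrow> (\<exists>qs. sorted_wrt (slt L) qs \<and> set qs \<subseteq> dom L \<and> supp (set qs) P \<and> AE qs P (\<lambda>_. \<zero>))"

context
  fixes L :: "(nat, lsym) struct"
  assumes L: "L \<in> countable_LO"
begin

text \<open>Two increasing lists that support \<open>P\<close> arise from the increasing list of
  their union by deleting unread coordinates, so they give the same verdict.\<close>

lemma W_iff:
  assumes qs: "sorted_wrt (slt L) qs" "set qs \<subseteq> dom L" "supp (set qs) P"
  shows "W L P \<longleftrightarrow> AE qs P s"
proof -
  have *: "AE qs P t = AE qs' P t" if qs': "sorted_wrt (slt L) qs'" "set qs' \<subseteq> dom L" "supp (set qs') P" for qs' t
  proof -
    obtain zs where zs: "sorted_wrt (slt L) zs" "set zs = set qs \<union> set qs'"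
      using sorted_exists[OF L, of "set qs \<union> set qs'"] qs(2) qs'(2) by auto
    have "filter (\<lambda>q. q \<in> set qs) zs = qs"
      by (rule sorted_unique[OF L]) (use zs qs in \<open>auto simp: sorted_wrt_filter\<close>)
    moreover have "filter (\<lambda>q. q \<in> set qs') zs = qs'"
      by (rule sorted_unique[OF L]) (use zs qs' in \<open>auto simp: sorted_wrt_filter\<close>)
    ultimately show ?thesis using AE_filter[OF qs(3), of zs t] AE_filter[OF qs'(3), of zs t] by simp
  qed
  have "AE qs P s = AE qs P (\<lambda>_. \<zero>)" by (rule AE_cong[OF qs(3)]) simp
  then show ?thesis unfolding W_def using qs * by metis
qed

lemma common_support:
  assumes "fsup L P" "fsup L Q"
  obtains qs where "sorted_wrt (slt L) qs" "set qs \<subseteq> dom L" "supp (set qs) P" "supp (set qs) Q"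
proof -
  obtain A B where AB: "finite A" "A \<subseteq> dom L" "supp A P" "finite B" "B \<subseteq> dom L" "supp B Q"
    using assms unfolding fsup_def by blast
  then obtain qs where "sorted_wrt (slt L) qs" "set qs = A \<union> B"
    using sorted_exists[OF L, of "A \<union> B"] by auto
  then show ?thesis using that AB supp_mono[of _ P "A \<union> B"] supp_mono[of _ Q "A \<union> B"] by auto
qed

lemma W_neg: "fsup L P \<Longrightarrow> W L (\<lambda>s. \<not> P s) \<longleftrightarrow> \<not> W L P"
proof -
  assume P: "fsup L P"
  obtain qs where qs: "sorted_wrt (slt L) qs" "set qs \<subseteq> dom L" "supp (set qs) P"
    by (rule common_support[OF P P]) (rule that)
  moreover have "supp (set qs) (\<lambda>s. \<not> P s)" using qs(3) unfolding supp_def by metis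
  ultimately show ?thesis by (simp add: W_iff[where s="\<lambda>_. \<zero>" and qs=qs] AE_neg)
qed

lemma W_conj: "fsup L P \<Longrightarrow> fsup L Q \<Longrightarrow> W L (\<lambda>s. P s \<and> Q s) \<longleftrightarrow> W L P \<and> W L Q"
proof -
  assume PQ: "fsup L P" "fsup L Q"
  obtain qs where qs: "sorted_wrt (slt L) qs" "set qs \<subseteq> dom L" and P: "supp (set qs) P" and Q: "supp (set qs) Q"
    by (rule common_support[OF PQ]) (rule that)
  moreover have "supp (set qs) (\<lambda>s. P s \<and> Q s)" using P Q unfolding supp_def by metis
  ultimately show ?thesis using P Q by (simp add: W_iff[where s="\<lambda>_. \<zero>" and qs=qs] AE_conj)
qed

lemma W_mono: "W L P \<Longrightarrow> fsup L P \<Longrightarrow> fsup L Q \<Longrightarrow> (\<And>s. P s \<Longrightarrow> Q s) \<Longrightarrow> W L Q"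
proof -
  assume PQ: "fsup L P" "fsup L Q" and W: "W L P" and imp: "\<And>s. P s \<Longrightarrow> Q s"
  obtain qs where qs: "sorted_wrt (slt L) qs" "set qs \<subseteq> dom L" and P: "supp (set qs) P" and Q: "supp (set qs) Q"
    by (rule common_support[OF PQ]) (rule that)
  have "AE qs P (\<lambda>_. \<zero>)" using W W_iff[OF qs P] by blast
  then have "AE qs Q (\<lambda>_. \<zero>)" using imp by (rule AE_mono)
  then show ?thesis using W_iff[OF qs Q] by blast
qed

lemma W_const [simp]: "W L (\<lambda>s. b) \<longleftrightarrow> b"
  using W_iff[of "[]" "\<lambda>s. b"] by (simp add: supp_def)

lemma W_cong:
  assumes "W L B" "fsup L B" "fsup L P" "fsup L Q" "\<And>s. B s \<Longrightarrow> P s \<longleftrightarrow> Q s"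
  shows "W L P \<longleftrightarrow> W L Q"
proof -
  have "W L Q" if "W L P" "fsup L P" "fsup L Q" "\<And>s. B s \<Longrightarrow> P s \<Longrightarrow> Q s" for P Q
    by (rule W_mono[of "\<lambda>s. B s \<and> P s"]) (use assms(1,2) that in \<open>auto simp: W_conj intro: fsup_and\<close>)
  then show ?thesis using assms by metis
qed

lemma W_single: "q \<in> dom L \<Longrightarrow> W L (\<lambda>s. P (s q)) \<longleftrightarrow> U P"
  using W_iff[of "[q]" "\<lambda>s. P (s q)"] by (simp add: supp_def)

lemma W_pair: "q \<in> dom L \<Longrightarrow> q' \<in> dom L \<Longrightarrow> slt L q q' \<Longrightarrow> W L (\<lambda>s. P (s q) (s q')) \<longleftrightarrow> U (\<lambda>x. U (\<lambda>y. P x y))"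
  using W_iff[of "[q, q']" "\<lambda>s. P (s q) (s q')"] by (auto simp: supp_def slt_def)

section \<open>The ultrapower by definable functions, realized on the natural numbers\<close>

definition FX :: "((nat \<Rightarrow> 'a) \<Rightarrow> 'a) set" where "FX = {F. DT {} F \<and> fsup L F}"

definition FR :: "(((nat \<Rightarrow> 'a) \<Rightarrow> 'a) \<times> ((nat \<Rightarrow> 'a) \<Rightarrow> 'a)) set" where
  "FR = {(F, H). F \<in> FX \<and> H \<in> FX \<and> W L (\<lambda>s. F s = H s)}"

text \<open>The elements of the order are natural numbers and serve directly as variable indices:
  the generator at \<open>q\<close> is the projection to \<open>q\<close>.\<close>

lemma FX_var: "q \<in> dom L \<Longrightarrow> (\<lambda>s. s q) \<in> FX"
  unfolding FX_def fsup_def supp_def by (auto intro!: DT_var exI[of _ "{q}"])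

lemma FX_num: "(\<lambda>s. num n) \<in> FX"
  unfolding FX_def by (simp add: DT_num fsup_const)

lemma fsup_FX: "F \<in> FX \<Longrightarrow> fsup L F" by (simp add: FX_def)

lemma countable_FX: "countable FX"
proof -
  define c where "c F = (SOME p. \<forall>\<rho>. \<rho> 0 = F (\<lambda>i. \<rho> (Suc i)) \<longleftrightarrow> esat M \<rho> p)" for F :: "(nat \<Rightarrow> 'a) \<Rightarrow> 'a"
  have c: "\<rho> 0 = F (\<lambda>i. \<rho> (Suc i)) \<longleftrightarrow> esat M \<rho> (c F)" if "DT {} F" for F \<rho>
    using someI_ex[of "\<lambda>p. \<forall>\<rho>. \<rho> 0 = F (\<lambda>i. \<rho> (Suc i)) \<longleftrightarrow> esat M \<rho> p"] that
    unfolding defn_def D_iff_esat c_def[symmetric] by blast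
  have "inj_on c FX"
  proof (rule inj_onI)
    fix F H assume "F \<in> FX" "H \<in> FX" "c F = c H"
    then have "\<rho> 0 = F (\<lambda>i. \<rho> (Suc i)) \<longleftrightarrow> \<rho> 0 = H (\<lambda>i. \<rho> (Suc i))" for \<rho> using c unfolding FX_def by auto
    from this[of "case_nat (F _) _"] show "F = H" by auto
  qed
  then show ?thesis using countableI' by blast
qed

lemma equiv_FR: "equiv FX FR"
proof (rule equivI)
  show "FR \<subseteq> FX \<times> FX" unfolding FR_def by blast
  show "refl_on FX FR" unfolding refl_on_def FR_def by auto
  show "sym FR" unfolding sym_def FR_def by (auto simp: eq_commute)
  show "trans FR"
  proof (rule transI)
    fix F G H assume "(F, G) \<in> FR" "(G, H) \<in> FR"
    then have *: "F \<in> FX" "G \<in> FX" "H \<in> FX" "W L (\<lambda>s. F s = G s)" "W L (\<lambda>s. G s = H s)"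
      by (auto simp: FR_def)
    have "W L (\<lambda>s. F s = H s) \<longleftrightarrow> W L (\<lambda>s. G s = H s)"
      by (rule W_cong[OF *(4)]) (use * in \<open>auto intro!: fsup_eq fsup_FX\<close>)
    then show "(F, H) \<in> FR" using * by (simp add: FR_def)
  qed
qed

definition cls :: "((nat \<Rightarrow> 'a) \<Rightarrow> 'a) \<Rightarrow> nat" where
  "cls F = to_nat_on (FX // FR) (FR `` {F})"

lemma cls_eq: "F \<in> FX \<Longrightarrow> H \<in> FX \<Longrightarrow> cls F = cls H \<longleftrightarrow> W L (\<lambda>s. F s = H s)"
proof -
  assume FH: "F \<in> FX" "H \<in> FX"
  have "countable (FX // FR)" unfolding quotient_def using countable_FX by auto
  then have "cls F = cls H \<longleftrightarrow> FR `` {F} = FR `` {H}"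
    unfolding cls_def using FH by (intro to_nat_on_inj) (auto intro: quotientI)
  also have "\<dots> \<longleftrightarrow> (F, H) \<in> FR" using eq_equiv_class_iff[OF equiv_FR FH] .
  finally show ?thesis using FH by (simp add: FR_def)
qed

text \<open>The numerals stay distinct, so the quotient is infinite and \<open>to_nat_on\<close> is
  a bijection. Hence the new model has all of \<open>nat\<close> as its domain, the form that
  \<open>arith_full\<close> requires.\<close>

lemma cls_surj: "cls ` FX = UNIV"
proof -
  have "countable (FX // FR)" unfolding quotient_def using countable_FX by auto
  moreover have "infinite (FX // FR)"
  proof
    assume "finite (FX // FR)"
    moreover have "inj (\<lambda>n. FR `` {\<lambda>s. num n})"
    proof (rule injI)
      fix m n assume "FR `` {\<lambda>s. num m} = FR `` {\<lambda>s. num n}"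
      then have "((\<lambda>s. num m), (\<lambda>s. num n)) \<in> FR"
        using eq_equiv_class_iff[OF equiv_FR FX_num FX_num] by blast
      then show "m = n" by (simp add: FR_def)
    qed
    moreover have "range (\<lambda>n. FR `` {\<lambda>s. num n}) \<subseteq> FX // FR" using FX_num by (auto intro: quotientI)
    ultimately show False using finite_subset finite_imageD by blast
  qed
  ultimately have "to_nat_on (FX // FR) ` (FX // FR) = UNIV"
    using to_nat_on_infinite by (auto simp: bij_betw_def)
  moreover have "FX // FR = (\<lambda>F. FR `` {F}) ` FX" unfolding quotient_def by auto
  ultimately show ?thesis unfolding cls_def by (simp add: image_image)
qed

definition rep :: "nat \<Rightarrow> (nat \<Rightarrow> 'a) \<Rightarrow> 'a" where "rep = inv_into FX cls"

lemma rep_FX: "rep n \<in> FX"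
  unfolding rep_def using inv_into_into[of n cls FX] cls_surj by auto

lemma cls_rep: "cls (rep n) = n"
  unfolding rep_def using f_inv_into_f[of n cls FX] cls_surj by auto

lemma rep_cls: "F \<in> FX \<Longrightarrow> W L (\<lambda>s. rep (cls F) s = F s)"
  using cls_eq[OF rep_FX] cls_rep by blast

definition NL :: "nat arith" where
  "NL = \<lparr>adom = UNIV, azero = cls (\<lambda>s. \<zero>), aone = cls (\<lambda>s. \<one>),
     aplus = (\<lambda>m n. cls (\<lambda>s. rep m s \<oplus> rep n s)), atimes = (\<lambda>m n. cls (\<lambda>s. rep m s \<otimes> rep n s)),
     ale = (\<lambda>m n. W L (\<lambda>s. rep m s \<preceq> rep n s))\<rparr>"

lemma FX_comp2:
  assumes "F \<in> FX" "H \<in> FX" "DT {} (\<lambda>s. f (F s) (H s))"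
  shows "(\<lambda>s. f (F s) (H s)) \<in> FX"
  using assms fsup_comp2[where f=f] unfolding FX_def by blast

lemma W_rep: "F \<in> FX \<Longrightarrow> H \<in> FX \<Longrightarrow> W L (\<lambda>s. rep (cls F) s = F s \<and> rep (cls H) s = H s)"
  by (subst W_conj) (auto intro!: fsup_eq fsup_FX rep_FX rep_cls)

lemma W_rep2:
  assumes "F \<in> FX" "H \<in> FX"
  shows "W L (\<lambda>s. P (rep (cls F) s) (rep (cls H) s)) \<longleftrightarrow> W L (\<lambda>s. P (F s) (H s))"
proof (rule W_cong[of "\<lambda>s. rep (cls F) s = F s \<and> rep (cls H) s = H s"])
  show "W L (\<lambda>s. rep (cls F) s = F s \<and> rep (cls H) s = H s)" by (rule W_rep[OF assms])
  show "fsup L (\<lambda>s. rep (cls F) s = F s \<and> rep (cls H) s = H s)"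
    by (intro fsup_and fsup_eq fsup_FX rep_FX assms)
  show "fsup L (\<lambda>s. P (rep (cls F) s) (rep (cls H) s))"
    by (rule fsup_comp2[where f=P]) (intro fsup_FX rep_FX)+
  show "fsup L (\<lambda>s. P (F s) (H s))"
    by (rule fsup_comp2[where f=P]) (intro fsup_FX assms)+
qed simp

lemma NL_plus:
  assumes "F \<in> FX" "H \<in> FX"
  shows "aplus NL (cls F) (cls H) = cls (\<lambda>s. F s \<oplus> H s)" "(\<lambda>s. F s \<oplus> H s) \<in> FX"
proof -
  have FX: "(\<lambda>s. F s \<oplus> H s) \<in> FX" if "F \<in> FX" "H \<in> FX" for F H
    by (rule FX_comp2[OF that]) (use that in \<open>auto simp: FX_def intro!: DT_plus\<close>)
  have "W L (\<lambda>s. rep (cls F) s \<oplus> rep (cls H) s = F s \<oplus> H s)"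
  proof (rule W_mono[of "\<lambda>s. rep (cls F) s = F s \<and> rep (cls H) s = H s"])
    show "W L (\<lambda>s. rep (cls F) s = F s \<and> rep (cls H) s = H s)" by (rule W_rep[OF assms])
  qed (simp_all add: fsup_and fsup_eq fsup_FX rep_FX FX assms)
  then show "aplus NL (cls F) (cls H) = cls (\<lambda>s. F s \<oplus> H s)"
    unfolding NL_def using FX assms rep_FX by (simp add: cls_eq)
  show "(\<lambda>s. F s \<oplus> H s) \<in> FX" using FX assms by blast
qed

lemma NL_times:
  assumes "F \<in> FX" "H \<in> FX"
  shows "atimes NL (cls F) (cls H) = cls (\<lambda>s. F s \<otimes> H s)" "(\<lambda>s. F s \<otimes> H s) \<in> FX"
proof -
  have FX: "(\<lambda>s. F s \<otimes> H s) \<in> FX" if "F \<in> FX" "H \<in> FX" for F H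
    by (rule FX_comp2[OF that]) (use that in \<open>auto simp: FX_def intro!: DT_times\<close>)
  have "W L (\<lambda>s. rep (cls F) s \<otimes> rep (cls H) s = F s \<otimes> H s)"
  proof (rule W_mono[of "\<lambda>s. rep (cls F) s = F s \<and> rep (cls H) s = H s"])
    show "W L (\<lambda>s. rep (cls F) s = F s \<and> rep (cls H) s = H s)" by (rule W_rep[OF assms])
  qed (simp_all add: fsup_and fsup_eq fsup_FX rep_FX FX assms)
  then show "atimes NL (cls F) (cls H) = cls (\<lambda>s. F s \<otimes> H s)"
    unfolding NL_def using FX assms rep_FX by (simp add: cls_eq)
  show "(\<lambda>s. F s \<otimes> H s) \<in> FX" using FX assms by blast
qed

lemma NL_le: "F \<in> FX \<Longrightarrow> H \<in> FX \<Longrightarrow> ale NL (cls F) (cls H) \<longleftrightarrow> W L (\<lambda>s. F s \<preceq> H s)"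
  unfolding NL_def using W_rep2[of F H "(\<preceq>)"] by simp

lemma tval_NL:
  assumes "\<And>i. Fs i \<in> FX"
  shows "tval NL (\<lambda>i. cls (Fs i)) t = cls (\<lambda>s. tval M (\<lambda>i. Fs i s) t)" "(\<lambda>s. tval M (\<lambda>i. Fs i s) t) \<in> FX"
proof (induction t)
  case Zero
  { case 1 show ?case by (simp add: NL_def) next case 2 show ?case by (simp add: FX_def DT_zero fsup_const) }
next
  case One
  { case 1 show ?case by (simp add: NL_def) next case 2 show ?case by (simp add: FX_def DT_one fsup_const) }
qed (use assms NL_plus NL_times in simp_all)

lemma fsup_esat:
  assumes "\<And>i. Fs i \<in> FX"
  shows "fsup L (\<lambda>s. esat M (\<lambda>i. Fs i s) p)"
proof -
  obtain n where n: "afm_in n p" using afm_in_ex by blast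
  show ?thesis
  proof (rule fsup_fin[of L Fs n])
    show "fsup L (Fs i)" for i by (rule fsup_FX[OF assms])
    show "esat M (\<lambda>i. Fs i s) p = esat M (\<lambda>i. Fs i s') p" if "\<And>i. i < n \<Longrightarrow> Fs i s = Fs i s'" for s s'
      by (rule esat_cong[OF n]) (rule that)
  qed
qed

theorem Los:
  assumes "\<And>i. Fs i \<in> FX"
  shows "esat NL (\<lambda>i. cls (Fs i)) p \<longleftrightarrow> W L (\<lambda>s. esat M (\<lambda>i. Fs i s) p)"
  using assms
proof (induction p arbitrary: Fs)
  case (AEq s t)
  then show ?case by (simp add: tval_NL cls_eq)
next
  case (ALe s t)
  then show ?case by (simp add: tval_NL NL_le)
next
  case (ANeg p)
  then show ?case by (simp add: W_neg fsup_esat)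
next
  case (AAnd p q)
  then show ?case by (simp add: W_conj fsup_esat)
next
  case (AEx p)
  have cn: "case_nat F Fs i \<in> FX" if "F \<in> FX" for F i using that AEx.prems by (cases i) auto
  have ev: "(\<lambda>i. case_nat F Fs i s) = case_nat (F s) (\<lambda>i. Fs i s)" for F s
    by (rule ext) (simp split: nat.split)
  have kv: "(\<lambda>i. cls (case_nat F Fs i)) = case_nat (cls F) (\<lambda>i. cls (Fs i))" for F
    by (rule ext) (simp split: nat.split)
  have "esat NL (\<lambda>i. cls (Fs i)) (AEx p) \<longleftrightarrow> (\<exists>m\<in>cls ` FX. esat NL (case_nat m (\<lambda>i. cls (Fs i))) p)"
    by (simp add: cls_surj) (simp add: NL_def)
  also have "\<dots> \<longleftrightarrow> (\<exists>F\<in>FX. esat NL (\<lambda>i. cls (case_nat F Fs i)) p)" by (simp add: kv)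
  also have "\<dots> \<longleftrightarrow> (\<exists>F\<in>FX. W L (\<lambda>s. esat M (case_nat (F s) (\<lambda>i. Fs i s)) p))"
    using AEx.IH[of "case_nat _ Fs"] cn by (simp add: ev)
  also have "\<dots> \<longleftrightarrow> W L (\<lambda>s. esat M (\<lambda>i. Fs i s) (AEx p))"
  proof
    assume "\<exists>F\<in>FX. W L (\<lambda>s. esat M (case_nat (F s) (\<lambda>i. Fs i s)) p)"
    then obtain F where F: "F \<in> FX" "W L (\<lambda>s. esat M (case_nat (F s) (\<lambda>i. Fs i s)) p)" by blast
    show "W L (\<lambda>s. esat M (\<lambda>i. Fs i s) (AEx p))"
    proof (rule W_mono[OF F(2)])
      show "fsup L (\<lambda>s. esat M (case_nat (F s) (\<lambda>i. Fs i s)) p)"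
        using fsup_esat[of "case_nat F Fs" p] cn[OF F(1)] by (simp add: ev)
      show "fsup L (\<lambda>s. esat M (\<lambda>i. Fs i s) (AEx p))" by (rule fsup_esat) (rule AEx.prems)
    qed auto
  next
    assume W: "W L (\<lambda>s. esat M (\<lambda>i. Fs i s) (AEx p))"
    \<comment> \<open>The least witness, taken pointwise in \<open>s\<close>, is again a
      parameter-free definable function, and its support is finite since the formula reads only
      finitely many of the \<open>Fs\<close>.\<close>
    define F where "F s = mu (\<lambda>x. esat M (case_nat x (\<lambda>i. Fs i s)) p)" for s
    have "D {} (\<lambda>\<rho>. esat M (\<lambda>i. (case_nat (\<lambda>\<rho>. \<rho> 0) (\<lambda>i \<rho>. Fs i (\<lambda>i. \<rho> (Suc i))) i) \<rho>) p)"
      by (rule D_esat_comp) (use AEx.prems in \<open>auto simp: FX_def intro!: DT_var DT_shift split: nat.split\<close>)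
    moreover have "(\<lambda>i. (case_nat (\<lambda>\<rho>. \<rho> 0) (\<lambda>i \<rho>. Fs i (\<lambda>i. \<rho> (Suc i))) i) \<rho>) =
        case_nat (\<rho> 0) (\<lambda>i. Fs i (\<lambda>i. \<rho> (Suc i)))" for \<rho>
      by (rule ext) (simp split: nat.split)
    ultimately have "DT {} F" unfolding F_def by (intro DT_mu) simp
    moreover have "fsup L F"
    proof -
      obtain n where n: "afm_in n (AEx p)" using afm_in_ex by blast
      have "F s = F s'" if eq: "\<And>i. i < n \<Longrightarrow> Fs i s = Fs i s'" for s s'
      proof -
        have "esat M (case_nat x (\<lambda>i. Fs i s)) p = esat M (case_nat x (\<lambda>i. Fs i s')) p" for x
          by (rule esat_cong[of "Suc n"]) (use n eq in \<open>auto split: nat.split\<close>)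
        then show ?thesis unfolding F_def by simp
      qed
      then show ?thesis using fsup_fin[of L Fs n F] AEx.prems fsup_FX by blast
    qed
    ultimately have F: "F \<in> FX" by (simp add: FX_def)
    have "W L (\<lambda>s. esat M (case_nat (F s) (\<lambda>i. Fs i s)) p)"
    proof (rule W_mono[OF W])
      show "fsup L (\<lambda>s. esat M (case_nat (F s) (\<lambda>i. Fs i s)) p)"
        using fsup_esat[of "case_nat F Fs" p] cn[OF F(1)] by (simp add: ev)
      show "fsup L (\<lambda>s. esat M (\<lambda>i. Fs i s) (AEx p))" by (rule fsup_esat) (rule AEx.prems)
      fix s assume "esat M (\<lambda>i. Fs i s) (AEx p)"
      then obtain x where x: "esat M (case_nat x (\<lambda>i. Fs i s)) p" by auto
      have "D UNIV (\<lambda>\<rho>. esat M (case_nat (\<rho> 0) (\<lambda>i. Fs i s)) p)"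
        using D_fix[of "{}" "\<lambda>\<rho>. esat M \<rho> p" "\<lambda>i. Fs i s"] D_esat by blast
      then show "esat M (case_nat (F s) (\<lambda>i. Fs i s)) p" unfolding F_def
        using mu_least(1)[of "\<lambda>x. esat M (case_nat x (\<lambda>i. Fs i s)) p"] x by blast
    qed
    then show "\<exists>F\<in>FX. W L (\<lambda>s. esat M (case_nat (F s) (\<lambda>i. Fs i s)) p)" using F by blast
  qed
  finally show ?case .
qed

lemma asat_NL:
  assumes "Fs \<in> lists FX" "afm_in (length Fs) p"
  shows "asat NL (map cls Fs) p \<longleftrightarrow> W L (\<lambda>s. asat M (map (\<lambda>F. F s) Fs) p)"
proof -
  let ?G = "\<lambda>i. if i < length Fs then Fs ! i else (\<lambda>s. num 0)"
  have "?G i \<in> FX" for i using assms(1) FX_num[of 0] by (auto simp: in_lists_conv_set)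
  then have "esat NL (\<lambda>i. cls (?G i)) p \<longleftrightarrow> W L (\<lambda>s. esat M (\<lambda>i. ?G i s) p)" by (rule Los)
  moreover have "asat NL (map cls Fs) p \<longleftrightarrow> esat NL (\<lambda>i. cls (?G i)) p"
    unfolding asat_esat by (rule esat_cong[OF assms(2)]) simp
  moreover have "asat M (map (\<lambda>F. F s) Fs) p \<longleftrightarrow> esat M (\<lambda>i. ?G i s) p" for s
    unfolding asat_esat by (rule esat_cong[OF assms(2)]) simp
  ultimately show ?thesis by simp
qed

lemma asat_NL_sentence: "afm_in 0 p \<Longrightarrow> asat NL [] p \<longleftrightarrow> asat M [] p"
  using asat_NL[of "[]" p] by simp

lemma adom_NL [simp]: "adom NL = UNIV" by (simp add: NL_def)

text \<open>Induction on the support, removing the largest generator \<open>q\<close>. If almost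
  everywhere \<open>F\<close> is eventually constant in \<open>q\<close>, it agrees with a function
  \<open>H\<close> of the smaller generators, which has the same type. Otherwise the thin set
  \<open>Y\<close> decides: it belongs to the type, so the value of \<open>F\<close> lies in
  \<open>Y\<close> and must be the value at \<open>q\<close>.\<close>

lemma generator_unique:
  assumes "sorted_wrt (slt L) qs" "set qs \<subseteq> dom L" "DT {} F" "supp (set qs) F"
    and "\<And>Y. D {} (\<lambda>\<rho>. Y (\<rho> 0)) \<Longrightarrow> U Y \<Longrightarrow> W L (\<lambda>s. Y (F s))"
  shows "\<exists>q\<in>set qs. W L (\<lambda>s. F s = s q)"
  using assms
proof (induction qs arbitrary: F rule: rev_induct)
  case Nil
  \<comment> \<open>A constant \<open>F\<close> has a definable value, and being different from it
    is a \<open>U\<close>-large property, which would then hold of \<open>F\<close> itself. Writing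
    the value as \<open>F (\<lambda>_. x)\<close> keeps the definition of \<open>Y\<close> free of
    parameters.\<close>
  define Y where "Y x \<longleftrightarrow> x \<noteq> F (\<lambda>_. x)" for x
  have const: "F s = F s'" for s s' using Nil(4) by (simp add: supp_def)
  have Yc: "Y x \<longleftrightarrow> x \<noteq> F (\<lambda>_. \<zero>)" for x
    unfolding Y_def using const[of "\<lambda>_. x" "\<lambda>_. \<zero>"] by simp
  have "DT {} (\<lambda>\<rho>. F (\<lambda>i. \<rho> 0))" by (rule DT_comp[OF Nil(3)]) (rule DT_var)
  then have "D {} (\<lambda>\<rho>. Y (\<rho> 0))" unfolding Y_def by (intro D_neg D_eq DT_var)
  moreover have "U Y" by (rule U_mono[OF U_tail[of "F (\<lambda>_. \<zero>)"]]) (auto simp: Yc lt_def)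
  ultimately have "W L (\<lambda>s. Y (F s))" by (rule Nil(5))
  moreover have "Y (F s) = False" for s using const[of s "\<lambda>_. \<zero>"] by (simp add: Yc)
  ultimately show ?case by simp
next
  case (snoc q qs)
  have qs: "sorted_wrt (slt L) qs" "set qs \<subseteq> dom L" using snoc.prems by (auto simp: sorted_wrt_append)
  have q: "q \<notin> set qs" using snoc.prems(1) by (auto simp: sorted_wrt_append slt_def)
  have W: "W L P \<longleftrightarrow> AE qs (\<lambda>s. U (\<lambda>x. P (s(q := x)))) (\<lambda>_. \<zero>)" if "supp (set (qs @ [q])) P" for P
    using W_iff[OF snoc.prems(1,2) that, of "\<lambda>_. \<zero>"] unfolding AE_append by (simp add: AE.simps[abs_def])
  have suppP: "supp (set (qs @ [q])) (\<lambda>s. P (F s))" for P :: "'a \<Rightarrow> bool" using snoc.prems(4) unfolding supp_def by metis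
  obtain Y where Y: "D {} (\<lambda>\<rho>. Y (\<rho> 0))" "U Y" and YF:
    "\<And>s. (\<exists>c. ev Y (\<lambda>x. F (s(q := x)) = c)) \<or> ev Y (\<lambda>x. Y (F (s(q := x))) \<longrightarrow> F (s(q := x)) = x)"
    using U_thin[OF snoc.prems(3), of q] unfolding thins_def by blast
  have U_ev: "U P" if "ev Y P" for P
  proof -
    obtain a where a: "\<forall>x. a \<prec> x \<longrightarrow> Y x \<longrightarrow> P x" using \<open>ev Y P\<close> unfolding ev_def by blast
    show ?thesis by (rule U_mono[OF U_conjI[OF U_tail[of a] Y(2)]]) (use a in blast)
  qed
  define C where "C s \<longleftrightarrow> (\<exists>c. ev Y (\<lambda>x. F (s(q := x)) = c))" for s
  have F_upd: "F (s(q := x)) = F (s'(q := x))" if "\<forall>q\<in>set qs. s q = s' q" for s s' x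
    using snoc.prems(4) that unfolding supp_def by simp
  have "supp (set qs) C" unfolding supp_def
  proof (intro allI impI)
    fix s s' :: "nat \<Rightarrow> 'a" assume "\<forall>q\<in>set qs. s q = s' q"
    then have "F (s(q := x)) = F (s'(q := x))" for x by (rule F_upd)
    then show "C s = C s'" by (simp only: C_def)
  qed
  then have WC: "W L C \<longleftrightarrow> AE qs C (\<lambda>_. \<zero>)" by (rule W_iff[OF qs])
  show ?case
  proof (cases "W L C")
    case True
    \<comment> \<open>The eventual value does not mention \<open>q\<close>, so \<open>H\<close> is
      supported by \<open>qs\<close>. The default of \<open>mu\<close> matters only outside
      \<open>C\<close>, which has measure one here.\<close>
    define H where "H s = mu (\<lambda>c. ev Y (\<lambda>x. F (s(q := x)) = c))" for s
    have H: "ev Y (\<lambda>x. F (s(q := x)) = H s)" if "C s" for s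
    proof -
      have "DT UNIV (\<lambda>\<rho>. if i = q then \<rho> 0 else s i)" for i
        by (cases "i = q") (auto intro: DT_var DT_const)
      then have "DT UNIV (\<lambda>\<rho>. F (\<lambda>i. if i = q then \<rho> 0 else s i))"
        by (rule DT_comp[OF DT_mono[OF snoc.prems(3) empty_subsetI]])
      then have F: "DT UNIV (\<lambda>\<rho>. F (s(q := \<rho> i)))" for i
        using DT_fun1[of UNIV "\<lambda>x. F (s(q := x))" "\<lambda>\<rho>. \<rho> i"] DT_var[of UNIV i] by (simp add: fun_upd_def)
      have "D UNIV (\<lambda>\<rho>. ev Y (\<lambda>x. F (s(q := x)) = \<rho> 0))" unfolding ev_def
        by (intro D_rules F D_rel1[OF D_mono[OF Y(1)]]) simp
      then show ?thesis unfolding H_def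
        using mu_least(1)[of "\<lambda>c. ev Y (\<lambda>x. F (s(q := x)) = c)"] \<open>C s\<close> unfolding C_def by blast
    qed
    have "DT {} H"
    proof -
      have "DT {} (\<lambda>\<rho>. if i = q then \<rho> 0 else \<rho> (Suc (Suc (Suc i))))" for i
        by (cases "i = q") (auto intro: DT_var)
      then have "DT {} (\<lambda>\<rho>. F (\<lambda>i. if i = q then \<rho> 0 else \<rho> (Suc (Suc (Suc i)))))"
        by (rule DT_comp[OF snoc.prems(3)])
      then have F: "DT {} (\<lambda>\<rho>. F ((\<lambda>i. \<rho> (Suc (Suc (Suc i))))(q := \<rho> 0)))" by (simp add: fun_upd_def)
      show ?thesis unfolding H_def ev_def
        by (intro DT_mu D_rules F D_rel1[OF Y(1)])
    qed
    moreover have suppH: "supp (set qs) H" unfolding supp_def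
    proof (intro allI impI)
      fix s s' :: "nat \<Rightarrow> 'a" assume "\<forall>q\<in>set qs. s q = s' q"
      then have "F (s(q := x)) = F (s'(q := x))" for x by (rule F_upd)
      then show "H s = H s'" by (simp only: H_def)
    qed
    moreover have WFH: "W L (\<lambda>s. F s = H s)"
    proof -
      have "H (s(q := x)) = H s" for s x using suppH q unfolding supp_def by (metis fun_upd_other)
      then have *: "U (\<lambda>x. F (s(q := x)) = H (s(q := x)))" if "C s" for s using U_ev[OF H[OF that]] by simp
      have "supp (set (qs @ [q])) H" using suppH by (rule supp_mono) auto
      then have suppFH: "supp (set (qs @ [q])) (\<lambda>s. F s = H s)"
        using snoc.prems(4) unfolding supp_def by metis
      have "AE qs (\<lambda>s. U (\<lambda>x. F (s(q := x)) = H (s(q := x)))) (\<lambda>_. \<zero>)"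
        by (rule AE_mono[OF iffD1[OF WC True] *])
      then show ?thesis by (rule iffD2[OF W[OF suppFH]])
    qed
    moreover have FX: "F \<in> FX" "H \<in> FX"
    proof -
      have "fsup L F" unfolding fsup_def
        by (intro exI[of _ "set (qs @ [q])"] conjI snoc.prems finite_set)
      then show "F \<in> FX" using snoc.prems(3) by (simp add: FX_def)
      have "fsup L H" unfolding fsup_def by (intro exI[of _ "set qs"] conjI suppH qs finite_set)
      then show "H \<in> FX" using \<open>DT {} H\<close> by (simp add: FX_def)
    qed
    moreover have "W L (\<lambda>s. Y' (H s))" if "D {} (\<lambda>\<rho>. Y' (\<rho> 0))" "U Y'" for Y'
    proof -
      have "W L (\<lambda>s. Y' (F s)) \<longleftrightarrow> W L (\<lambda>s. Y' (H s))"
        by (rule W_cong[OF WFH]) (simp_all add: fsup_comp[where f=Y'] fsup_eq fsup_FX FX)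
      then show ?thesis using snoc.prems(5)[OF that] by simp
    qed
    ultimately obtain q' where q': "q' \<in> set qs" "W L (\<lambda>s. H s = s q')"
      using snoc.IH[OF qs, of H] by blast
    have "W L (\<lambda>s. F s = s q') \<longleftrightarrow> W L (\<lambda>s. H s = s q')"
      by (rule W_cong[OF WFH])
        (use q'(1) qs(2) in \<open>auto simp: fsup_eq fsup_FX FX FX_var\<close>)
    then show ?thesis using q' by auto
  next
    case False
    then have 1: "AE qs (\<lambda>s. \<not> C s) (\<lambda>_. \<zero>)" unfolding WC AE_neg .
    have 2: "AE qs (\<lambda>s. U (\<lambda>x. Y (F (s(q := x))))) (\<lambda>_. \<zero>)"
      using snoc.prems(5)[OF Y] W[OF suppP] by blast
    have *: "U (\<lambda>x. F (s(q := x)) = (s(q := x)) q)" if "\<not> C s \<and> U (\<lambda>x. Y (F (s(q := x))))" for s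
    proof -
      have "U (\<lambda>x. Y (F (s(q := x))) \<longrightarrow> F (s(q := x)) = x)"
        using that YF[of s] unfolding C_def by (intro U_ev) blast
      from U_conjI[OF this conjunct2[OF that]] show ?thesis by (rule U_mono) simp
    qed
    have "AE qs (\<lambda>s. U (\<lambda>x. F (s(q := x)) = (s(q := x)) q)) (\<lambda>_. \<zero>)"
      by (rule AE_mono[OF iffD2[OF AE_conj conjI[OF 1 2]] *])
    moreover have "supp (set (qs @ [q])) (\<lambda>s. F s = s q)" unfolding supp_def
    proof (intro allI impI)
      fix s s' :: "nat \<Rightarrow> 'a" assume eq: "\<forall>r\<in>set (qs @ [q]). s r = s' r"
      then have "F s = F s'" using snoc.prems(4) unfolding supp_def by blast
      then show "(F s = s q) = (F s' = s' q)" using eq by simp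
    qed
    ultimately have "W L (\<lambda>s. F s = s q)" using iffD2[OF W] by blast
    then show ?thesis by (intro bexI[of _ q]) simp_all
  qed
qed

end

end

section \<open>Types realized in the models\<close>

lemma suppD: "supp A P \<Longrightarrow> (\<And>q. q \<in> A \<Longrightarrow> s q = s' q) \<Longrightarrow> P s = P s'"
  unfolding supp_def by blast

section \<open>Finite order embeddings, complete types and indiscernibility\<close>

definition emb :: "(nat, lsym) struct \<Rightarrow> (nat, lsym) struct \<Rightarrow> nat set \<Rightarrow> (nat \<Rightarrow> nat) \<Rightarrow> bool" where
  "emb L L' A \<pi> \<longleftrightarrow> finite A \<and> A \<subseteq> dom L \<and> \<pi> ` A \<subseteq> dom L' \<and> (\<forall>a\<in>A. \<forall>b\<in>A. slt L a b \<longrightarrow> slt L' (\<pi> a) (\<pi> b))"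

lemma emb_inj:
  assumes "L \<in> countable_LO" "emb L L' A \<pi>"
  shows "inj_on \<pi> A"
proof (rule inj_onI, rule ccontr)
  fix a b assume ab: "a \<in> A" "b \<in> A" "\<pi> a = \<pi> b" "a \<noteq> b"
  have dom: "a \<in> dom L" "b \<in> dom L" and mono: "\<And>x y. x \<in> A \<Longrightarrow> y \<in> A \<Longrightarrow> slt L x y \<Longrightarrow> slt L' (\<pi> x) (\<pi> y)"
    using assms(2) ab(1,2) unfolding emb_def by auto
  have "slt L' (\<pi> a) (\<pi> b) \<or> slt L' (\<pi> b) (\<pi> a)"
    using slt_total[OF assms(1) dom ab(4)] mono ab(1,2) by blast
  then show False using ab(3) by (simp add: slt_def)
qed

text \<open>The length is part of the type, so that a type determines the arity of the relation
  symbol that will name it.\<close>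

definition eqtp :: "nat arith \<Rightarrow> nat list \<Rightarrow> nat \<times> afm set" where
  "eqtp N xs = (length xs, {p. afm_in (length xs) p \<and> asat N xs p})"

lemma eqt_iff: "eqt N a b \<longleftrightarrow> eqtp N a = eqtp N b"
proof (cases "length a = length b")
  case True
  have "(\<forall>p. afm_in (length b) p \<longrightarrow> (asat N a p \<longleftrightarrow> asat N b p)) \<longleftrightarrow>
      {p. afm_in (length b) p \<and> asat N a p} = {p. afm_in (length b) p \<and> asat N b p}" by blast
  then show ?thesis by (simp add: eqt_def eqtp_def True)
qed (simp add: eqt_def eqtp_def)

lemma eqtp_map_nth:
  assumes "eqtp N xs = eqtp N' xs'" "\<And>i. i \<in> set is \<Longrightarrow> i < length xs"
  shows "eqtp N (map ((!) xs) is) = eqtp N' (map ((!) xs') is)"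
proof -
  have len: "length xs = length xs'" using assms(1) by (simp add: eqtp_def)
  have "asat N (map ((!) xs) is) p \<longleftrightarrow> asat N' (map ((!) xs') is) p" if p: "afm_in (length is) p" for p
  proof -
    let ?\<sigma> = "\<lambda>i. if i < length is then V (is ! i) else Zero"
    have "asat N (map ((!) xs) is) p \<longleftrightarrow> asat N xs (asubst ?\<sigma> p)" for N :: "nat arith" and xs
      unfolding asat_esat esat_asubst by (rule esat_cong[OF p]) simp
    moreover have "afm_in (length xs) (asubst ?\<sigma> p)" by (rule afm_in_asubst) (use assms(2) in auto)
    ultimately show ?thesis using assms(1) len unfolding eqtp_def by auto
  qed
  then show ?thesis unfolding eqtp_def by auto
qed

text \<open>
  Every definable function has arbitrarily large indices, so that a tuple of arguments can be padded
  until its length is an index.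
\<close>

locale ultra_enum = ultra_model M U for M :: "'a arith" and U +
  fixes fm :: "nat \<Rightarrow> (nat \<Rightarrow> 'a) \<Rightarrow> 'a"
  assumes DT_fm: "DT {} (fm m)" and supp_fm: "supp {..<m} (fm m)"
    and fm_surj: "DT {} F \<Longrightarrow> supp {..<n} F \<Longrightarrow> \<exists>m\<ge>n. fm m = F"

lemma (in ultra_model) ultra_enum_exists: "\<exists>fm. ultra_enum M U fm"
proof -
  define def where "def p F \<longleftrightarrow> (\<forall>\<rho>. \<rho> 0 = F (\<lambda>i. \<rho> (Suc i)) \<longleftrightarrow> esat M \<rho> p)" for p and F :: "(nat \<Rightarrow> 'a) \<Rightarrow> 'a"
  have def_unique: "F = H" if "def p F" "def p H" for p F H
  proof
    fix s
    have "esat M (case_nat (F s) s) p" using that(1)[unfolded def_def, rule_format, of "case_nat (F s) s"] by simp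
    then show "F s = H s" using that(2)[unfolded def_def, rule_format, of "case_nat (F s) s"] by simp
  qed
  have DT_def: "DT {} F \<longleftrightarrow> (\<exists>p. def p F)" for F unfolding defn_def D_iff_esat def_def ..
  \<comment> \<open>An index \<open>m\<close> codes a formula together with a padding number, so
    each formula has infinitely many indices; \<open>m\<close> counts only if the function reads
    none but its first \<open>m\<close> arguments.\<close>
  define P where "P m F \<longleftrightarrow> def (fst (from_nat m :: afm \<times> nat)) F \<and> supp {..<m} F" for m F
  define fm where "fm m = (if \<exists>F. P m F then SOME F. P m F else (\<lambda>s. \<zero>))" for m
  have fm_P: "fm m = F" if "P m F" for m F
  proof -
    have "\<exists>F. P m F" using that by blast
    then have "P m (fm m)" unfolding fm_def using someI_ex[of "P m"] by simp
    then show ?thesis using that def_unique[of _ "fm m" F] unfolding P_def by blast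
  qed
  have "ultra_enum M U fm"
  proof (unfold_locales)
    fix m
    show "DT {} (fm m)" "supp {..<m} (fm m)"
    proof (atomize (full), cases "\<exists>F. P m F")
      case True
      then obtain F where F: "P m F" by blast
      then show "DT {} (fm m) \<and> supp {..<m} (fm m)" using fm_P[OF F] DT_def[of F] unfolding P_def by auto
    next
      case False
      from False have "fm m = (\<lambda>s. \<zero>)" unfolding fm_def by (rule if_not_P)
      then show "DT {} (fm m) \<and> supp {..<m} (fm m)" by (simp add: DT_zero supp_def)
    qed
  next
    fix F :: "(nat \<Rightarrow> 'a) \<Rightarrow> 'a" and n assume F: "DT {} F" "supp {..<n} F"
    then obtain p where p: "def p F" using DT_def by blast
    have "inj (\<lambda>k. to_nat (p, k :: nat))" by (auto simp: inj_def)
    then have "infinite (range (\<lambda>k. to_nat (p, k :: nat)))" using finite_imageD by blast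
    then obtain m where m: "m \<ge> n" "m \<in> range (\<lambda>k. to_nat (p, k :: nat))"
      unfolding infinite_nat_iff_unbounded_le by blast
    then obtain k where k: "m = to_nat (p, k :: nat)" by blast
    have "{..<n} \<subseteq> {..<m}" using m(1) by auto
    then have "supp {..<m} F" using F(2) supp_mono by blast
    then have "P m F" using p k by (simp add: P_def)
    then show "\<exists>m\<ge>n. fm m = F" using fm_P m(1) by blast
  qed
  then show ?thesis by blast
qed

context ultra_enum
begin

lemmas fsup_le = fsup_comp2[where f="(\<preceq>)"]
lemmas fsup_lt = fsup_comp2[where f="(\<prec>)"]

lemma AE_transport:
  assumes "inj_on \<pi> A" "supp A P"
  shows "set qs \<subseteq> A \<Longrightarrow> AE (map \<pi> qs) (\<lambda>s. P (\<lambda>q. s (\<pi> q))) s = AE qs P (\<lambda>q. s (\<pi> q))"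
proof (induction qs arbitrary: s)
  case (Cons q qs)
  have "AE qs P (\<lambda>r. (s(\<pi> q := x)) (\<pi> r)) = AE qs P ((\<lambda>r. s (\<pi> r))(q := x))" for x
    by (rule AE_cong[OF assms(2)]) (use assms(1) Cons.prems in \<open>auto dest: inj_onD\<close>)
  then show ?case using Cons by simp
qed simp

text \<open>Indiscernibility: an order embedding maps the increasing list of the support to an
  increasing list, and the iterated quantifier sees only the order in which the coordinates are
  bound.\<close>

lemma W_transport:
  assumes L: "L \<in> countable_LO" and L': "L' \<in> countable_LO" and "emb L L' A \<pi>" "supp A P"
  shows "W L' (\<lambda>s. P (\<lambda>q. s (\<pi> q))) \<longleftrightarrow> W L P"
proof -
  have A: "finite A" "A \<subseteq> dom L" "\<pi> ` A \<subseteq> dom L'" "\<And>a b. a \<in> A \<Longrightarrow> b \<in> A \<Longrightarrow> slt L a b \<Longrightarrow> slt L' (\<pi> a) (\<pi> b)"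
    using assms(3) unfolding emb_def by auto
  obtain qs where qs: "sorted_wrt (slt L) qs" "set qs = A" using sorted_exists[OF L A(1,2)] by blast
  have "sorted_wrt (slt L') (map \<pi> qs)" using qs A(4)
    unfolding sorted_wrt_map by (auto intro: sorted_wrt_mono_rel[of _ "slt L"])
  moreover have "set (map \<pi> qs) \<subseteq> dom L'" using qs(2) A(3) by simp
  moreover have "supp (set (map \<pi> qs)) (\<lambda>s. P (\<lambda>q. s (\<pi> q)))"
    unfolding supp_def
  proof (intro allI impI)
    fix s s' :: "nat \<Rightarrow> 'a" assume "\<forall>q\<in>set (map \<pi> qs). s q = s' q"
    then show "P (\<lambda>q. s (\<pi> q)) = P (\<lambda>q. s' (\<pi> q))"
      by (intro suppD[OF assms(4)]) (use qs(2) in simp)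
  qed
  ultimately have "W L' (\<lambda>s. P (\<lambda>q. s (\<pi> q))) \<longleftrightarrow> AE (map \<pi> qs) (\<lambda>s. P (\<lambda>q. s (\<pi> q))) (\<lambda>_. \<zero>)"
    by (rule W_iff[OF L'])
  also have "\<dots> \<longleftrightarrow> AE qs P (\<lambda>_. \<zero>)"
    using AE_transport[OF emb_inj[OF L assms(3)] assms(4), of qs "\<lambda>_. \<zero>"] qs(2) by simp
  also have "\<dots> \<longleftrightarrow> W L P" using W_iff[OF L qs(1), of P "\<lambda>_. \<zero>"] qs(2) A(2) assms(4) by simp
  finally show ?thesis .
qed

definition ftp :: "(nat, lsym) struct \<Rightarrow> ((nat \<Rightarrow> 'a) \<Rightarrow> 'a) list \<Rightarrow> nat \<times> afm set" where
  "ftp L Fs = eqtp (NL L) (map (cls L) Fs)"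

lemma FX_transport:
  assumes "L \<in> countable_LO" "L' \<in> countable_LO" "emb L L' A \<pi>" "supp A F" "DT {} F"
  shows "F \<in> FX L" "(\<lambda>s. F (\<lambda>q. s (\<pi> q))) \<in> FX L'"
proof -
  have A: "finite A" "A \<subseteq> dom L" "\<pi> ` A \<subseteq> dom L'" using assms(3) unfolding emb_def by auto
  show "F \<in> FX L" unfolding FX_def[OF assms(1)] fsup_def using assms(4,5) A by blast
  have "supp (\<pi> ` A) (\<lambda>s. F (\<lambda>q. s (\<pi> q)))" using assms(4) unfolding supp_def by simp
  then show "(\<lambda>s. F (\<lambda>q. s (\<pi> q))) \<in> FX L'"
    unfolding FX_def[OF assms(2)] fsup_def using DT_rename[OF assms(5), of \<pi>] A by blast
qed

lemma ftp_transport: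
  assumes L: "L \<in> countable_LO" "L' \<in> countable_LO" and "emb L L' A \<pi>"
    "\<And>F. F \<in> set Fs \<Longrightarrow> supp A F \<and> DT {} F"
  shows "ftp L' (map (\<lambda>F s. F (\<lambda>q. s (\<pi> q))) Fs) = ftp L Fs"
proof -
  let ?Fs = "map (\<lambda>F s. F (\<lambda>q. s (\<pi> q))) Fs"
  have "asat (NL L') (map (cls L') ?Fs) p \<longleftrightarrow> asat (NL L) (map (cls L) Fs) p" if p: "afm_in (length Fs) p" for p
  proof -
    have "asat (NL L') (map (cls L') ?Fs) p \<longleftrightarrow> W L' (\<lambda>s. asat M (map (\<lambda>F. F s) ?Fs) p)"
      by (rule asat_NL[OF L(2)]) (use p assms(4) FX_transport[OF L assms(3)] in auto)
    also have "\<dots> \<longleftrightarrow> W L' (\<lambda>s. (\<lambda>s. asat M (map (\<lambda>F. F s) Fs) p) (\<lambda>q. s (\<pi> q)))" by (simp add: o_def)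
    also have "\<dots> \<longleftrightarrow> W L (\<lambda>s. asat M (map (\<lambda>F. F s) Fs) p)"
    proof (rule W_transport[OF L assms(3)])
      have "map (\<lambda>F. F s) Fs = map (\<lambda>F. F s') Fs" if "\<forall>q\<in>A. s q = s' q" for s s'
        using assms(4) that unfolding supp_def by auto
      then show "supp A (\<lambda>s. asat M (map (\<lambda>F. F s) Fs) p)" unfolding supp_def by metis
    qed
    also have "\<dots> \<longleftrightarrow> asat (NL L) (map (cls L) Fs) p"
      by (rule asat_NL[OF L(1), symmetric]) (use p assms(4) FX_transport[OF L assms(3)] in auto)
    finally show ?thesis .
  qed
  then show ?thesis unfolding ftp_def eqtp_def by auto
qed

text \<open>The length of a tuple of generators codes the function that is applied to it.\<close>

definition elem_fun :: "nat list \<Rightarrow> (nat \<Rightarrow> 'a) \<Rightarrow> 'a" where "elem_fun b s = fm (length b) (\<lambda>i. s (b ! i))"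

definition elem :: "(nat, lsym) struct \<Rightarrow> nat list \<Rightarrow> nat" where "elem L b = cls L (elem_fun b)"

definition gen :: "(nat, lsym) struct \<Rightarrow> nat \<Rightarrow> nat" where "gen L q = cls L (\<lambda>s. s q)"

lemma DT_elem_fun: "DT {} (elem_fun b)"
  unfolding elem_fun_def by (rule DT_rename[OF DT_fm])

lemma supp_elem_fun: "supp (set b) (elem_fun b)"
  unfolding supp_def
proof (intro allI impI)
  fix s s' :: "nat \<Rightarrow> 'a" assume "\<forall>q\<in>set b. s q = s' q"
  then show "elem_fun b s = elem_fun b s'" unfolding elem_fun_def
    by (intro suppD[OF supp_fm]) simp
qed

lemma elem_fun_map: "elem_fun (map \<pi> b) = (\<lambda>s. elem_fun b (\<lambda>q. s (\<pi> q)))"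
proof
  fix s
  show "elem_fun (map \<pi> b) s = elem_fun b (\<lambda>q. s (\<pi> q))" unfolding elem_fun_def length_map
    by (rule suppD[OF supp_fm]) simp
qed

text \<open>Elements and generators are transported together, so that mixed tuples are covered, in
  particular a value with its arguments.\<close>

lemma ftp_map:
  assumes "L \<in> countable_LO" "L' \<in> countable_LO" "emb L L' (set (concat bs) \<union> set qs) \<pi>"
  shows "ftp L' (map elem_fun (map (map \<pi>) bs) @ map (\<lambda>q s. s (\<pi> q)) qs) = ftp L (map elem_fun bs @ map (\<lambda>q s. s q) qs)"
proof -
  have "ftp L' (map (\<lambda>F s. F (\<lambda>q. s (\<pi> q))) (map elem_fun bs @ map (\<lambda>q s. s q) qs)) = ftp L (map elem_fun bs @ map (\<lambda>q s. s q) qs)"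
  proof (rule ftp_transport[OF assms])
    fix F assume "F \<in> set (map elem_fun bs @ map (\<lambda>q s. s q) qs)"
    then consider b where "b \<in> set bs" "F = elem_fun b" | q where "q \<in> set qs" "F = (\<lambda>s. s q)" by auto
    then show "supp (set (concat bs) \<union> set qs) F \<and> DT {} F"
    proof cases
      case 1
      then have "set b \<subseteq> set (concat bs) \<union> set qs" by auto
      then show ?thesis using 1(2) supp_mono[OF supp_elem_fun] DT_elem_fun by blast
    next
      case 2
      then show ?thesis using DT_var by (auto simp: supp_def)
    qed
  qed
  then show ?thesis by (simp add: o_def elem_fun_map)
qed

text \<open>As a member of the type of a tuple of generators followed by one more element, such a
  formula forces that element to be the value; see \<open>graph_NL\<close>.\<close>

lemma graph_formula: "\<exists>p. afm_in (Suc m) p \<and> (\<forall>e x. length e = m \<longrightarrow>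
    (asat M (e @ [x]) p \<longleftrightarrow> x = fm m ((!) e)))"
proof -
  obtain p where p: "\<And>\<rho>. \<rho> 0 = fm m (\<lambda>i. \<rho> (Suc i)) \<longleftrightarrow> esat M \<rho> p"
    using DT_fm[of m] unfolding defn_def D_iff_esat by blast
  let ?\<sigma> = "\<lambda>i. case i of 0 \<Rightarrow> V m | Suc j \<Rightarrow> if j < m then V j else Zero"
  have "asat M (e @ [x]) (asubst ?\<sigma> p) \<longleftrightarrow> x = fm m ((!) e)" if "length e = m" for e x
  proof -
    have "fm m (\<lambda>i. tval M ((!) (e @ [x])) (?\<sigma> (Suc i))) = fm m ((!) e)"
      by (rule suppD[OF supp_fm]) (use that in \<open>simp add: nth_append\<close>)
    then show ?thesis using p[of "\<lambda>i. tval M ((!) (e @ [x])) (?\<sigma> i)"] that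
      by (simp add: asat_esat esat_asubst nth_append)
  qed
  moreover have "afm_in (Suc m) (asubst ?\<sigma> p)" by (rule afm_in_asubst) (auto split: nat.split)
  ultimately show ?thesis by blast
qed

section \<open>Elements, generators and their types in the model of one order\<close>

context
  fixes L :: "(nat, lsym) struct"
  assumes L: "L \<in> countable_LO"
begin

lemma elem_fun_FX: "b \<in> lists (dom L) \<Longrightarrow> elem_fun b \<in> FX L"
  unfolding FX_def[OF L] fsup_def using DT_elem_fun supp_elem_fun[of b] by (auto simp: in_lists_conv_set intro!: exI[of _ "set b"])

lemma dom_ne: "dom L \<noteq> {}"
  using L unfolding countable_LO_def is_struct_def by blast

text \<open>Relabelling turns a function of finite support into one of its first arguments, and the
  list of arguments is padded with an arbitrary element \<open>x0\<close> until its length is an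
  index of that function.\<close>

lemma elem_surj: "\<exists>b\<in>lists (dom L). elem L b = n"
proof -
  obtain F where F: "F \<in> FX L" "cls L F = n" using cls_surj[OF L] by (metis UNIV_I imageE)
  then obtain A where A: "finite A" "A \<subseteq> dom L" "supp A F" and DF: "DT {} F"
    unfolding FX_def[OF L] fsup_def by blast
  obtain qs where qs: "set qs = A" using finite_list[OF A(1)] by blast
  have "\<forall>i\<in>A. \<exists>j. j < length qs \<and> qs ! j = i" using qs by (auto simp: in_set_conv_nth)
  then obtain idx where idx: "\<forall>i\<in>A. idx i < length qs \<and> qs ! idx i = i" using bchoice by meson
  define F' where "F' \<rho> = F (\<lambda>i. \<rho> (if i \<in> A then idx i else 0))" for \<rho>
  have "DT {} F'" unfolding F'_def by (rule DT_rename[OF DF])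
  moreover have "supp {..<length qs} F'" unfolding supp_def F'_def
  proof (intro allI impI)
    fix s s' :: "nat \<Rightarrow> 'a" assume "\<forall>q\<in>{..<length qs}. s q = s' q"
    then show "F (\<lambda>i. s (if i \<in> A then idx i else 0)) = F (\<lambda>i. s' (if i \<in> A then idx i else 0))"
      by (intro suppD[OF A(3)]) (use idx in simp)
  qed
  ultimately obtain m where m: "m \<ge> length qs" "fm m = F'" using fm_surj by blast
  obtain x0 where x0: "x0 \<in> dom L" using dom_ne by blast
  define b where "b = qs @ replicate (m - length qs) x0"
  have "length b = m" using m(1) by (simp add: b_def)
  have "elem_fun b s = F s" for s
  proof -
    have "F (\<lambda>i. s (b ! (if i \<in> A then idx i else 0))) = F s"
      by (rule suppD[OF A(3)]) (use idx in \<open>simp add: b_def nth_append\<close>)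
    then show ?thesis unfolding elem_fun_def \<open>length b = m\<close> m(2) F'_def .
  qed
  then have "elem_fun b = F" by blast
  moreover have "b \<in> lists (dom L)" using x0 qs A(2) by (auto simp: b_def)
  ultimately show ?thesis using F(2) unfolding elem_def by blast
qed

lemma eqtp_FX: "Fs \<in> lists (FX L) \<Longrightarrow> p \<in> snd (eqtp (NL L) (map (cls L) Fs)) \<longleftrightarrow>
    afm_in (length Fs) p \<and> W L (\<lambda>s. asat M (map (\<lambda>F. F s) Fs) p)"
  using asat_NL[OF L] by (auto simp: eqtp_def)

lemma gen_type: "q \<in> dom L \<Longrightarrow> eqtp (NL L) [gen L q] = (1, {p. afm_in 1 p \<and> U (\<lambda>x. asat M [x] p)})"
proof -
  assume q: "q \<in> dom L"
  have "p \<in> snd (eqtp (NL L) (map (cls L) [\<lambda>s. s q])) \<longleftrightarrow> afm_in 1 p \<and> U (\<lambda>x. asat M [x] p)" for p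
    using eqtp_FX[of "[\<lambda>s. s q]" p] FX_var[OF L q] W_single[OF L q, of "\<lambda>x. asat M [x] p"] by simp
  then show ?thesis unfolding gen_def by (auto simp: eqtp_def prod_eq_iff)
qed

lemma gen_only:
  assumes q0: "q0 \<in> dom L" and eq: "eqtp (NL L) [n] = eqtp (NL L) [gen L q0]"
  shows "\<exists>q\<in>dom L. n = gen L q"
proof -
  obtain F where F: "F \<in> FX L" "cls L F = n" using cls_surj[OF L] by (metis UNIV_I imageE)
  then obtain A where A: "finite A" "A \<subseteq> dom L" "supp A F" and DF: "DT {} F"
    unfolding FX_def[OF L] fsup_def by blast
  obtain qs where qs: "sorted_wrt (slt L) qs" "set qs = A" using sorted_exists[OF L A(1,2)] by blast
  have "\<exists>q\<in>set qs. W L (\<lambda>s. F s = s q)"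
  proof (rule generator_unique[OF L qs(1) _ DF])
    show "set qs \<subseteq> dom L" "supp (set qs) F" using A qs(2) by auto
    fix Y assume Y: "D {} (\<lambda>\<rho>. Y (\<rho> 0))" "U Y"
    then obtain p where p: "\<And>\<rho>. Y (\<rho> 0) \<longleftrightarrow> esat M \<rho> p" unfolding D_iff_esat by blast
    \<comment> \<open>A predicate of \<open>\<rho> 0\<close> alone can be tested at constant
      valuations, so all variables may be replaced by \<open>V 0\<close>. This makes
      \<open>Y\<close> visible to the type of a single element.\<close>
    let ?p = "asubst (\<lambda>_. V 0) p"
    have sat: "asat M [x] ?p \<longleftrightarrow> Y x" for x using p[of "\<lambda>_. x"] by (simp add: asat_esat esat_asubst)
    have in1: "afm_in 1 ?p" by (rule afm_in_asubst) simp
    have "?p \<in> snd (eqtp (NL L) [gen L q0])" using gen_type[OF q0] Y(2) in1 sat by simp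
    then have "?p \<in> snd (eqtp (NL L) (map (cls L) [F]))" using eq F(2) by simp
    then show "W L (\<lambda>s. Y (F s))" using eqtp_FX[of "[F]" ?p] F(1) sat by simp
  qed
  then obtain q where q: "q \<in> dom L" "W L (\<lambda>s. F s = s q)" using qs(2) A(2) by blast
  then have "cls L F = gen L q" unfolding gen_def using cls_eq[OF L F(1) FX_var[OF L q(1)]] by simp
  then show ?thesis using F(2) q(1) by blast
qed

lemma gen_le: "q \<in> dom L \<Longrightarrow> q' \<in> dom L \<Longrightarrow> ale (NL L) (gen L q) (gen L q') \<longleftrightarrow> rel L Leq [q, q']"
proof -
  assume q: "q \<in> dom L" "q' \<in> dom L"
  have lt: "W L (\<lambda>s. s r \<prec> s r')" if "slt L r r'" "r \<in> dom L" "r' \<in> dom L" for r r'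
    using W_pair[OF L that(2,3,1), of "\<lambda>x y. x \<prec> y"] U_tail by simp
  have fs: "fsup L (\<lambda>s. s r :: 'a)" if "r \<in> dom L" for r using fsup_FX[OF L FX_var[OF L that]] .
  have "W L (\<lambda>s. s q \<preceq> s q') \<longleftrightarrow> q = q' \<or> slt L q q'"
  proof -
    consider "q = q'" | "slt L q q'" | "slt L q' q" using slt_total[OF L q] by blast
    then show ?thesis
    proof cases
      case 1 then show ?thesis by (simp add: W_const[OF L])
    next
      case 2
      have "W L (\<lambda>s. s q \<preceq> s q')"
        by (rule W_mono[OF L lt[OF 2 q]]) (simp_all add: fsup_le fsup_lt fs q ord.less_imp_le)
      then show ?thesis using 2 by simp
    next
      case 3
      have "\<not> W L (\<lambda>s. s q \<preceq> s q')"
        using lt[OF 3 q(2,1)] W_neg[OF L fsup_le[OF fs[OF q(1)] fs[OF q(2)]]]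
        unfolding ord.not_le by (rule iffD1[rotated])
      then show ?thesis using 3 slt_trans[OF L 3] slt_irrefl[OF L] by (auto simp: slt_def)
    qed
  qed
  then show ?thesis unfolding gen_def using NL_le[OF L FX_var[OF L q(1)] FX_var[OF L q(2)]] leq_iff[OF L q] by simp
qed

lemma gen_inj: "q \<in> dom L \<Longrightarrow> q' \<in> dom L \<Longrightarrow> gen L q = gen L q' \<Longrightarrow> q = q'"
  using gen_le[of q q'] gen_le[of q' q] gen_le[of q q] leq_iff[OF L, of q q'] leq_iff[OF L, of q' q]
    leq_iff[OF L, of q q] slt_trans[OF L, of q q' q] slt_irrefl[OF L] by auto

text \<open>A generator lies above every numeral by \<open>U_tail\<close>, so the model is
  nonstandard even if \<open>M\<close> is not; this makes \<open>bf_le_omega_iff\<close>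
  applicable.\<close>

lemma nonstd_NL:
  assumes "pa_model (NL L)"
  shows "\<exists>m. pa_model.nonstd (NL L) m"
proof -
  interpret N: pa_model "NL L" by fact
  obtain q where q: "q \<in> dom L" using dom_ne by blast
  have num: "N.num n = cls L (\<lambda>s. num n)" for n
  proof (induction n)
    case 0
    have "azero (NL L) = cls L (\<lambda>s. \<zero>)" by (simp add: NL_def[OF L])
    then show ?case by simp
  next
    case (Suc n)
    have one: "aone (NL L) = cls L (\<lambda>s. \<one>)" "(\<lambda>s. \<one>) \<in> FX L"
      by (auto simp: NL_def[OF L] FX_def[OF L] DT_one fsup_const)
    show ?case using NL_plus(1)[OF L FX_num[OF L] one(2), of n] Suc one(1) by simp
  qed
  have "N.num n \<noteq> gen L q \<and> ale (NL L) (N.num n) (gen L q)" for n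
  proof -
    have W: "W L (\<lambda>s. num n \<prec> s q)" using W_single[OF L q, of "\<lambda>x. num n \<prec> x"] U_tail by simp
    have fs: "fsup L (\<lambda>s. s q :: 'a)" "fsup L (\<lambda>s :: nat \<Rightarrow> 'a. num n)"
      using fsup_FX[OF L FX_var[OF L q]] fsup_FX[OF L FX_num[OF L]] by auto
    have "W L (\<lambda>s. num n \<preceq> s q)"
      by (rule W_mono[OF L W]) (simp_all add: fsup_le fsup_lt fs ord.less_imp_le)
    moreover have "W L (\<lambda>s. \<not> num n = s q)"
      by (rule W_mono[OF L W]) (simp_all add: fsup_comp[where f=Not] fsup_eq fsup_lt fs ord.less_imp_neq)
    ultimately show ?thesis unfolding num gen_def using cls_eq[OF L FX_num[OF L] FX_var[OF L q]]
        NL_le[OF L FX_num[OF L] FX_var[OF L q]] W_neg[OF L fsup_eq[OF fs(2,1)]] by simp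
  qed
  then show ?thesis unfolding N.nonstd_def N.lt_def by (intro exI[of _ "gen L q"]) auto
qed

lemma graph_NL:
  assumes p: "afm_in (Suc m) p" "\<And>e x. length e = m \<Longrightarrow> asat M (e @ [x]) p \<longleftrightarrow> x = fm m ((!) e)"
    and qs: "qs \<in> lists (dom L)" "length qs = m"
  shows "p \<in> snd (eqtp (NL L) (map (gen L) qs @ [x])) \<longleftrightarrow> x = elem L qs"
proof -
  obtain F where F: "F \<in> FX L" "cls L F = x" using cls_surj[OF L] by (metis UNIV_I imageE)
  let ?Fs = "map (\<lambda>q s. s q) qs @ [F]"
  have Fs: "?Fs \<in> lists (FX L)" using F(1) qs(1) FX_var[OF L] by auto
  have e: "map (gen L) qs @ [x] = map (cls L) ?Fs" using F(2) by (simp add: gen_def)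
  have "afm_in (length ?Fs) p" using p(1) qs(2) by simp
  then have "p \<in> snd (eqtp (NL L) (map (gen L) qs @ [x])) \<longleftrightarrow> W L (\<lambda>s. asat M (map (\<lambda>F. F s) ?Fs) p)"
    unfolding e using eqtp_FX[OF Fs, of p] by blast
  also have "(\<lambda>s. asat M (map (\<lambda>F. F s) ?Fs) p) = (\<lambda>s. F s = elem_fun qs s)"
  proof
    fix s
    have "asat M (map (\<lambda>F. F s) ?Fs) p \<longleftrightarrow> F s = fm m ((!) (map s qs))"
      using p(2)[of "map s qs" "F s"] qs(2) by (simp add: o_def)
    also have "fm m ((!) (map s qs)) = elem_fun qs s" unfolding elem_fun_def qs(2)
      by (rule suppD[OF supp_fm]) (use qs(2) in simp)
    finally show "asat M (map (\<lambda>F. F s) ?Fs) p \<longleftrightarrow> F s = elem_fun qs s" .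
  qed
  also have "W L (\<lambda>s. F s = elem_fun qs s) \<longleftrightarrow> x = elem L qs"
    unfolding elem_def using cls_eq[OF L F(1) elem_fun_FX[OF qs(1)]] F(2) by simp
  finally show ?thesis .
qed

end

end

section \<open>Quantifier-free definitions\<close>

definition qdef :: "('r \<Rightarrow> nat) \<Rightarrow> nat \<Rightarrow> ((nat, 'r) struct \<Rightarrow> nat list \<Rightarrow> bool) \<Rightarrow> bool" where
  "qdef ar n P \<longleftrightarrow> (\<exists>\<phi>. qfree \<phi> \<and> form_in ar n \<phi> \<and> (\<forall>A e. sat A e \<phi> \<longleftrightarrow> P A e))"

lemma qdef_neg: "qdef ar n P \<Longrightarrow> qdef ar n (\<lambda>A e. \<not> P A e)"
  unfolding qdef_def by (metis form_in.simps(4) qfree.simps(4) sat.simps(4))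

lemma qdef_conj: "qdef ar n P \<Longrightarrow> qdef ar n Q \<Longrightarrow> qdef ar n (\<lambda>A e. P A e \<and> Q A e)"
  unfolding qdef_def by (metis form_in.simps(5) qfree.simps(5) sat.simps(5))

lemma qdef_rel: "length is = ar r \<Longrightarrow> (\<And>i. i \<in> set is \<Longrightarrow> i < n) \<Longrightarrow> qdef ar n (\<lambda>A e. rel A r (map ((!) e) is))"
  unfolding qdef_def by (intro exI[of _ "Rel r is"]) simp

lemma qdef_all: "finite X \<Longrightarrow> (\<And>x. x \<in> X \<Longrightarrow> qdef ar n (P x)) \<Longrightarrow> qdef ar n (\<lambda>A e. \<forall>x\<in>X. P x A e)"
proof (induction rule: finite_induct)
  case empty
  show ?case unfolding qdef_def by (intro exI[of _ "Neg Bot"]) simp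
next
  case (insert x X)
  have "qdef ar n (\<lambda>A e. P x A e \<and> (\<forall>x\<in>X. P x A e))" by (rule qdef_conj) (use insert in auto)
  then show ?case by simp
qed

lemma qdef_ex: "finite X \<Longrightarrow> (\<And>x. x \<in> X \<Longrightarrow> qdef ar n (P x)) \<Longrightarrow> qdef ar n (\<lambda>A e. \<exists>x\<in>X. P x A e)"
proof -
  assume "finite X" "\<And>x. x \<in> X \<Longrightarrow> qdef ar n (P x)"
  then have "qdef ar n (\<lambda>A e. \<not> (\<forall>x\<in>X. \<not> P x A e))" by (intro qdef_neg qdef_all)
  then show ?thesis by simp
qed

lemma qfree_Delta1:
  assumes "\<And>ls. qfree (\<Phi> ls)" "\<And>ls. form_in ar (sum_list ls) (\<Phi> ls)"
  shows "Delta1 ar K \<Phi>"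
  unfolding Delta1_def Let_def
proof (intro allI conjI)
  fix ls
  show "form_in ar (sum_list ls) (\<Phi> ls)" by (rule assms)
  have "Sigma1 (Disj (\<lambda>_. \<Phi> ls))" unfolding Sigma1_def
    using assms by (intro exI[of _ "\<lambda>_. 0"] exI[of _ "\<lambda>_. \<Phi> ls"]) simp
  then show "\<exists>\<sigma>. Sigma1 \<sigma> \<and> form_in ar (sum_list ls) \<sigma> \<and> equiv_on K (sum_list ls) (\<Phi> ls) \<sigma>"
    using assms by (intro exI[of _ "Disj (\<lambda>_. \<Phi> ls)"]) (simp add: equiv_on_def)
  have "Pi1 (Conj (\<lambda>_. \<Phi> ls))" unfolding Pi1_def
    using assms by (intro exI[of _ "\<lambda>_. 0"] exI[of _ "\<lambda>_. \<Phi> ls"]) simp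
  then show "\<exists>\<pi>. Pi1 \<pi> \<and> form_in ar (sum_list ls) \<pi> \<and> equiv_on K (sum_list ls) (\<Phi> ls) \<pi>"
    using assms by (intro exI[of _ "Conj (\<lambda>_. \<Phi> ls)"]) (simp add: equiv_on_def)
qed

section \<open>Order patterns of tuples\<close>

definition pat :: "(nat, lsym) struct \<Rightarrow> nat list \<Rightarrow> (nat \<times> nat) set" where
  "pat L e = {(i, j). i < length e \<and> j < length e \<and> rel L Leq [e ! i, e ! j]}"

text \<open>The pattern of an \<open>n\<close>-tuple is one of finitely many sets of pairs, so
  membership in an arbitrary \<open>\<Theta>\<close> amounts to a finite disjunction of diagrams.
  One formula serves all orders.\<close>

lemma pat_formula: "\<exists>\<phi>. qfree \<phi> \<and> form_in lo_ar n \<phi> \<and>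
    (\<forall>L e. length e = n \<longrightarrow> (sat L e \<phi> \<longleftrightarrow> pat L e \<in> \<Theta>))"
proof -
  let ?X = "{..<n} \<times> {..<n}"
  let ?P = "\<lambda>(L :: (nat, lsym) struct) e. \<exists>\<tau>\<in>\<Theta> \<inter> Pow ?X. \<forall>x\<in>?X. x \<in> \<tau> \<longleftrightarrow> rel L Leq [e ! fst x, e ! snd x]"
  have "qdef lo_ar n (\<lambda>L e. x \<in> \<tau> \<longleftrightarrow> rel L Leq [e ! fst x, e ! snd x])" if "x \<in> ?X" for x \<tau>
  proof -
    have "qdef lo_ar n (\<lambda>L e. rel L Leq (map ((!) e) [fst x, snd x]))" by (rule qdef_rel) (use that in auto)
    then have r: "qdef lo_ar n (\<lambda>L e. rel L Leq [e ! fst x, e ! snd x])" by simp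
    show ?thesis using r qdef_neg[OF r] by (cases "x \<in> \<tau>") simp_all
  qed
  then have all: "qdef lo_ar n (\<lambda>L e. \<forall>x\<in>?X. x \<in> \<tau> \<longleftrightarrow> rel L Leq [e ! fst x, e ! snd x])" for \<tau>
    by (intro qdef_all) (simp, blast)
  have fin: "finite (\<Theta> \<inter> Pow ?X)" by simp
  have "qdef lo_ar n ?P" by (rule qdef_ex[OF fin]) (rule all)
  then obtain \<phi> where \<phi>: "qfree \<phi>" "form_in lo_ar n \<phi>" "\<forall>L e. sat L e \<phi> \<longleftrightarrow> ?P L e"
    unfolding qdef_def by (elim exE conjE) (rule that)
  have P_iff: "?P L e \<longleftrightarrow> pat L e \<in> \<Theta>" if "length e = n" for L e
  proof -
    have "(\<forall>x\<in>?X. x \<in> \<tau> \<longleftrightarrow> rel L Leq [e ! fst x, e ! snd x]) \<longleftrightarrow> \<tau> = pat L e" if "\<tau> \<subseteq> ?X" for \<tau>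
      using that \<open>length e = n\<close> by (auto simp: pat_def set_eq_iff)
    moreover have "pat L e \<subseteq> ?X" using that by (auto simp: pat_def)
    ultimately show ?thesis by (metis (no_types, lifting) Int_iff PowD PowI)
  qed
  have "sat L e \<phi> \<longleftrightarrow> pat L e \<in> \<Theta>" if "length e = n" for L e
    unfolding \<phi>(3)[THEN spec, THEN spec] by (rule P_iff[OF that])
  then show ?thesis using \<phi>(1,2) by blast
qed

text \<open>The pattern also decides equality of entries, by antisymmetry, so sending each entry to
  the entry at the same position is well defined.\<close>

lemma pat_emb:
  assumes L: "L \<in> countable_LO" "L' \<in> countable_LO" and e: "e \<in> lists (dom L)" "e' \<in> lists (dom L')"
    and len: "length e = length e'" and pat: "pat L e = pat L' e'"
  shows "\<exists>\<pi>. emb L L' (set e) \<pi> \<and> map \<pi> e = e'"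
proof -
  have rel: "rel L Leq [e ! i, e ! j] \<longleftrightarrow> rel L' Leq [e' ! i, e' ! j]" if "i < length e" "j < length e" for i j
    using pat that len unfolding pat_def by (auto simp: set_eq_iff)
  have dom: "e ! i \<in> dom L" "e' ! i \<in> dom L'" if "i < length e" for i
    using e that len by (auto simp: in_lists_conv_set)
  have eq: "e ! i = e ! j \<longleftrightarrow> e' ! i = e' ! j" if "i < length e" "j < length e" for i j
    using rel[OF that] rel[OF that(2,1)] leq_iff[OF L(1) dom(1)[OF that(1)] dom(1)[OF that(2)]]
      leq_iff[OF L(1) dom(1)[OF that(2)] dom(1)[OF that(1)]] leq_iff[OF L(2) dom(2)[OF that(1)] dom(2)[OF that(2)]]
      leq_iff[OF L(2) dom(2)[OF that(2)] dom(2)[OF that(1)]]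
      slt_trans[OF L(1), of "e ! i" "e ! j" "e ! i"] slt_trans[OF L(2), of "e' ! i" "e' ! j" "e' ! i"]
      slt_irrefl[OF L(1)] slt_irrefl[OF L(2)] by metis
  define \<pi> where "\<pi> a = e' ! (SOME i. i < length e \<and> e ! i = a)" for a
  have \<pi>: "\<pi> (e ! i) = e' ! i" if "i < length e" for i
  proof -
    have "\<exists>j. j < length e \<and> e ! j = e ! i" using that by blast
    from someI_ex[OF this] show ?thesis unfolding \<pi>_def using eq that by blast
  qed
  have "slt L' (\<pi> a) (\<pi> b)" if ab: "a \<in> set e" "b \<in> set e" "slt L a b" for a b
  proof -
    obtain i j where ij: "i < length e" "j < length e" "a = e ! i" "b = e ! j" using ab by (auto simp: in_set_conv_nth)
    then show ?thesis using ab(3) rel[OF ij(1,2)] eq[OF ij(1,2)] \<pi> by (simp add: slt_def)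
  qed
  moreover have "map \<pi> e = e'" using \<pi> len by (auto intro: nth_equalityI)
  moreover have "set e \<subseteq> dom L" "set e' \<subseteq> dom L'" using e by auto
  ultimately have "emb L L' (set e) \<pi>" unfolding emb_def by (metis List.finite_set set_map)
  then show ?thesis using \<open>map \<pi> e = e'\<close> by blast
qed

lemma map_map_concat:
  "map \<pi> (concat bs) = concat bs' \<Longrightarrow> map length bs = map length bs' \<Longrightarrow> map (map \<pi>) bs = bs'"
proof (induction bs arbitrary: bs')
  case (Cons b bs)
  then obtain b' bs'' where "bs' = b' # bs''" by (cases bs') auto
  then show ?case using Cons by auto
qed simp

lemma concat_in_lists: "bs \<in> lists (lists A) \<Longrightarrow> concat bs \<in> lists A"
  by (induction bs) auto

lemma sorted_distinct: "sorted_wrt (slt L) xs \<Longrightarrow> distinct xs"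
  by (induction xs) (auto simp: slt_def)

lemma emb_exists:
  assumes L: "L \<in> infinite_countable_LO" "L' \<in> countable_LO" and A: "finite A" "A \<subseteq> dom L'"
  shows "\<exists>\<pi>. emb L' L A \<pi>"
proof -
  have L1: "L \<in> countable_LO" "infinite (dom L)" using L(1) unfolding infinite_countable_LO_def by auto
  obtain qs' where qs': "sorted_wrt (slt L') qs'" "set qs' = A" using sorted_exists[OF L(2) A] by blast
  obtain B where B: "finite B" "card B = card A" "B \<subseteq> dom L" using infinite_arbitrarily_large[OF L1(2)] by blast
  obtain qs where qs: "sorted_wrt (slt L) qs" "set qs = B" using sorted_exists[OF L1(1) B(1,3)] by blast
  have len: "length qs' = length qs"
    using distinct_card[OF sorted_distinct[OF qs(1)]] distinct_card[OF sorted_distinct[OF qs'(1)]] qs qs' B(2) by simp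
  define \<pi> where "\<pi> a = the (map_of (zip qs' qs) a)" for a
  have \<pi>: "\<pi> (qs' ! i) = qs ! i" if "i < length qs" for i
    unfolding \<pi>_def using map_of_zip_nth[OF len sorted_distinct[OF qs'(1)] that] by simp
  have nth: "\<exists>i<length qs. a = qs' ! i" if "a \<in> A" for a
    using that qs'(2) len by (metis in_set_conv_nth)
  have "slt L (\<pi> a) (\<pi> b)" if ab: "a \<in> A" "b \<in> A" "slt L' a b" for a b
  proof -
    obtain i j where ij: "i < length qs" "j < length qs" "a = qs' ! i" "b = qs' ! j" using nth ab by blast
    have "\<not> j < i" using sorted_wrt_nth_less[OF qs'(1), of j i] ij len ab(3) slt_trans[OF L(2)] slt_irrefl[OF L(2)] by metis
    moreover have "i \<noteq> j" using ab(3) ij by (auto simp: slt_def)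
    ultimately show ?thesis using sorted_wrt_nth_less[OF qs(1), of i j] ij \<pi> by simp
  qed
  moreover have "\<pi> ` A \<subseteq> dom L"
  proof
    fix y assume "y \<in> \<pi> ` A"
    then obtain i where "i < length qs" "y = \<pi> (qs' ! i)" using nth by blast
    then show "y \<in> dom L" using \<pi> qs(2) B(3) nth_mem by (metis subsetD)
  qed
  ultimately show ?thesis unfolding emb_def using A by blast
qed

text \<open>A reference order: its model realizes every type that occurs for some countable order,
  so it supplies the common list of symbols.\<close>

definition omega_LO :: "(nat, lsym) struct" where
  "omega_LO = \<lparr>dom = UNIV, rel = (\<lambda>_ xs. \<exists>a b. xs = [a, b] \<and> a \<le> b)\<rparr>"

lemma lo_ar_2: "lo_ar s = 2"
  by (cases s) simp

lemma omega_LO: "omega_LO \<in> infinite_countable_LO"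
  unfolding infinite_countable_LO_def countable_LO_def is_struct_def omega_LO_def linear_order_on_def
    partial_order_on_def preorder_on_def refl_on_def trans_def antisym_def total_on_def
  by (auto simp: lo_ar_2)

lemma infinite_LO: "L \<in> infinite_countable_LO \<Longrightarrow> L \<in> countable_LO"
  by (simp add: infinite_countable_LO_def)

section \<open>The bi-interpretation\<close>

locale jump_model = ultra_enum M U fm for M :: "nat arith" and U fm +
  fixes T :: "afm set"
  assumes T_sentences: "T \<subseteq> asentences" and T_true: "p \<in> T \<Longrightarrow> asat M [] p" and T_PA: "extends_PA T"
begin

lemma NL_model: "L \<in> countable_LO \<Longrightarrow> amodel T (NL L)"
  unfolding amodel_def arith_struct_def
  using T_sentences T_true asat_NL_sentence by (auto simp: asentences_def)

lemma NL_pa: "L \<in> countable_LO \<Longrightarrow> pa_model (NL L)"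
  using NL_model T_PA unfolding extends_PA_def aconsequence_def
  by unfold_locales auto

abbreviation "tp L \<equiv> eqtp (NL L)"

lemma ftp_elem: "ftp L (map elem_fun bs @ map (\<lambda>q s. s q) qs) = tp L (map (elem L) bs @ map (gen L) qs)"
  unfolding ftp_def elem_def gen_def by (simp add: o_def)

lemma tp_transport:
  assumes "L \<in> countable_LO" "L' \<in> countable_LO" "emb L L' (set (concat bs) \<union> set qs) \<pi>"
  shows "tp L' (map (elem L') (map (map \<pi>) bs) @ map (gen L') (map \<pi> qs)) = tp L (map (elem L) bs @ map (gen L) qs)"
  using ftp_map[OF assms] ftp_elem[of L bs qs] ftp_elem[of L' "map (map \<pi>) bs" "map \<pi> qs"] by (simp add: o_def)

lemma elem_list: "L \<in> countable_LO \<Longrightarrow> \<exists>bs\<in>lists (lists (dom L)). map (elem L) bs = xs"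
proof (induction xs)
  case (Cons x xs)
  then obtain bs where "bs \<in> lists (lists (dom L))" "map (elem L) bs = xs" by blast
  moreover obtain b where "b \<in> lists (dom L)" "elem L b = x" using elem_surj[OF Cons.prems] by blast
  ultimately show ?case by (intro bexI[of _ "b # bs"]) auto
qed simp

text \<open>A tuple is built from finitely many generators, and a finite suborder embeds in any
  infinite order. In particular, all infinite orders give models with the same types.\<close>

lemma realize:
  assumes L: "L \<in> infinite_countable_LO" "L' \<in> countable_LO"
  shows "\<exists>xs. tp L xs = tp L' xs'"
proof -
  obtain bs where bs: "bs \<in> lists (lists (dom L'))" "map (elem L') bs = xs'" using elem_list[OF L(2)] by blast
  have "set (concat bs) \<subseteq> dom L'" using bs(1) by auto
  then obtain \<pi> where "emb L' L (set (concat bs)) \<pi>" using emb_exists[OF L, of "set (concat bs)"] by auto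
  then have "tp L (map (elem L) (map (map \<pi>) bs)) = tp L' xs'"
    using tp_transport[OF L(2) infinite_LO[OF L(1)], of bs "[]" \<pi>] bs(2) by simp
  then show ?thesis by blast
qed

section \<open>A vocabulary of types shared by all the models\<close>

definition all_types :: "(nat \<times> afm set) set" where "all_types = range (tp omega_LO)"
definition type_at :: "nat \<Rightarrow> nat \<times> afm set" where "type_at = from_nat_into all_types"
definition type_index :: "nat \<times> afm set \<Rightarrow> nat" where "type_index = to_nat_on all_types"
definition ar :: "nat \<Rightarrow> nat" where "ar i = fst (type_at i)"

text \<open>There are types of every length, hence infinitely many. So \<open>type_at\<close>
  enumerates them without repetition and uses every index, as the canonical jump demands.\<close>

lemma all_types: "countable all_types" "infinite all_types"
proof -
  show "countable all_types" unfolding all_types_def by simp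
  have "fst ` all_types = UNIV"
  proof -
    have "n \<in> fst ` all_types" for n
    proof -
      have "fst (tp omega_LO (replicate n 0)) = n" by (simp add: eqtp_def)
      then show ?thesis unfolding all_types_def by (metis imageI rangeI)
    qed
    then show ?thesis by auto
  qed
  then show "infinite all_types" using infinite_UNIV_nat finite_imageI[of all_types fst] by metis
qed

lemma tp_all_types: "L \<in> countable_LO \<Longrightarrow> tp L xs \<in> all_types"
  unfolding all_types_def using realize[OF omega_LO, of L xs] by (metis rangeI)

lemma type_at_index: "t \<in> all_types \<Longrightarrow> type_at (type_index t) = t"
  unfolding type_at_def type_index_def by (rule from_nat_into_to_nat_on[OF all_types(1)])

lemma index_type_at: "type_index (type_at i) = i"
  unfolding type_at_def type_index_def by (rule to_nat_on_from_nat_into_infinite[OF all_types])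

definition realized :: "(nat, lsym) struct \<Rightarrow> nat set" where "realized L = {i. \<exists>xs. tp L xs = type_at i}"
definition realizer :: "(nat, lsym) struct \<Rightarrow> nat \<Rightarrow> nat list" where "realizer L i = (SOME xs. tp L xs = type_at i)"
definition jump_of :: "(nat, lsym) struct \<Rightarrow> (nat, jsym) struct" where "jump_of L = omega_jump (NL L) (realized L) (realizer L)"

lemma tp_realizer: "i \<in> realized L \<Longrightarrow> tp L (realizer L i) = type_at i"
  unfolding realized_def realizer_def using someI_ex[of "\<lambda>xs. tp L xs = type_at i"] by blast

lemma bf_tp: "L \<in> countable_LO \<Longrightarrow> bf_le (NL L) \<infinity> xs ys \<longleftrightarrow> tp L xs = tp L ys"
proof -
  assume L: "L \<in> countable_LO"
  interpret N: pa_model "NL L" by (rule NL_pa[OF L])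
  obtain m where "N.nonstd m" using nonstd_NL[OF L NL_pa[OF L]] by blast
  then show ?thesis using N.bf_le_omega_iff eqt_iff by blast
qed

lemma realizer_enumeration: "L \<in> countable_LO \<Longrightarrow> bf_enumeration (NL L) (realized L) (realizer L)"
proof -
  assume L: "L \<in> countable_LO"
  have "\<exists>!i. i \<in> realized L \<and> bf_equiv_omega (NL L) (realizer L i) b" for b
  proof (rule ex1I[of _ "type_index (tp L b)"])
    have "type_index (tp L b) \<in> realized L" unfolding realized_def using type_at_index[OF tp_all_types[OF L]] by auto
    then show "type_index (tp L b) \<in> realized L \<and> bf_equiv_omega (NL L) (realizer L (type_index (tp L b))) b"
      using tp_realizer type_at_index[OF tp_all_types[OF L]] by (simp add: bf_equiv_omega_def bf_tp[OF L])
  next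
    fix i assume "i \<in> realized L \<and> bf_equiv_omega (NL L) (realizer L i) b"
    then show "i = type_index (tp L b)" using tp_realizer index_type_at by (metis bf_equiv_omega_def bf_tp[OF L])
  qed
  then show ?thesis unfolding bf_enumeration_def by (simp add: adom_NL[OF L])
qed

lemma length_realizer: "i \<in> realized L \<Longrightarrow> length (realizer L i) = ar i"
  using tp_realizer[of i L] unfolding ar_def eqtp_def by (metis fst_conv)

lemma jump_of_partial: "L \<in> countable_LO \<Longrightarrow> jump_of L \<in> omega_jumps_partial T ar"
  unfolding omega_jumps_partial_def jump_of_def using NL_model realizer_enumeration length_realizer by blast

text \<open>An infinite order realizes the whole list by \<open>realize\<close>. A finite order with
  n elements cannot: its model has only n elements of the type of the generators, so the type of n +
  1 increasing generators is omitted and the jump is only partial.\<close>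

lemma jump_of_full: "L \<in> infinite_countable_LO \<Longrightarrow> jump_of L \<in> omega_jumps T ar"
proof -
  assume L: "L \<in> infinite_countable_LO"
  have "i \<in> realized L" for i
  proof -
    have "type_at i \<in> all_types" unfolding type_at_def using from_nat_into[of all_types i] all_types(2) finite.emptyI by metis
    then obtain xs' where "type_at i = tp omega_LO xs'" unfolding all_types_def by blast
    then show ?thesis unfolding realized_def using realize[OF L infinite_LO[OF omega_LO], of xs'] by simp
  qed
  then have "realized L = UNIV" by blast
  then show ?thesis unfolding omega_jumps_def jump_of_def
    using NL_model[OF infinite_LO[OF L]] realizer_enumeration[OF infinite_LO[OF L]] length_realizer[of _ L] by auto
qed

text \<open>Each symbol of the jump, arithmetical or \<open>R i\<close>, depends only on the type of
  the tuple, so all of them are defined over the order by one argument,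
  \<open>inv_tp\<close>.\<close>

primrec rel_in_type :: "jsym \<Rightarrow> nat \<times> afm set \<Rightarrow> bool" where
  "rel_in_type GZero t \<longleftrightarrow> fst t = 1 \<and> AEq (V 0) Zero \<in> snd t"
| "rel_in_type GOne t \<longleftrightarrow> fst t = 1 \<and> AEq (V 0) One \<in> snd t"
| "rel_in_type GPlus t \<longleftrightarrow> fst t = 3 \<and> AEq (Plus (V 0) (V 1)) (V 2) \<in> snd t"
| "rel_in_type GTimes t \<longleftrightarrow> fst t = 3 \<and> AEq (Times (V 0) (V 1)) (V 2) \<in> snd t"
| "rel_in_type GLe t \<longleftrightarrow> fst t = 2 \<and> ALe (V 0) (V 1) \<in> snd t"
| "rel_in_type (R i) t \<longleftrightarrow> t = type_at i"

lemma length3: "length xs = 3 \<longleftrightarrow> (\<exists>x y z. xs = [x, y, z])"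
  by (auto simp: length_Suc_conv numeral_3_eq_3)

lemma length2: "length xs = 2 \<longleftrightarrow> (\<exists>x y. xs = [x, y])"
  by (auto simp: length_Suc_conv numeral_2_eq_2)

lemma length1: "length xs = 1 \<longleftrightarrow> (\<exists>x. xs = [x])"
  by (auto simp: length_Suc_conv)

lemma rel_jump_of: "L \<in> countable_LO \<Longrightarrow> rel (jump_of L) s xs \<longleftrightarrow> rel_in_type s (tp L xs)"
proof -
  assume L: "L \<in> countable_LO"
  have len: "fst (tp L xs) = length xs" by (simp add: eqtp_def)
  show ?thesis
  proof (cases s)
    case GZero
    then show ?thesis by (auto simp: jump_of_def omega_jump_def len length1 eqtp_def simp del: One_nat_def)
  next
    case GOne
    then show ?thesis by (auto simp: jump_of_def omega_jump_def len length1 eqtp_def simp del: One_nat_def)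
  next
    case GPlus
    then show ?thesis by (auto simp: jump_of_def omega_jump_def len length3 eqtp_def adom_NL[OF L])
  next
    case GTimes
    then show ?thesis by (auto simp: jump_of_def omega_jump_def len length3 eqtp_def adom_NL[OF L])
  next
    case GLe
    then show ?thesis by (auto simp: jump_of_def omega_jump_def len length2 eqtp_def adom_NL[OF L])
  next
    case (R i)
    have "rel (jump_of L) (R i) xs \<longleftrightarrow> i \<in> realized L \<and> tp L (realizer L i) = tp L xs"
      by (simp add: jump_of_def omega_jump_def bf_tp[OF L] adom_NL[OF L])
    also have "\<dots> \<longleftrightarrow> tp L xs = type_at i"
    proof
      show "tp L xs = type_at i" if "i \<in> realized L \<and> tp L (realizer L i) = tp L xs" using that tp_realizer[of i L] by simp
      show "i \<in> realized L \<and> tp L (realizer L i) = tp L xs" if xs: "tp L xs = type_at i"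
      proof -
        have "i \<in> realized L" unfolding realized_def using xs by blast
        then show ?thesis using tp_realizer[of i L] xs by simp
      qed
    qed
    finally show ?thesis using R by simp
  qed
qed

lemma dom_jump_of: "L \<in> countable_LO \<Longrightarrow> dom (jump_of L) = UNIV"
  by (simp add: jump_of_def omega_jump_def adom_NL)

section \<open>The symbol that defines the generators\<close>

definition gen_tp :: "nat \<times> afm set" where "gen_tp = (1, {p. afm_in 1 p \<and> U (\<lambda>x. asat M [x] p)})"

lemma tp_gen: "L \<in> countable_LO \<Longrightarrow> q \<in> dom L \<Longrightarrow> tp L [gen L q] = gen_tp"
  unfolding gen_tp_def by (rule gen_type)

lemma tp_gen_iff: "L \<in> countable_LO \<Longrightarrow> tp L [x] = gen_tp \<longleftrightarrow> (\<exists>q\<in>dom L. x = gen L q)"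
proof -
  assume L: "L \<in> countable_LO"
  obtain q0 where q0: "q0 \<in> dom L" using dom_ne[OF L] by blast
  show ?thesis using gen_only[OF L q0, of x] tp_gen[OF L] q0 by auto
qed

lemma gen_tp_all_types: "gen_tp \<in> all_types"
proof -
  have "tp omega_LO [gen omega_LO 0] = gen_tp"
    by (rule tp_gen[OF infinite_LO[OF omega_LO]]) (simp add: omega_LO_def)
  then show ?thesis using tp_all_types[OF infinite_LO[OF omega_LO]] by metis
qed

definition gen_index :: nat where "gen_index = type_index gen_tp"

lemma rel_gen_index: "L \<in> countable_LO \<Longrightarrow> rel (jump_of L) (R gen_index) [x] \<longleftrightarrow> (\<exists>q\<in>dom L. x = gen L q)"
  by (simp add: rel_jump_of gen_index_def type_at_index[OF gen_tp_all_types] tp_gen_iff)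

lemma ar_gen_index: "ar gen_index = 1"
  unfolding ar_def gen_index_def type_at_index[OF gen_tp_all_types] by (simp add: gen_tp_def)

section \<open>Quantifier-free definitions over the order from invariance under embeddings\<close>

definition inv_rel :: "((nat, lsym) struct \<Rightarrow> nat list list \<Rightarrow> bool) \<Rightarrow> bool" where
  "inv_rel P \<longleftrightarrow> (\<forall>L\<in>countable_LO. \<forall>L'\<in>countable_LO. \<forall>bs \<pi>.
     emb L L' (set (concat bs)) \<pi> \<longrightarrow> P L bs \<longrightarrow> P L' (map (map \<pi>) bs))"

text \<open>The formula collects the patterns of the positive instances over all countable orders.
  Tuples of equal pattern are related by an embedding, along which \<open>P\<close> is preserved, so
  no negative instance shares a collected pattern, and the formula is uniform in the order.\<close>

lemma inv_family:
  assumes "inv_rel P"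
  shows "\<exists>\<Phi>. (\<forall>ls. qfree (\<Phi> ls) \<and> form_in lo_ar (sum_list ls) (\<Phi> ls)) \<and>
    (\<forall>L\<in>countable_LO. \<forall>bs\<in>lists (lists (dom L)). holds L \<Phi> bs \<longleftrightarrow> P L bs)"
proof -
  define \<Theta> where "\<Theta> ls = {pat L (concat bs) | L bs. L \<in> countable_LO \<and> bs \<in> lists (lists (dom L)) \<and>
    map length bs = ls \<and> P L bs}" for ls
  have "\<forall>ls. \<exists>\<phi>. qfree \<phi> \<and> form_in lo_ar (sum_list ls) \<phi> \<and>
    (\<forall>L e. length e = sum_list ls \<longrightarrow> (sat L e \<phi> \<longleftrightarrow> pat L e \<in> \<Theta> ls))"
    using pat_formula by blast
  then obtain \<Phi> where \<Phi>: "\<And>ls. qfree (\<Phi> ls)" "\<And>ls. form_in lo_ar (sum_list ls) (\<Phi> ls)"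
    "\<And>ls L e. length e = sum_list ls \<Longrightarrow> sat L e (\<Phi> ls) \<longleftrightarrow> pat L e \<in> \<Theta> ls"
    by metis
  have "holds L \<Phi> bs \<longleftrightarrow> P L bs" if L: "L \<in> countable_LO" and bs: "bs \<in> lists (lists (dom L))" for L bs
  proof -
    have "holds L \<Phi> bs \<longleftrightarrow> pat L (concat bs) \<in> \<Theta> (map length bs)"
      unfolding holds_def by (rule \<Phi>(3)) (simp add: length_concat)
    also have "\<dots> \<longleftrightarrow> P L bs"
    proof
      assume "pat L (concat bs) \<in> \<Theta> (map length bs)"
      then obtain L' bs' where L': "L' \<in> countable_LO" "bs' \<in> lists (lists (dom L'))"
        and len: "map length bs' = map length bs" and P: "P L' bs'" and pat: "pat L' (concat bs') = pat L (concat bs)"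
        unfolding \<Theta>_def by auto
      have "length (concat bs') = length (concat bs)" using len by (simp add: length_concat)
      moreover have "concat bs' \<in> lists (dom L')" "concat bs \<in> lists (dom L)" using L'(2) bs by (auto intro!: concat_in_lists)
      ultimately obtain \<pi> where \<pi>: "emb L' L (set (concat bs')) \<pi>" "map \<pi> (concat bs') = concat bs"
        using pat_emb[OF L'(1) L _ _ _ pat] by blast
      then have "P L (map (map \<pi>) bs')" using assms L L'(1) P unfolding inv_rel_def by blast
      then show "P L bs" using map_map_concat[OF \<pi>(2) len] by simp
    next
      assume "P L bs"
      then show "pat L (concat bs) \<in> \<Theta> (map length bs)" unfolding \<Theta>_def using L bs by blast
    qed
    finally show ?thesis .
  qed
  then show ?thesis using \<Phi> by blast
qed

lemma inv_tp: "inv_rel (\<lambda>L bs. Q (tp L (map (elem L) bs)))"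
  unfolding inv_rel_def
proof (intro ballI allI impI)
  fix L L' bs \<pi>
  assume "L \<in> countable_LO" "L' \<in> countable_LO" "emb L L' (set (concat bs)) \<pi>" "Q (tp L (map (elem L) bs))"
  then show "Q (tp L' (map (elem L') (map (map \<pi>) bs)))" using tp_transport[of L L' bs "[]" \<pi>] by simp
qed

lemma eq_tp: "x = y \<longleftrightarrow> AEq (V 0) (V 1) \<in> snd (tp L [x, y])"
  by (simp add: eqtp_def)

text \<open>An equation between an element and a generator is read off from the type of the pair,
  and embeddings preserve this type.\<close>

lemma inv_gen: "inv_rel (\<lambda>L cs. \<exists>b x. cs = [b, [x]] \<and> elem L b = gen L x)"
  unfolding inv_rel_def
proof (intro ballI allI impI)
  fix L L' cs \<pi>
  assume L: "L \<in> countable_LO" "L' \<in> countable_LO" and emb: "emb L L' (set (concat cs)) \<pi>"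
    and "\<exists>b x. cs = [b, [x]] \<and> elem L b = gen L x"
  then obtain b x where cs: "cs = [b, [x]]" "elem L b = gen L x" by blast
  have "set (concat cs) = set (concat [b]) \<union> set [x]" using cs by auto
  then have "tp L' (map (elem L') (map (map \<pi>) [b]) @ map (gen L') (map \<pi> [x])) = tp L (map (elem L) [b] @ map (gen L) [x])"
    using tp_transport[OF L, of "[b]" "[x]" \<pi>] emb by metis
  then have t: "tp L' [elem L' (map \<pi> b), gen L' (\<pi> x)] = tp L [elem L b, gen L x]" by simp
  have "elem L' (map \<pi> b) = gen L' (\<pi> x)"
    using cs(2) eq_tp[of "elem L b" "gen L x" L] eq_tp[of "elem L' (map \<pi> b)" "gen L' (\<pi> x)" L']
    unfolding t by blast
  then show "\<exists>b' x'. map (map \<pi>) cs = [b', [x']] \<and> elem L' b' = gen L' x'" using cs(1) by simp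
qed

section \<open>The interpretation of the order, and the composition formula over the jump\<close>

definition LO_interp :: "(jsym, lsym) interp" where
  "LO_interp = \<lparr>dom_fm = (\<lambda>ls. if ls = [1] then Rel (R gen_index) [0] else Bot),
     eq_fm = (\<lambda>ls. if ls = [1, 1] then And (Rel (R gen_index) [0]) (Eq 0 1) else Bot),
     rel_fm = (\<lambda>_ ls. if ls = [1, 1] then And (And (Rel (R gen_index) [0]) (Rel (R gen_index) [1])) (Rel GLe [0, 1]) else Bot)\<rparr>"

lemma LO_interp_Delta1: "Delta1_interp (jump_ar ar) K LO_interp"
  unfolding Delta1_interp_def LO_interp_def by (auto intro!: qfree_Delta1 simp: ar_gen_index)

definition value_types :: "nat \<Rightarrow> (nat \<times> afm set) set" where
  "value_types m = {tp L (elem L qs # map (gen L) qs) | L qs. L \<in> countable_LO \<and> qs \<in> lists (dom L) \<and> length qs = m}"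

lemma value_types_all_types:
  assumes "t \<in> value_types m"
  shows "t \<in> all_types" "fst t = Suc m"
proof -
  obtain L qs where L: "L \<in> countable_LO" "length qs = m" "t = tp L (elem L qs # map (gen L) qs)"
    using assms unfolding value_types_def by blast
  show "t \<in> all_types" unfolding L(3) by (rule tp_all_types[OF L(1)])
  show "fst t = Suc m" unfolding L(3) by (simp add: eqtp_def L(2))
qed

text \<open>By indiscernibility the type of a value with its arguments depends only on the pattern
  of the arguments. Finiteness is what makes the composition formula a finite disjunction of symbols
  \<open>R i\<close>, and so quantifier-free, instead of an infinitary one.\<close>

lemma finite_value_types: "finite (value_types m)"
proof -
  define F where "F \<tau> = (SOME t. \<exists>L qs. L \<in> countable_LO \<and> qs \<in> lists (dom L) \<and> length qs = m \<and>
    pat L qs = \<tau> \<and> t = tp L (elem L qs # map (gen L) qs))" for \<tau>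
  have "t \<in> F ` Pow ({..<m} \<times> {..<m})" if t: "t \<in> value_types m" for t
  proof -
    obtain L qs where L: "L \<in> countable_LO" "qs \<in> lists (dom L)" "length qs = m" "t = tp L (elem L qs # map (gen L) qs)"
      using t unfolding value_types_def by blast
    have "\<exists>t L' qs'. L' \<in> countable_LO \<and> qs' \<in> lists (dom L') \<and> length qs' = m \<and>
      pat L' qs' = pat L qs \<and> t = tp L' (elem L' qs' # map (gen L') qs')" using L by blast
    from someI_ex[OF this] obtain L' qs' where L': "L' \<in> countable_LO" "qs' \<in> lists (dom L')" "length qs' = m"
      "pat L' qs' = pat L qs" "F (pat L qs) = tp L' (elem L' qs' # map (gen L') qs')" unfolding F_def by blast
    obtain \<pi> where \<pi>: "emb L' L (set qs') \<pi>" "map \<pi> qs' = qs"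
      using pat_emb[OF L'(1) L(1) L'(2) L(2) _ L'(4)] L(3) L'(3) by auto
    have "t = F (pat L qs)" using tp_transport[OF L'(1) L(1), of "[qs']" qs' \<pi>] \<pi> L(4) L'(5) by simp
    moreover have "pat L qs \<in> Pow ({..<m} \<times> {..<m})" using L(3) by (auto simp: pat_def)
    ultimately show ?thesis by blast
  qed
  then show ?thesis by (meson finite_Pow_iff finite_SigmaI finite_imageI finite_lessThan finite_subset subsetI)
qed

text \<open>Each argument has the type of a generator and therefore is one; then the graph of
  \<open>fm\<close>, as a formula in the type, fixes the value.\<close>

lemma value_types_iff:
  assumes L: "L \<in> countable_LO"
  shows "tp L (x # ys) \<in> value_types (length ys) \<longleftrightarrow> (\<exists>qs\<in>lists (dom L). ys = map (gen L) qs \<and> x = elem L qs)"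
proof
  assume "tp L (x # ys) \<in> value_types (length ys)"
  then obtain L' qs' where L': "L' \<in> countable_LO" "qs' \<in> lists (dom L')" "length qs' = length ys"
    and eq: "tp L (x # ys) = tp L' (elem L' qs' # map (gen L') qs')" unfolding value_types_def by auto
  have "\<exists>q\<in>dom L. y = gen L q" if y: "y \<in> set ys" for y
  proof -
    obtain i where i: "i < length ys" "y = ys ! i" using y by (metis in_set_conv_nth)
    have "tp L (map ((!) (x # ys)) [Suc i]) = tp L' (map ((!) (elem L' qs' # map (gen L') qs')) [Suc i])"
      by (rule eqtp_map_nth[OF eq]) (use i in simp)
    then have "tp L [y] = tp L' [gen L' (qs' ! i)]" using i L'(3) by simp
    moreover have "qs' ! i \<in> dom L'" using L'(2,3) i by (auto simp: in_lists_conv_set)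
    ultimately show ?thesis using tp_gen_iff[OF L, of y] tp_gen[OF L'(1)] by simp
  qed
  then have "\<forall>y\<in>set ys. \<exists>q. q \<in> dom L \<and> gen L q = y" by blast
  then obtain c where c: "\<forall>y\<in>set ys. c y \<in> dom L \<and> gen L (c y) = y" using bchoice by meson
  define qs where "qs = map c ys"
  have "map (\<lambda>y. gen L (c y)) ys = ys" by (rule map_idI) (use c in blast)
  moreover have "qs \<in> lists (dom L)" using c by (auto simp: qs_def)
  ultimately have qs: "qs \<in> lists (dom L)" "map (gen L) qs = ys" "length qs = length ys"
    by (simp_all add: qs_def o_def)
  obtain p where p: "afm_in (Suc (length ys)) p"
    "\<forall>e x. length e = length ys \<longrightarrow> (asat M (e @ [x]) p \<longleftrightarrow> x = fm (length ys) ((!) e))"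
    using graph_formula[of "length ys"] by (elim exE conjE) (rule that)
  note graph = p(1) p(2)[rule_format]
  \<comment> \<open>\<open>value_types\<close> lists the value first, whereas the graph formula
    expects it last.\<close>
  let ?is = "[1..<Suc (length ys)] @ [0]"
  have perm: "map ((!) (z # zs)) ?is = zs @ [z]" if "length zs = length ys" for z :: nat and zs
  proof -
    have "map ((!) (z # zs)) [1..<Suc (length ys)] = map ((!) zs) [0..<length zs]"
      unfolding One_nat_def map_Suc_upt[symmetric] map_map that by (rule map_cong) simp_all
    then show ?thesis using map_nth[of zs] by simp
  qed
  have "tp L (ys @ [x]) = tp L' (map (gen L') qs' @ [elem L' qs'])"
  proof -
    have "tp L (map ((!) (x # ys)) ?is) = tp L' (map ((!) (elem L' qs' # map (gen L') qs')) ?is)"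
      by (rule eqtp_map_nth[OF eq]) auto
    then show ?thesis using L'(3) by (simp only: perm length_map)
  qed
  moreover have "p \<in> snd (tp L' (map (gen L') qs' @ [elem L' qs']))"
    using graph_NL[OF L'(1) graph L'(2,3)] by simp
  ultimately have "p \<in> snd (tp L (map (gen L) qs @ [x]))" unfolding qs(2) by simp
  then have "x = elem L qs" using graph_NL[OF L graph qs(1,3)] by simp
  then show "\<exists>qs\<in>lists (dom L). ys = map (gen L) qs \<and> x = elem L qs" using qs(1) qs(2)[symmetric] by blast
next
  assume "\<exists>qs\<in>lists (dom L). ys = map (gen L) qs \<and> x = elem L qs"
  then obtain qs where "qs \<in> lists (dom L)" "ys = map (gen L) qs" "x = elem L qs" by blast
  then show "tp L (x # ys) \<in> value_types (length ys)" unfolding value_types_def using L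
    by (intro CollectI exI[of _ L] exI[of _ qs]) simp
qed

text \<open>The composition takes one-element tuples, one for each generator, followed by the value.
  So the only length lists that matter consist of ones, and the last variable \<open>m\<close> holds
  the value, which \<open>value_types\<close> puts in front.\<close>

lemma value_formula: "\<exists>\<Phi>. (\<forall>ls. qfree (\<Phi> ls) \<and> form_in (jump_ar ar) (sum_list ls) (\<Phi> ls)) \<and>
    (\<forall>L\<in>countable_LO. \<forall>bs x. holds (jump_of L) \<Phi> (bs @ [[x]]) \<longleftrightarrow>
      (\<exists>qs\<in>lists (dom L). bs = map (\<lambda>q. [gen L q]) qs \<and> x = elem L qs))"
proof -
  have "\<exists>\<phi>. qfree \<phi> \<and> form_in (jump_ar ar) (Suc m) \<phi> \<and>
    (\<forall>(A :: (nat, jsym) struct) e. sat A e \<phi> \<longleftrightarrow> (\<exists>t\<in>value_types m. rel A (R (type_index t)) (map ((!) e) (m # [0..<m]))))" for m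
  proof -
    have "qdef (jump_ar ar) (Suc m) (\<lambda>A e. \<exists>t\<in>value_types m. rel A (R (type_index t)) (map ((!) e) (m # [0..<m])))"
    proof (rule qdef_ex[OF finite_value_types])
      fix t assume "t \<in> value_types m"
      then have "t \<in> all_types" "fst t = Suc m" by (rule value_types_all_types)+
      then show "qdef (jump_ar ar) (Suc m) (\<lambda>A e. rel A (R (type_index t)) (map ((!) e) (m # [0..<m])))"
        by (intro qdef_rel) (auto simp: ar_def type_at_index)
    qed
    then show ?thesis unfolding qdef_def .
  qed
  then obtain \<phi> where \<phi>: "\<And>m. qfree (\<phi> m)" "\<And>m. form_in (jump_ar ar) (Suc m) (\<phi> m)"
    "\<And>m (A :: (nat, jsym) struct) e. sat A e (\<phi> m) \<longleftrightarrow> (\<exists>t\<in>value_types m. rel A (R (type_index t)) (map ((!) e) (m # [0..<m])))"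
    by metis
  define \<Phi> where "\<Phi> ls = (if \<exists>m. ls = replicate (Suc m) 1 then \<phi> (length ls - 1) else Bot)" for ls :: "nat list"
  have \<Phi>_m: "\<Phi> (replicate (Suc m) 1) = \<phi> m" for m unfolding \<Phi>_def by auto
  have "qfree (\<Phi> ls) \<and> form_in (jump_ar ar) (sum_list ls) (\<Phi> ls)" for ls
  proof (cases "\<exists>m. ls = replicate (Suc m) 1")
    case True
    then obtain m where m: "ls = replicate (Suc m) 1" by blast
    have "sum_list ls = Suc m" unfolding m by (simp add: sum_list_replicate)
    then show ?thesis using \<phi> \<Phi>_m[of m] m by simp
  next
    case False
    then have "\<Phi> ls = Bot" unfolding \<Phi>_def by (rule if_not_P)
    then show ?thesis by simp
  qed
  moreover have "holds (jump_of L) \<Phi> (bs @ [[x]]) \<longleftrightarrow>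
      (\<exists>qs\<in>lists (dom L). bs = map (\<lambda>q. [gen L q]) qs \<and> x = elem L qs)" if L: "L \<in> countable_LO" for L bs x
  proof (cases "\<forall>b\<in>set bs. length b = 1")
    case True
    define ys where "ys = map hd bs"
    have bs: "bs = map (\<lambda>y. [y]) ys" using True by (auto simp: ys_def length_Suc_conv o_def intro!: map_idI[symmetric])
    have "map length (bs @ [[x]]) = replicate (Suc (length ys)) 1"
      unfolding bs by (simp add: o_def map_replicate_const replicate_append_same)
    then have "holds (jump_of L) \<Phi> (bs @ [[x]]) \<longleftrightarrow> sat (jump_of L) (concat (bs @ [[x]])) (\<phi> (length ys))"
      unfolding holds_def by (simp only: \<Phi>_m)
    also have "concat (bs @ [[x]]) = ys @ [x]" unfolding bs by (simp add: concat_map_singleton)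
    also have "sat (jump_of L) (ys @ [x]) (\<phi> (length ys)) \<longleftrightarrow> (\<exists>t\<in>value_types (length ys). rel (jump_of L) (R (type_index t)) (x # ys))"
    proof -
      have "map ((!) (ys @ [x])) (length ys # [0..<length ys]) = x # ys"
        by (auto intro!: nth_equalityI simp: nth_append)
      then show ?thesis unfolding \<phi>(3) by simp
    qed
    also have "\<dots> \<longleftrightarrow> tp L (x # ys) \<in> value_types (length ys)"
    proof -
      have "rel (jump_of L) (R (type_index t)) (x # ys) \<longleftrightarrow> tp L (x # ys) = t" if "t \<in> value_types (length ys)" for t
        by (simp add: rel_jump_of[OF L] type_at_index value_types_all_types(1)[OF that])
      then show ?thesis by blast
    qed
    also have "\<dots> \<longleftrightarrow> (\<exists>qs\<in>lists (dom L). ys = map (gen L) qs \<and> x = elem L qs)" by (rule value_types_iff[OF L])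
    also have "\<dots> \<longleftrightarrow> (\<exists>qs\<in>lists (dom L). bs = map (\<lambda>q. [gen L q]) qs \<and> x = elem L qs)"
    proof -
      have "ys = map (gen L) qs \<longleftrightarrow> bs = map (\<lambda>q. [gen L q]) qs" for qs
        unfolding bs by (auto simp: list_eq_iff_nth_eq)
      then show ?thesis by simp
    qed
    finally show ?thesis .
  next
    case False
    then have "map length (bs @ [[x]]) \<noteq> replicate (Suc m) 1" for m
      by (metis UnCI in_set_replicate image_eqI set_append set_map)
    then have "\<Phi> (map length (bs @ [[x]])) = Bot" unfolding \<Phi>_def by auto
    then show ?thesis using False unfolding holds_def by auto
  qed
  ultimately show ?thesis by blast
qed

section \<open>Verification of the bi-interpretation\<close>

definition LO_coord :: "(nat, lsym) struct \<Rightarrow> nat list \<Rightarrow> nat" where "LO_coord L b = inv_into (dom L) (gen L) (hd b)"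

lemma LO_coord_gen: "L \<in> countable_LO \<Longrightarrow> q \<in> dom L \<Longrightarrow> LO_coord L [gen L q] = q"
  unfolding LO_coord_def using gen_inj by (auto intro!: inv_into_f_f inj_onI)

lemma Dom_LO_interp: "L \<in> countable_LO \<Longrightarrow> Dom (jump_of L) LO_interp = (\<lambda>q. [gen L q]) ` dom L"
proof -
  assume L: "L \<in> countable_LO"
  have "holds (jump_of L) (dom_fm LO_interp) [b] \<longleftrightarrow> b \<in> (\<lambda>q. [gen L q]) ` dom L" for b
  proof (cases "\<exists>x. b = [x]")
    case True
    then obtain x where "b = [x]" by blast
    then show ?thesis using rel_gen_index[OF L, of x] by (auto simp: holds_def LO_interp_def)
  next
    case False
    then have "length b \<noteq> 1" by (auto simp: length_Suc_conv)
    then show ?thesis using False by (auto simp: holds_def LO_interp_def)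
  qed
  then show ?thesis unfolding Dom_def by (auto simp: dom_jump_of[OF L] lists_UNIV)
qed

lemma Sim_LO_interp: "L \<in> countable_LO \<Longrightarrow> Sim (jump_of L) LO_interp = Id_on (Dom (jump_of L) LO_interp)"
proof -
  assume L: "L \<in> countable_LO"
  have "holds (jump_of L) (eq_fm LO_interp) [a, b] \<longleftrightarrow> (\<exists>q\<in>dom L. a = [gen L q] \<and> b = [gen L q])" for a b
  proof (cases "\<exists>x y. a = [x] \<and> b = [y]")
    case True
    then obtain x y where "a = [x]" "b = [y]" by blast
    then show ?thesis using rel_gen_index[OF L, of x] by (auto simp: holds_def LO_interp_def)
  next
    case False
    then have "map length [a, b] \<noteq> [1, 1]" by (auto simp: length_Suc_conv)
    then show ?thesis using False by (auto simp: holds_def LO_interp_def)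
  qed
  then show ?thesis unfolding Sim_def Dom_LO_interp[OF L] by (auto simp: dom_jump_of[OF L] lists_UNIV)
qed

lemma IRel_LO_interp: "L \<in> countable_LO \<Longrightarrow> IRel lo_ar (jump_of L) LO_interp Leq =
  {[[gen L q], [gen L q']] | q q'. q \<in> dom L \<and> q' \<in> dom L \<and> rel L Leq [q, q']}"
proof -
  assume L: "L \<in> countable_LO"
  have GLe: "rel (jump_of L) GLe [x, y] \<longleftrightarrow> ale (NL L) x y" for x y
    by (simp add: jump_of_def omega_jump_def adom_NL[OF L])
  have "holds (jump_of L) (rel_fm LO_interp Leq) [a, b] \<longleftrightarrow>
    (\<exists>q q'. a = [gen L q] \<and> b = [gen L q'] \<and> q \<in> dom L \<and> q' \<in> dom L \<and> rel L Leq [q, q'])" for a b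
  proof (cases "\<exists>x y. a = [x] \<and> b = [y]")
    case True
    then obtain x y where "a = [x]" "b = [y]" by blast
    then show ?thesis using rel_gen_index[OF L, of x] rel_gen_index[OF L, of y] GLe[of x y] gen_le[OF L]
      by (auto simp: holds_def LO_interp_def)
  next
    case False
    then have "map length [a, b] \<noteq> [1, 1]" by (auto simp: length_Suc_conv)
    then show ?thesis using False by (auto simp: holds_def LO_interp_def)
  qed
  then show ?thesis unfolding IRel_def by (auto simp: dom_jump_of[OF L] lists_UNIV length2)
qed

lemma interprets_LO_interp:
  assumes L: "L \<in> countable_LO"
  shows "interprets lo_ar L (jump_of L) LO_interp (LO_coord L)"
  unfolding interprets_def
proof (intro conjI allI ballI impI)
  show "equiv (Dom (jump_of L) LO_interp) (Sim (jump_of L) LO_interp)"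
    unfolding Sim_LO_interp[OF L] by (auto simp: equiv_def refl_on_def sym_def trans_def)
  show "IRel lo_ar (jump_of L) LO_interp s \<subseteq> lists (Dom (jump_of L) LO_interp)" for s
    by (cases s) (auto simp: IRel_LO_interp[OF L] Dom_LO_interp[OF L])
  show "bs \<in> IRel lo_ar (jump_of L) LO_interp s"
    if "as \<in> IRel lo_ar (jump_of L) LO_interp s" "list_all2 (\<lambda>a b. (a, b) \<in> Sim (jump_of L) LO_interp) as bs" for s as bs
  proof -
    have "as = bs" using that(2) unfolding Sim_LO_interp[OF L] by (auto simp: list_all2_conv_all_nth Id_on_iff intro: nth_equalityI)
    then show ?thesis using that(1) by simp
  qed
  show "LO_coord L ` Dom (jump_of L) LO_interp = dom L" unfolding Dom_LO_interp[OF L] by (auto simp: LO_coord_gen[OF L] image_image)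
  show "LO_coord L a = LO_coord L b \<longleftrightarrow> (a, b) \<in> Sim (jump_of L) LO_interp" if "a \<in> Dom (jump_of L) LO_interp" "b \<in> Dom (jump_of L) LO_interp" for a b
    using that unfolding Sim_LO_interp[OF L] Dom_LO_interp[OF L] by (auto simp: LO_coord_gen[OF L])
  show "bs \<in> IRel lo_ar (jump_of L) LO_interp s \<longleftrightarrow> rel L s (map (LO_coord L) bs)"
    if bs: "bs \<in> lists (Dom (jump_of L) LO_interp)" "length bs = lo_ar s" for s bs
  proof (cases s)
    case Leq
    then obtain a b where "bs = [a, b]" using bs(2) by (auto simp: length2)
    moreover obtain q q' where "a = [gen L q]" "b = [gen L q']" "q \<in> dom L" "q' \<in> dom L"
      using bs(1) \<open>bs = [a, b]\<close> unfolding Dom_LO_interp[OF L] by auto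
    ultimately show ?thesis using Leq gen_inj[OF L] by (auto simp: IRel_LO_interp[OF L] LO_coord_gen[OF L])
  qed
qed

text \<open>Stated for arbitrary \<open>K\<close> and \<open>Cls\<close>, so that the full jumps of
  infinite orders and the partial jumps of all orders are handled by the same formulas.\<close>

theorem reducible:
  assumes K: "K \<subseteq> countable_LO" and D: "\<And>L. L \<in> K \<Longrightarrow> jump_of L \<in> Cls"
  shows "reducible_Delta1_biint lo_ar K (jump_ar ar) Cls"
proof -
  obtain \<Phi> where \<Phi>: "\<forall>ls. qfree (\<Phi> ls) \<and> form_in (jump_ar ar) (sum_list ls) (\<Phi> ls)"
    "\<forall>L\<in>countable_LO. \<forall>bs x. holds (jump_of L) \<Phi> (bs @ [[x]]) \<longleftrightarrow>
      (\<exists>qs\<in>lists (dom L). bs = map (\<lambda>q. [gen L q]) qs \<and> x = elem L qs)"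
    using value_formula by (elim exE conjE) (rule that)
  obtain \<Psi> where \<Psi>: "\<forall>ls. qfree (\<Psi> ls) \<and> form_in lo_ar (sum_list ls) (\<Psi> ls)"
    "\<forall>L\<in>countable_LO. \<forall>bs\<in>lists (lists (dom L)). holds L \<Psi> bs \<longleftrightarrow> (\<exists>b x. bs = [b, [x]] \<and> elem L b = gen L x)"
    using inv_family[OF inv_gen] by (elim exE conjE) (rule that)
  obtain E where E: "\<forall>ls. qfree (E ls) \<and> form_in lo_ar (sum_list ls) (E ls)"
    "\<forall>L\<in>countable_LO. \<forall>bs\<in>lists (lists (dom L)). holds L E bs \<longleftrightarrow> AEq (V 0) (V 1) \<in> snd (tp L (map (elem L) bs))"
    using inv_family[OF inv_tp[of "\<lambda>t. AEq (V 0) (V 1) \<in> snd t"]] by (elim exE conjE) (rule that)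
  have "\<forall>s. \<exists>\<Phi>. (\<forall>ls. qfree (\<Phi> ls) \<and> form_in lo_ar (sum_list ls) (\<Phi> ls)) \<and>
    (\<forall>L\<in>countable_LO. \<forall>bs\<in>lists (lists (dom L)). holds L \<Phi> bs \<longleftrightarrow> rel_in_type s (tp L (map (elem L) bs)))"
    using inv_family[OF inv_tp] by (intro allI)
  from choice[OF this] obtain Rl where Rl: "\<forall>s. (\<forall>ls. qfree (Rl s ls) \<and> form_in lo_ar (sum_list ls) (Rl s ls)) \<and>
    (\<forall>L\<in>countable_LO. \<forall>bs\<in>lists (lists (dom L)). holds L (Rl s) bs \<longleftrightarrow> rel_in_type s (tp L (map (elem L) bs)))"
    by (elim exE) (rule that)
  \<comment> \<open>Every tuple from the order, of whatever length, names an element of the model,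
    so the domain formula is always true and all identifications are left to
    \<open>E\<close>.\<close>
  define J :: "(lsym, jsym) interp" where "J = \<lparr>dom_fm = (\<lambda>_. Neg Bot), eq_fm = E, rel_fm = Rl\<rparr>"
  have bi: "bi_interpretation lo_ar L (jump_ar ar) (jump_of L) LO_interp J \<Phi> \<Psi>" if "L \<in> K" for L
  proof -
    have L: "L \<in> countable_LO" using K that by blast
    have Dom_J: "Dom L J = lists (dom L)" by (simp add: Dom_def J_def holds_def)
    have Sim_J: "Sim L J = {(a, b). a \<in> lists (dom L) \<and> b \<in> lists (dom L) \<and> elem L a = elem L b}"
    proof -
      have "holds L E [a, b] \<longleftrightarrow> elem L a = elem L b" if "a \<in> lists (dom L)" "b \<in> lists (dom L)" for a b
      proof -
        have "[a, b] \<in> lists (lists (dom L))" using that by simp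
        then have "holds L E [a, b] \<longleftrightarrow> AEq (V 0) (V 1) \<in> snd (tp L (map (elem L) [a, b]))"
          using bspec[OF bspec[OF E(2) L]] by blast
        then show ?thesis using eq_tp[of "elem L a" "elem L b" L] by simp
      qed
      then show ?thesis unfolding Sim_def J_def by auto
    qed
    have IRel_J: "IRel (jump_ar ar) L J s =
        {bs \<in> lists (lists (dom L)). length bs = jump_ar ar s \<and> rel (jump_of L) s (map (elem L) bs)}" for s
    proof -
      have "holds L (Rl s) bs \<longleftrightarrow> rel (jump_of L) s (map (elem L) bs)" if "bs \<in> lists (lists (dom L))" for bs
        unfolding rel_jump_of[OF L] using bspec[OF bspec[OF conjunct2[OF spec[OF Rl]] L] that] .
      then show ?thesis unfolding IRel_def J_def by auto
    qed
    have "interprets (jump_ar ar) (jump_of L) L J (elem L)"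
      unfolding interprets_def Dom_J Sim_J IRel_J
    proof (intro conjI allI ballI impI)
      show "equiv (lists (dom L)) {(a, b). a \<in> lists (dom L) \<and> b \<in> lists (dom L) \<and> elem L a = elem L b}"
        by (auto simp: equiv_def refl_on_def sym_def trans_def)
      show "elem L ` lists (dom L) = dom (jump_of L)" unfolding dom_jump_of[OF L] using elem_surj[OF L] by (metis UNIV_eq_I imageI)
      fix s as bs
      assume as: "as \<in> {bs \<in> lists (lists (dom L)). length bs = jump_ar ar s \<and> rel (jump_of L) s (map (elem L) bs)}"
        and sim: "list_all2 (\<lambda>a b. (a, b) \<in> {(a, b). a \<in> lists (dom L) \<and> b \<in> lists (dom L) \<and> elem L a = elem L b}) as bs"
      have len: "length as = length bs" and nth: "\<forall>i<length bs. bs ! i \<in> lists (dom L) \<and> elem L (as ! i) = elem L (bs ! i)"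
        using sim by (auto simp: list_all2_conv_all_nth)
      have "bs \<in> lists (lists (dom L))"
        unfolding in_lists_conv_set[of bs] using nth by (metis in_set_conv_nth)
      moreover have "map (elem L) as = map (elem L) bs" using len nth by (auto intro: nth_equalityI)
      ultimately show "bs \<in> {bs \<in> lists (lists (dom L)). length bs = jump_ar ar s \<and> rel (jump_of L) s (map (elem L) bs)}"
        using as len by simp
    qed auto
    moreover have "defines_composition L (jump_of L) LO_interp (LO_coord L) J (elem L) \<Phi>"
      unfolding defines_composition_def Dom_J
    proof (intro ballI)
      fix bs x
      have dom: "bs \<in> lists (Dom (jump_of L) LO_interp) \<longleftrightarrow> (\<exists>qs\<in>lists (dom L). bs = map (\<lambda>q. [gen L q]) qs)"
        unfolding Dom_LO_interp[OF L] lists_image by blast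
      have LO_coord: "map (LO_coord L) (map (\<lambda>q. [gen L q]) qs) = qs" if "qs \<in> lists (dom L)" for qs
        using that LO_coord_gen[OF L] by (auto simp: in_lists_conv_set intro!: map_idI)
      show "holds (jump_of L) \<Phi> (bs @ [[x]]) \<longleftrightarrow>
          bs \<in> lists (Dom (jump_of L) LO_interp) \<and> map (LO_coord L) bs \<in> lists (dom L) \<and> elem L (map (LO_coord L) bs) = x"
        unfolding bspec[OF \<Phi>(2) L, THEN spec, THEN spec] dom
      proof
        assume "\<exists>qs\<in>lists (dom L). bs = map (\<lambda>q. [gen L q]) qs \<and> x = elem L qs"
        then obtain qs where qs: "qs \<in> lists (dom L)" "bs = map (\<lambda>q. [gen L q]) qs" "x = elem L qs" by blast
        then have "map (LO_coord L) bs = qs" using LO_coord by blast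
        then show "(\<exists>qs\<in>lists (dom L). bs = map (\<lambda>q. [gen L q]) qs) \<and>
            map (LO_coord L) bs \<in> lists (dom L) \<and> elem L (map (LO_coord L) bs) = x" using qs by blast
      next
        assume *: "(\<exists>qs\<in>lists (dom L). bs = map (\<lambda>q. [gen L q]) qs) \<and>
            map (LO_coord L) bs \<in> lists (dom L) \<and> elem L (map (LO_coord L) bs) = x"
        then obtain qs where qs: "qs \<in> lists (dom L)" "bs = map (\<lambda>q. [gen L q]) qs" by blast
        then have "map (LO_coord L) bs = qs" using LO_coord by blast
        then show "\<exists>qs\<in>lists (dom L). bs = map (\<lambda>q. [gen L q]) qs \<and> x = elem L qs" using qs * by blast
      qed
    qed
    moreover have "defines_composition (jump_of L) L J (elem L) LO_interp (LO_coord L) \<Psi>"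
      unfolding defines_composition_def Dom_J Dom_LO_interp[OF L]
    proof (intro ballI)
      fix bs x assume bs: "bs \<in> lists (lists (dom L))" "x \<in> dom L"
      \<comment> \<open>The domain of \<open>LO_interp\<close> consists of 1-tuples, so only a
        single tuple \<open>b\<close> can be mapped back to the order.\<close>
      have "holds L \<Psi> (bs @ [[x]]) \<longleftrightarrow> (\<exists>b. bs = [b] \<and> elem L b = gen L x)"
      proof -
        have "bs @ [[x]] \<in> lists (lists (dom L))" using bs by simp
        then have "holds L \<Psi> (bs @ [[x]]) \<longleftrightarrow> (\<exists>b y. bs @ [[x]] = [b, [y]] \<and> elem L b = gen L y)"
          using bspec[OF bspec[OF \<Psi>(2) L]] by blast
        then show ?thesis by (auto simp: append_eq_Cons_conv)
      qed
      also have "\<dots> \<longleftrightarrow> bs \<in> lists (lists (dom L)) \<and> map (elem L) bs \<in> (\<lambda>q. [gen L q]) ` dom L \<and>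
          LO_coord L (map (elem L) bs) = x"
        using bs LO_coord_gen[OF L] by (auto simp: map_eq_Cons_conv image_iff)
      finally show "holds L \<Psi> (bs @ [[x]]) \<longleftrightarrow> bs \<in> lists (lists (dom L)) \<and>
          map (elem L) bs \<in> (\<lambda>q. [gen L q]) ` dom L \<and> LO_coord L (map (elem L) bs) = x" .
    qed
    ultimately show ?thesis unfolding bi_interpretation_def using interprets_LO_interp[OF L] by blast
  qed
  show ?thesis unfolding reducible_Delta1_biint_def
  proof (intro exI conjI ballI)
    show "jump_of ` K \<subseteq> Cls" using D by blast
    show "Delta1_interp (jump_ar ar) (jump_of ` K) LO_interp" by (rule LO_interp_Delta1)
    show "Delta1 (jump_ar ar) (jump_of ` K) \<Phi>" by (rule qfree_Delta1) (simp_all add: \<Phi>(1))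
    show "Delta1_interp lo_ar K J" unfolding Delta1_interp_def J_def
      using E(1) Rl by (auto intro!: qfree_Delta1)
    show "Delta1 lo_ar K \<Psi>" by (rule qfree_Delta1) (simp_all add: \<Psi>(1))
    show "\<exists>D\<in>jump_of ` K. bi_interpretation lo_ar L (jump_ar ar) D LO_interp J \<Phi> \<Psi>" if "L \<in> K" for L
      using bi[OF that] that by blast
  qed
qed

end

section \<open>Countable models\<close>

text \<open>Renames the domain of a countably infinite model to all of \<open>nat\<close>, the form
  that \<open>arith_full\<close> requires.\<close>

lemma esat_iso:
  assumes N: "arith_struct N" and bij: "bij_betw c (adom N) UNIV" and d: "d = inv_into (adom N) c"
    and M: "M = \<lparr>adom = UNIV, azero = c (azero N), aone = c (aone N), aplus = (\<lambda>x y. c (aplus N (d x) (d y))),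
      atimes = (\<lambda>x y. c (atimes N (d x) (d y))), ale = (\<lambda>x y. ale N (d x) (d y))\<rparr>"
  shows "range \<rho> \<subseteq> adom N \<Longrightarrow> esat M (\<lambda>i. c (\<rho> i)) p \<longleftrightarrow> esat N \<rho> p"
proof -
  have dc: "d (c x) = x" if "x \<in> adom N" for x using that bij unfolding d bij_betw_def by simp
  have tv: "tval N \<rho> t \<in> adom N \<and> tval M (\<lambda>i. c (\<rho> i)) t = c (tval N \<rho> t)" if "range \<rho> \<subseteq> adom N" for \<rho> t
    using N that by (induction t) (auto simp: arith_struct_def M dc)
  show "range \<rho> \<subseteq> adom N \<Longrightarrow> esat M (\<lambda>i. c (\<rho> i)) p \<longleftrightarrow> esat N \<rho> p"
  proof (induction p arbitrary: \<rho>)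
    case (AEq s t)
    then show ?case using tv[of \<rho> s] tv[of \<rho> t] dc by simp metis
  next
    case (ALe s t)
    then show ?case using tv[of \<rho> s] tv[of \<rho> t] dc by (simp add: M)
  next
    case (AEx p)
    have *: "case_nat (c x) (\<lambda>i. c (\<rho> i)) = (\<lambda>i. c (case_nat x \<rho> i))" for x
      by (rule ext) (simp split: nat.split)
    have "range (case_nat x \<rho>) \<subseteq> adom N" if "x \<in> adom N" for x
      using AEx.prems that by (auto simp: image_subset_iff split: nat.split)
    then have "esat M (case_nat (c x) (\<lambda>i. c (\<rho> i))) p \<longleftrightarrow> esat N (case_nat x \<rho>) p" if "x \<in> adom N" for x
      using AEx.IH that unfolding * by blast
    moreover have "adom M = c ` adom N" using bij by (simp add: bij_betw_def M)
    ultimately show ?case by simp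
  qed simp_all
qed

text \<open>The first two axioms keep the numerals distinct.\<close>

lemma PA_infinite:
  assumes N: "arith_struct N" and PA: "\<And>p. p \<in> PA \<Longrightarrow> asat N [] p"
  shows "infinite (adom N)"
proof -
  define num where "num n = ((\<lambda>x. aplus N x (aone N)) ^^ n) (azero N)" for n
  have num: "num n \<in> adom N" for n
    using N by (induction n) (auto simp: num_def arith_struct_def)
  have "asat N [] (AAll (ANeg (AEq (Plus (V 0) One) Zero)))" by (rule PA) (simp add: PA_def)
  then have nz: "\<And>x. x \<in> adom N \<Longrightarrow> aplus N x (aone N) \<noteq> azero N" by simp
  have "asat N [] (AAll (AAll (AImp (AEq (Plus (V 1) One) (Plus (V 0) One)) (AEq (V 1) (V 0)))))"
    by (rule PA) (simp add: PA_def)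
  then have inj: "\<And>x y. x \<in> adom N \<Longrightarrow> y \<in> adom N \<Longrightarrow> aplus N x (aone N) = aplus N y (aone N) \<Longrightarrow> x = y" by auto
  have num_Suc: "num (Suc n) = aplus N (num n) (aone N)" for n by (simp add: num_def)
  have "num m \<noteq> num n" if "m < n" for m n
    using that
  proof (induction m arbitrary: n)
    case 0
    then obtain k where "n = Suc k" using gr0_implies_Suc by blast
    then show ?case using nz[OF num[of k]] num_Suc[of k] by (simp add: num_def)
  next
    case (Suc m)
    then obtain k where k: "n = Suc k" "m < k" by (metis Suc_lessE)
    then show ?case using Suc.IH[of k] inj[OF num[of m] num[of k]] num_Suc by metis
  qed
  then have "inj num" by (metis injI nat_neq_iff)
  then show ?thesis using num finite_subset[of "range num" "adom N"] finite_imageD by blast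
qed

lemma model_UNIV:
  assumes "complete_theory T" "extends_PA T"
  shows "\<exists>M :: nat arith. adom M = UNIV \<and> amodel T M"
proof -
  obtain N :: "nat arith" where N: "amodel T N" using assms(1) unfolding complete_theory_def by blast
  have sen: "afm_in 0 p" if "p \<in> T" for p using assms(1) that unfolding complete_theory_def asentences_def by auto
  have "asat N [] p" if "p \<in> PA" for p using assms(2) N that unfolding extends_PA_def aconsequence_def by blast
  then have "infinite (adom N)" using PA_infinite N unfolding amodel_def by blast
  then have bij: "bij_betw (to_nat_on (adom N)) (adom N) UNIV" by (intro to_nat_on_infinite) auto
  define c where "c = to_nat_on (adom N)"
  define d where "d = inv_into (adom N) c"
  define M where "M = \<lparr>adom = UNIV, azero = c (azero N), aone = c (aone N), aplus = (\<lambda>x y. c (aplus N (d x) (d y))),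
      atimes = (\<lambda>x y. c (atimes N (d x) (d y))), ale = (\<lambda>x y. ale N (d x) (d y))\<rparr>"
  have "asat M [] p" if p: "p \<in> T" for p
  proof -
    have "asat M [] p \<longleftrightarrow> esat M (\<lambda>i. c (azero N)) p"
      unfolding asat_esat by (rule esat_cong[OF sen[OF p]]) simp
    also have "\<dots> \<longleftrightarrow> esat N (\<lambda>i. azero N) p"
      by (rule esat_iso[OF _ bij[folded c_def] d_def M_def]) (use N in \<open>auto simp: amodel_def arith_struct_def\<close>)
    also have "\<dots> \<longleftrightarrow> asat N [] p"
      unfolding asat_esat by (rule esat_cong[OF sen[OF p]]) simp
    finally show ?thesis using N p unfolding amodel_def by blast
  qed
  then show ?thesis by (intro exI[of _ M]) (auto simp: amodel_def arith_struct_def M_def)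
qed

text \<open>Both halves share \<open>M\<close>, the ultrafilter and the list of types; they differ
  only in whether a model has to realize the whole list.\<close>

theorem theorem3p1:
  fixes T :: "afm set"
  assumes "complete_theory T" and "extends_PA T"
  shows "\<exists>ar :: nat \<Rightarrow> nat.
    reducible_Delta1_biint lo_ar infinite_countable_LO (jump_ar ar) (omega_jumps T ar) \<and>
    reducible_Delta1_biint lo_ar countable_LO (jump_ar ar) (omega_jumps_partial T ar)"
proof -
  obtain M :: "nat arith" where M: "adom M = UNIV" "amodel T M" using model_UNIV[OF assms] by blast
  interpret pa_model M
    using M assms(2) unfolding extends_PA_def aconsequence_def by unfold_locales auto
  obtain U where "ultra_model M U" using ultra_model_exists by blast
  then interpret ultra_model M U .
  obtain fm where "ultra_enum M U fm" using ultra_enum_exists by blast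
  then interpret ultra_enum M U fm .
  interpret jump_model M U fm T
    using assms M(2) by unfold_locales (auto simp: complete_theory_def amodel_def)
  show ?thesis
    using reducible[of infinite_countable_LO "omega_jumps T ar"] reducible[of countable_LO "omega_jumps_partial T ar"]
      jump_of_full jump_of_partial infinite_LO by blast
qed

end
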